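(* Let $K$ be a field of characteristic different from $2$ and $3$, let $L$ be a Lie superalgebra over $K$, $A\subseteq L$ a subalgebra with $\dim(L/A)\ge 1$, $d:A\to L$ a superderivation of degree $|d|\in\{0,1\}$, and let $H=\langle L,t\mid [t,a]=d(a),\ a\in A\rangle$ be the HNN extension. Let $\{a_i\}$ and $\{x_j\}$ be homogeneous bases of $A$ and of a complement of $A$ in $L$, respectively, indexed by some sets, and fix a total order on $T=\{a_i\}\cup\{x_j\}\cup\{t\}$ such that $a_i<x_j<t$ for all $i,j$; write $i<i'$ when $a_i<a_{i'}$ and $j<j'$ when $x_j<x_{j'}$. Using the notation $A^\alpha$, $X^\beta$ for ordered monomials given in the context: (1) A linear basis of the universal enveloping algebra $U(H)$ consists of the images of the words $$A^{\alpha_0}X^{\beta_0}\cdot\bigl(t^{\gamma_1}X^{\beta_1}\cdot t^{\gamma_2}X^{\beta_2}\cdots t^{\gamma_s}X^{\beta_s}\bigr)\cdot t^{\delta},\qquad s\ge 0,$$ where $|\alpha_0|,|\beta_0|,\delta\ge 0$, $\gamma_i\ge1$ and $|\beta_i|\ge 1$ for $1\le i\le s$, and any odd basis element $x_j$ (or $a_i$) appears in any fixed ordered factor $X^{\beta_k}$ (or $A^{\alpha_0}$) at most once. For $s=0$ the middle product is absent, so the word is $A^{\alpha_0}X^{\beta_0}t^{\delta}$. (2) Fix an admissible bracketing $(u)$ for every super-Lyndon–Shirshov word $u\in T^*$. A linear basis of $H$ consists of the (images of the) monomials (a) the basis elements of $L$, namely $\{a_i\}$, $\{x_j\}$; (b)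 $\{t,[t,t]\}$ (where $[t,t]$ appears only in case $t$ is odd); (c) the monomials with admissible bracketing $(u)$, where $$u=t^{\gamma_1}X^{\beta_1}\cdot t^{\gamma_2}X^{\beta_2}\cdots t^{\gamma_s}X^{\beta_s},\qquad \gamma_i,|\beta_i|\ge 1,\ s\ge 1,$$ ranges over all words of this form (with any odd $x_j$ appearing at most once in each factor $X^{\beta_k}$) that are super-Lyndon–Shirshov words.
   Context: A Lie superalgebra over $K$ is a $\mathbb Z_2$-graded vector space $L=L_0\oplus L_1$ with a bilinear graded bracket satisfying $[x,y]=-(-1)^{|x||y|}[y,x]$ and $[x,[y,z]]=[[x,y],z]+(-1)^{|x||y|}[y,[x,z]]$ for homogeneous elements. All subalgebras and ideals are $\mathbb Z_2$-homogeneous. A superderivation $d:A\to L$ of degree $|d|$ is a linear map with $|d(a)|=|a|+|d|$ and $d([a,b])=[d(a),b]+(-1)^{|d||a|}[a,d(b)]$ for homogeneous $a,b\in A$. $U(H)$ is the universal enveloping (associative) algebra of $H$, in which $[x,y]=xy-(-1)^{|x||y|}yx$ for homogeneous $x,y\in H$. The HNN extension $H=\langle L,t\mid [t,a]=d(a),\ a\in A\rangle$ is the Lie superalgebra generated by $L$ and an additional element $t$ of parity $|t|=|d|$, subject to all relations of $L$ and $[t,a]=d(a)$ for $a\in A$. Equivalently, with $X'=\{a_i\}\cup\{x_j\}$, it is the quotient of the free Lie superalgebra on $T=X'\cup\{t\}$ by the ideal generated by all $[x,y]-\sum_{v\in X'}\alpha_{xy}^v v$ ($x,y\in X'$) and $[t,a_i]-\sum_{v\in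 X'}\beta_{a_i}^v v$, where $\alpha_{xy}^v,\beta_{a_i}^v\in K$ are the coordinates in the basis $X'$ of the bracket of $x,y$ in $L$ and of $d(a_i)$. Ordered monomials: $A^{\alpha}=a_{i_1}^{n_{i_1}}\cdots a_{i_s}^{n_{i_s}}$ with $i_1<\cdots<i_s$, $s\ge0$, $\alpha=(n_{i_1},\dots,n_{i_s})$, $|\alpha|=n_{i_1}+\cdots+n_{i_s}\ge0$; $X^{\beta}=x_{j_1}^{m_{j_1}}\cdots x_{j_s}^{m_{j_s}}$ with $j_1<\cdots<j_s$, $s\ge0$, $\beta=(m_{j_1},\dots,m_{j_s})$, $|\beta|=m_{j_1}+\cdots+m_{j_s}\ge 0$; here $n_i,m_j\ge0$ are integers, and $n_i,m_j\in\{0,1\}$ for odd $a_i$, $x_j$. (The notation suppresses the indices $i_1,\dots,i_s$, $j_1,\dots,j_s$, which may vary from factor to factor.) The free Lie superalgebra on $T$ is the subalgebra generated by $T$ in the free associative algebra $A\langle T\rangle$ with $[x,y]=xy-(-1)^{|x||y|}yx$. $T^*$ is the monoid of words on $T$; a word is odd if it contains an odd number of odd letters, otherwise even. The order extends to $T^*$ lexicographically: $u<1$ for nonempty $u$, and $xv<yw$ ($x,y\in T$) if $x<y$, or $x=y$ and $v<w$. Length-lexicographic order: $u\ll v$ if $u$ is shorter than $v$, or lengths are equal and $u<v$. For $0\ne p\in A\langle T\rangle$, $\overline p$ is the $\ll$-largest word occurring in $p$ and its coefficient is the leading coefficient. A Lyndon–Shirshov word is a nonempty word $w$ with $w=uv>vu$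 for every factorization into nonempty $u,v$; a super-Lyndon–Shirshov word is a Lyndon–Shirshov word or a word $uu$ with $u$ an odd Lyndon–Shirshov word. A bracketing $(u)$ of a super-Lyndon–Shirshov word $u$ (a nonassociative word with underlying word $u$, evaluated with the superbracket) is admissible if $\overline{(u)}=u$ and its leading coefficient equals that of the unique standard bracketing of $u$ (super-Lyndon–Shirshov monomial), namely $1$ if $u$ is a Lyndon–Shirshov word and $2$ if $u=vv$ with $v$ an odd Lyndon–Shirshov word. *)

theory Defs
  imports
    "HOL-Library.Z2"
    "HOL-Library.Poly_Mapping"
    "HOL-Computational_Algebra.Computational_Algebra"
begin

section \<open>Lie superalgebras, subalgebras, superderivations\<close>

text \<open>Degrees in \<open>\<int>/2\<close> are elements of the two-element field \<open>bit\<close>, so that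
  \<open>i + j\<close> is addition modulo 2; \<open>ssign i j\<close> is \<open>(-1)^(i j)\<close>.\<close>

definition ssign :: "bit \<Rightarrow> bit \<Rightarrow> 'k::field" where
  "ssign i j = (if i = 1 \<and> j = 1 then - 1 else 1)"

locale lie_superalgebra = vector_space scale
  for scale :: "'k::field \<Rightarrow> 'l::ab_group_add \<Rightarrow> 'l" +
  fixes gr :: "bit \<Rightarrow> 'l set"
    and br :: "'l \<Rightarrow> 'l \<Rightarrow> 'l"
  assumes gr_subspace: "subspace (gr i)"
    and gr_disjoint: "gr 0 \<inter> gr 1 = {0}"
    and gr_spans: "\<exists>y\<in>gr 0. \<exists>z\<in>gr 1. v = y + z"
    and br_add_left: "br (u + v) w = br u w + br v w"
    and br_add_right: "br u (v + w) = br u v + br u w"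
    and br_scale_left: "br (scale c u) v = scale c (br u v)"
    and br_scale_right: "br u (scale c v) = scale c (br u v)"
    and br_graded: "u \<in> gr i \<Longrightarrow> v \<in> gr j \<Longrightarrow> br u v \<in> gr (i + j)"
    and br_skew: "u \<in> gr i \<Longrightarrow> v \<in> gr j \<Longrightarrow> br u v = scale (- ssign i j) (br v u)"
    and br_jacobi: "u \<in> gr i \<Longrightarrow> v \<in> gr j \<Longrightarrow> w \<in> gr m \<Longrightarrow>
      br u (br v w) = br (br u v) w + scale (ssign i j) (br v (br u w))"

definition lie_subalgebra ::
  "('k::field \<Rightarrow> 'l::ab_group_add \<Rightarrow> 'l) \<Rightarrow> (bit \<Rightarrow> 'l set) \<Rightarrow> ('l \<Rightarrow> 'l \<Rightarrow> 'l) \<Rightarrow> 'l set \<Rightarrow> bool" where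
  "lie_subalgebra scale gr br A \<longleftrightarrow>
     module.subspace scale A \<and>
     (\<forall>v\<in>A. \<exists>y\<in>A \<inter> gr 0. \<exists>z\<in>A \<inter> gr 1. v = y + z) \<and>
     (\<forall>u\<in>A. \<forall>v\<in>A. br u v \<in> A)"

definition superderivation ::
  "('k::field \<Rightarrow> 'l::ab_group_add \<Rightarrow> 'l) \<Rightarrow> (bit \<Rightarrow> 'l set) \<Rightarrow> ('l \<Rightarrow> 'l \<Rightarrow> 'l) \<Rightarrow>
   'l set \<Rightarrow> bit \<Rightarrow> ('l \<Rightarrow> 'l) \<Rightarrow> bool" where
  "superderivation scale gr br A e d \<longleftrightarrow>
     (\<forall>u\<in>A. \<forall>v\<in>A. d (u + v) = d u + d v) \<and>
     (\<forall>c. \<forall>u\<in>A. d (scale c u) = scale c (d u)) \<and>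
     (\<forall>i. \<forall>u\<in>A \<inter> gr i. d u \<in> gr (i + e)) \<and>
     (\<forall>i j. \<forall>u\<in>A \<inter> gr i. \<forall>v\<in>A \<inter> gr j.
        d (br u v) = br (d u) v + scale (ssign e i) (br u (d v)))"

definition homogeneous_basis ::
  "('k::field \<Rightarrow> 'l::ab_group_add \<Rightarrow> 'l) \<Rightarrow> (bit \<Rightarrow> 'l set) \<Rightarrow> 'l set \<Rightarrow> ('i \<Rightarrow> 'l) \<Rightarrow> 'i set \<Rightarrow> bool" where
  "homogeneous_basis scale gr V b I \<longleftrightarrow>
     inj_on b I \<and> \<not> module.dependent scale (b ` I) \<and> module.span scale (b ` I) = V \<and>
     (\<forall>i\<in>I. b i \<in> gr 0 \<union> gr 1)"

definition complementary :: "'l::ab_group_add set \<Rightarrow> 'l set \<Rightarrow> bool" where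
  "complementary A C \<longleftrightarrow> A \<inter> C = {0} \<and> (\<forall>v. \<exists>y\<in>A. \<exists>z\<in>C. v = y + z)"


section \<open>Vector spaces with explicit carrier, bases, quotients\<close>

text \<open>The HNN extension and its enveloping algebra are quotients depending on term
  parameters, so they live on sets of cosets rather than on types.\<close>

record ('k, 'v) vspace =
  vcarrier :: "'v set"
  vzero :: 'v
  vadd :: "'v \<Rightarrow> 'v \<Rightarrow> 'v"
  vscale :: "'k \<Rightarrow> 'v \<Rightarrow> 'v"

record ('k, 'v) lie_struct = "('k, 'v) vspace" +
  lgrade :: "bit \<Rightarrow> 'v set"
  lbracket :: "'v \<Rightarrow> 'v \<Rightarrow> 'v"

definition lincomb :: "('k, 'v, 'm) vspace_scheme \<Rightarrow> ('s \<Rightarrow> 'k) \<Rightarrow> ('s \<Rightarrow> 'v) \<Rightarrow> 's list \<Rightarrow> 'v" where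
  "lincomb V c f ss = foldr (\<lambda>s. vadd V (vscale V (c s) (f s))) ss (vzero V)"

text \<open>The indexed family \<open>f\<close> on \<open>S\<close> is a basis of \<open>V\<close>; in particular \<open>f\<close> is injective on \<open>S\<close>.\<close>

definition is_basis :: "('k::field, 'v, 'm) vspace_scheme \<Rightarrow> ('s \<Rightarrow> 'v) \<Rightarrow> 's set \<Rightarrow> bool" where
  "is_basis V f S \<longleftrightarrow>
     f ` S \<subseteq> vcarrier V \<and>
     (\<forall>ss c. distinct ss \<and> set ss \<subseteq> S \<and> lincomb V c f ss = vzero V \<longrightarrow> (\<forall>s\<in>set ss. c s = 0)) \<and>
     (\<forall>v\<in>vcarrier V. \<exists>ss c. distinct ss \<and> set ss \<subseteq> S \<and> v = lincomb V c f ss)"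

definition coset :: "'v::ab_group_add set \<Rightarrow> 'v \<Rightarrow> 'v set" where
  "coset W v = (\<lambda>w. v + w) ` W"


section \<open>The free associative superalgebra\<close>

text \<open>Words are lists; concatenation makes the finitely supported functions on words the
  free associative algebra, with the product of \<open>Poly_Mapping\<close>.\<close>

instantiation list :: (type) monoid_add
begin
definition zero_list_def: "(0 :: 'a list) = []"
definition plus_list_def: "u + v = (u @ v :: 'a list)"
instance by standard (simp_all add: zero_list_def plus_list_def)
end

type_synonym ('k, 'x) free_alg = "'x list \<Rightarrow>\<^sub>0 'k"

abbreviation wmono :: "'x list \<Rightarrow> ('k::field, 'x) free_alg" where
  "wmono w \<equiv> Poly_Mapping.single w 1"

definition fscale :: "'k::field \<Rightarrow> ('k, 'x) free_alg \<Rightarrow> ('k, 'x) free_alg" where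
  "fscale c p = Poly_Mapping.map ((*) c) p"

definition free_alg_on :: "'x set \<Rightarrow> ('k::field, 'x) free_alg set" where
  "free_alg_on T = {p. \<forall>w\<in>Poly_Mapping.keys p. set w \<subseteq> T}"

definition word_parity :: "('x \<Rightarrow> bit) \<Rightarrow> 'x list \<Rightarrow> bit" where
  "word_parity par w = sum_list (map par w)"

definition homogeneous :: "('x \<Rightarrow> bit) \<Rightarrow> bit \<Rightarrow> ('k::field, 'x) free_alg set" where
  "homogeneous par i = {p. \<forall>w\<in>Poly_Mapping.keys p. word_parity par w = i}"

definition hom_part :: "('x \<Rightarrow> bit) \<Rightarrow> bit \<Rightarrow> ('k::field, 'x) free_alg \<Rightarrow> ('k, 'x) free_alg" where
  "hom_part par i p =
     (\<Sum>w\<in>{w \<in> Poly_Mapping.keys p. word_parity par w = i}.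
        Poly_Mapping.single w (Poly_Mapping.lookup p w))"

definition superbracket ::
  "('x \<Rightarrow> bit) \<Rightarrow> ('k::field, 'x) free_alg \<Rightarrow> ('k, 'x) free_alg \<Rightarrow> ('k, 'x) free_alg" where
  "superbracket par p q =
     (\<Sum>u\<in>Poly_Mapping.keys p. \<Sum>v\<in>Poly_Mapping.keys q.
        fscale (Poly_Mapping.lookup p u * Poly_Mapping.lookup q v)
          (wmono u * wmono v
           - fscale (ssign (word_parity par u) (word_parity par v)) (wmono v * wmono u)))"

definition graded_subspace :: "('x \<Rightarrow> bit) \<Rightarrow> ('k::field, 'x) free_alg set \<Rightarrow> bool" where
  "graded_subspace par S \<longleftrightarrow>
     0 \<in> S \<and> (\<forall>p\<in>S. \<forall>q\<in>S. p + q \<in> S) \<and> (\<forall>c. \<forall>p\<in>S. fscale c p \<in> S) \<and>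
     (\<forall>i. \<forall>p\<in>S. hom_part par i p \<in> S)"


section \<open>Free Lie superalgebra, ideals, quotients\<close>

definition free_lie :: "'x set \<Rightarrow> ('x \<Rightarrow> bit) \<Rightarrow> ('k::field, 'x) free_alg set" where
  "free_lie T par =
     \<Inter>{S. graded_subspace par S \<and> (\<forall>z\<in>T. wmono [z] \<in> S) \<and>
         (\<forall>p\<in>S. \<forall>q\<in>S. superbracket par p q \<in> S)}"

definition lie_ideal_gen ::
  "'x set \<Rightarrow> ('x \<Rightarrow> bit) \<Rightarrow> ('k::field, 'x) free_alg set \<Rightarrow> ('k, 'x) free_alg set" where
  "lie_ideal_gen T par R =
     \<Inter>{S. graded_subspace par S \<and> R \<subseteq> S \<and>
         (\<forall>f\<in>free_lie T par. \<forall>p\<in>S. superbracket par f p \<in> S \<and> superbracket par p f \<in> S)}"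

definition lie_quotient ::
  "'x set \<Rightarrow> ('x \<Rightarrow> bit) \<Rightarrow> ('k::field, 'x) free_alg set \<Rightarrow> ('k, ('k, 'x) free_alg set) lie_struct" where
  "lie_quotient T par W =
     \<lparr> vcarrier = coset W ` free_lie T par,
       vzero = W,
       vadd = (\<lambda>X Y. {p + q | p q. p \<in> X \<and> q \<in> Y}),
       vscale = (\<lambda>c X. {fscale c p + w | p w. p \<in> X \<and> w \<in> W}),
       lgrade = (\<lambda>i. coset W ` (free_lie T par \<inter> homogeneous par i)),
       lbracket = (\<lambda>X Y. {superbracket par p q + w | p q w. p \<in> X \<and> q \<in> Y \<and> w \<in> W}) \<rparr>"


section \<open>Universal enveloping algebra\<close>

text \<open>The quotient of the free unital associative algebra on the underlying set of \<open>G\<close> by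
  the two-sided ideal which makes \<open>g \<mapsto> wmono [g]\<close> linear (this gives the tensor
  algebra of \<open>G\<close>) and turns the superbracket into the supercommutator.\<close>

definition env_relations :: "('k::field, 'g, 'm) lie_struct_scheme \<Rightarrow> ('k, 'g) free_alg set" where
  "env_relations G =
     {wmono [vadd G g h] - wmono [g] - wmono [h] | g h. g \<in> vcarrier G \<and> h \<in> vcarrier G} \<union>
     {wmono [vscale G c g] - fscale c (wmono [g]) | c g. g \<in> vcarrier G} \<union>
     {wmono [lbracket G g h] - (wmono [g] * wmono [h] - fscale (ssign i j) (wmono [h] * wmono [g]))
        | g h i j. g \<in> lgrade G i \<and> h \<in> lgrade G j}"

definition env_ideal :: "('k::field, 'g, 'm) lie_struct_scheme \<Rightarrow> ('k, 'g) free_alg set" where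
  "env_ideal G =
     \<Inter>{S. env_relations G \<subseteq> S \<and> 0 \<in> S \<and> (\<forall>p\<in>S. \<forall>q\<in>S. p + q \<in> S) \<and>
         (\<forall>f\<in>free_alg_on (vcarrier G). \<forall>p\<in>S. f * p \<in> S \<and> p * f \<in> S)}"

text \<open>Only the vector space structure is recorded; the product is induced by that of the
  free algebra, so a product \<open>g\<^sub>1 \<dots> g\<^sub>n\<close> of elements of \<open>G\<close> is the class of \<open>wmono [g\<^sub>1, \<dots>, g\<^sub>n]\<close>.\<close>

definition enveloping ::
  "('k::field, 'g, 'm) lie_struct_scheme \<Rightarrow> ('k, ('k, 'g) free_alg set) vspace" where
  "enveloping G =
     \<lparr> vcarrier = coset (env_ideal G) ` free_alg_on (vcarrier G),
       vzero = env_ideal G,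
       vadd = (\<lambda>X Y. {p + q | p q. p \<in> X \<and> q \<in> Y}),
       vscale = (\<lambda>c X. {fscale c p + w | p w. p \<in> X \<and> w \<in> env_ideal G}) \<rparr>"

definition env_product :: "('k::field, 'g, 'm) lie_struct_scheme \<Rightarrow> 'g list \<Rightarrow> ('k, 'g) free_alg set" where
  "env_product G gs = coset (env_ideal G) (wmono gs)"


section \<open>The HNN extension\<close>

datatype ('i, 'j) letter = LA 'i | LX 'j | LT

definition A_letters :: "'i set \<Rightarrow> ('i, 'j) letter set" where
  "A_letters I = LA ` I"

definition X_letters :: "'j set \<Rightarrow> ('i, 'j) letter set" where
  "X_letters J = LX ` J"

definition alphabet :: "'i set \<Rightarrow> 'j set \<Rightarrow> ('i, 'j) letter set" where
  "alphabet I J = A_letters I \<union> X_letters J \<union> {LT}"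

text \<open>The value at \<open>LT\<close> is a dummy and is never used.\<close>

primrec letter_val :: "('i \<Rightarrow> 'l::zero) \<Rightarrow> ('j \<Rightarrow> 'l) \<Rightarrow> ('i, 'j) letter \<Rightarrow> 'l" where
  "letter_val a x (LA i) = a i"
| "letter_val a x (LX j) = x j"
| "letter_val a x LT = 0"

definition parity_of :: "(bit \<Rightarrow> 'l set) \<Rightarrow> 'l \<Rightarrow> bit" where
  "parity_of gr v = (if v \<in> gr 0 then 0 else 1)"

primrec letter_parity ::
  "(bit \<Rightarrow> 'l set) \<Rightarrow> ('i \<Rightarrow> 'l) \<Rightarrow> ('j \<Rightarrow> 'l) \<Rightarrow> bit \<Rightarrow> ('i, 'j) letter \<Rightarrow> bit" where
  "letter_parity gr a x e (LA i) = parity_of gr (a i)"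
| "letter_parity gr a x e (LX j) = parity_of gr (x j)"
| "letter_parity gr a x e LT = e"

text \<open>The expansion of an element of \<open>L\<close> in the basis formed by the \<open>a i\<close> and \<open>x j\<close>,
  written as a linear form in the letters.\<close>

definition linear_form ::
  "('k::field \<Rightarrow> 'l::ab_group_add \<Rightarrow> 'l) \<Rightarrow> ('i \<Rightarrow> 'l) \<Rightarrow> 'i set \<Rightarrow> ('j \<Rightarrow> 'l) \<Rightarrow> 'j set \<Rightarrow>
   'l \<Rightarrow> ('k, ('i, 'j) letter) free_alg" where
  "linear_form scale a I x J v =
     (let coord = (\<lambda>z. module.representation scale (a ` I \<union> x ` J) v (letter_val a x z))
      in \<Sum>z\<in>{z \<in> A_letters I \<union> X_letters J. coord z \<noteq> 0}. Poly_Mapping.single [z] (coord z))"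

definition hnn_relations ::
  "('k::field \<Rightarrow> 'l::ab_group_add \<Rightarrow> 'l) \<Rightarrow> (bit \<Rightarrow> 'l set) \<Rightarrow> ('l \<Rightarrow> 'l \<Rightarrow> 'l) \<Rightarrow>
   bit \<Rightarrow> ('l \<Rightarrow> 'l) \<Rightarrow> ('i \<Rightarrow> 'l) \<Rightarrow> 'i set \<Rightarrow> ('j \<Rightarrow> 'l) \<Rightarrow> 'j set \<Rightarrow>
   ('k, ('i, 'j) letter) free_alg set" where
  "hnn_relations scale gr br e d a I x J =
     (let par = letter_parity gr a x e; lin = linear_form scale a I x J in
      {superbracket par (wmono [y]) (wmono [z]) - lin (br (letter_val a x y) (letter_val a x z))
         | y z. y \<in> A_letters I \<union> X_letters J \<and> z \<in> A_letters I \<union> X_letters J} \<union>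
      {superbracket par (wmono [LT]) (wmono [LA i]) - lin (d (a i)) | i. i \<in> I})"

definition hnn_ideal ::
  "('k::field \<Rightarrow> 'l::ab_group_add \<Rightarrow> 'l) \<Rightarrow> (bit \<Rightarrow> 'l set) \<Rightarrow> ('l \<Rightarrow> 'l \<Rightarrow> 'l) \<Rightarrow>
   bit \<Rightarrow> ('l \<Rightarrow> 'l) \<Rightarrow> ('i \<Rightarrow> 'l) \<Rightarrow> 'i set \<Rightarrow> ('j \<Rightarrow> 'l) \<Rightarrow> 'j set \<Rightarrow>
   ('k, ('i, 'j) letter) free_alg set" where
  "hnn_ideal scale gr br e d a I x J =
     lie_ideal_gen (alphabet I J) (letter_parity gr a x e) (hnn_relations scale gr br e d a I x J)"

definition hnn_extension ::
  "('k::field \<Rightarrow> 'l::ab_group_add \<Rightarrow> 'l) \<Rightarrow> (bit \<Rightarrow> 'l set) \<Rightarrow> ('l \<Rightarrow> 'l \<Rightarrow> 'l) \<Rightarrow>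
   bit \<Rightarrow> ('l \<Rightarrow> 'l) \<Rightarrow> ('i \<Rightarrow> 'l) \<Rightarrow> 'i set \<Rightarrow> ('j \<Rightarrow> 'l) \<Rightarrow> 'j set \<Rightarrow>
   ('k, ('k, ('i, 'j) letter) free_alg set) lie_struct" where
  "hnn_extension scale gr br e d a I x J =
     lie_quotient (alphabet I J) (letter_parity gr a x e) (hnn_ideal scale gr br e d a I x J)"


section \<open>Orders on words, Lyndon--Shirshov words, bracketings\<close>

text \<open>\<open>r\<close> is the strict order on letters: \<open>(y, z) \<in> r\<close> means \<open>y < z\<close>. In this
  lexicographic order a proper prefix is larger than its extensions.\<close>

fun lex_less :: "'x rel \<Rightarrow> 'x list \<Rightarrow> 'x list \<Rightarrow> bool" where
  "lex_less r [] v \<longleftrightarrow> False"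
| "lex_less r (y # u) [] \<longleftrightarrow> True"
| "lex_less r (y # u) (z # v) \<longleftrightarrow> (y, z) \<in> r \<or> (y = z \<and> lex_less r u v)"

definition deglex_less :: "'x rel \<Rightarrow> 'x list \<Rightarrow> 'x list \<Rightarrow> bool" where
  "deglex_less r u v \<longleftrightarrow> length u < length v \<or> (length u = length v \<and> lex_less r u v)"

definition leading_word :: "'x rel \<Rightarrow> ('k::field, 'x) free_alg \<Rightarrow> 'x list \<Rightarrow> bool" where
  "leading_word r p w \<longleftrightarrow>
     w \<in> Poly_Mapping.keys p \<and> (\<forall>v\<in>Poly_Mapping.keys p. v \<noteq> w \<longrightarrow> deglex_less r v w)"

definition lyndon_shirshov :: "'x rel \<Rightarrow> 'x list \<Rightarrow> bool" where
  "lyndon_shirshov r w \<longleftrightarrow>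
     w \<noteq> [] \<and> (\<forall>u v. u \<noteq> [] \<and> v \<noteq> [] \<and> w = u @ v \<longrightarrow> lex_less r (v @ u) (u @ v))"

definition super_lyndon_shirshov :: "'x rel \<Rightarrow> ('x \<Rightarrow> bit) \<Rightarrow> 'x list \<Rightarrow> bool" where
  "super_lyndon_shirshov r par w \<longleftrightarrow>
     lyndon_shirshov r w \<or> (\<exists>u. w = u @ u \<and> lyndon_shirshov r u \<and> word_parity par u = 1)"

datatype 'x bracketing = Letter 'x | Bracket "'x bracketing" "'x bracketing"

primrec underlying_word :: "'x bracketing \<Rightarrow> 'x list" where
  "underlying_word (Letter z) = [z]"
| "underlying_word (Bracket s t) = underlying_word s @ underlying_word t"

primrec bracket_value :: "('x \<Rightarrow> bit) \<Rightarrow> 'x bracketing \<Rightarrow> ('k::field, 'x) free_alg" where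
  "bracket_value par (Letter z) = wmono [z]"
| "bracket_value par (Bracket s t) = superbracket par (bracket_value par s) (bracket_value par t)"

text \<open>The leading coefficient required of a bracketing is that of the standard bracketing of
  the super-Lyndon--Shirshov word \<open>u\<close>: 1 if \<open>u\<close> is a Lyndon--Shirshov word and 2 if it is the
  square of an odd one. The first argument only fixes the field.\<close>

definition admissible ::
  "'k::field itself \<Rightarrow> 'x rel \<Rightarrow> ('x \<Rightarrow> bit) \<Rightarrow> 'x list \<Rightarrow> 'x bracketing \<Rightarrow> bool" where
  "admissible _ r par u b \<longleftrightarrow>
     underlying_word b = u \<and>
     leading_word r (bracket_value par b :: ('k, 'x) free_alg) u \<and>
     Poly_Mapping.lookup (bracket_value par b :: ('k, 'x) free_alg) u =
       (if lyndon_shirshov r u then 1 else 2)"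


section \<open>The words and monomials of the basis\<close>

text \<open>Ordered monomials \<open>z\<^sub>1^(n z\<^sub>1) \<dots> z\<^sub>s^(n z\<^sub>s)\<close> with \<open>z\<^sub>1 < \<dots> < z\<^sub>s\<close> in \<open>S\<close>.\<close>

definition ordered_monomials :: "'x rel \<Rightarrow> ('x \<Rightarrow> bit) \<Rightarrow> 'x set \<Rightarrow> 'x list set" where
  "ordered_monomials r par S =
     {concat (map (\<lambda>z. replicate (n z) z) zs) | zs n.
        set zs \<subseteq> S \<and> sorted_wrt (\<lambda>y z. (y, z) \<in> r) zs \<and>
        (\<forall>z\<in>set zs. par z = 1 \<longrightarrow> n z \<le> (1::nat))}"

text \<open>The pairs in \<open>ps\<close> are the \<open>(\<gamma>\<^sub>i, X^\<beta>\<^sub>i)\<close>; \<open>|\<beta>\<^sub>i| \<ge> 1\<close> means that the word is nonempty.\<close>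

definition tX_products ::
  "('i, 'j) letter rel \<Rightarrow> (('i, 'j) letter \<Rightarrow> bit) \<Rightarrow> 'j set \<Rightarrow> nat \<Rightarrow> ('i, 'j) letter list set" where
  "tX_products r par J s =
     {concat (map (\<lambda>(g, b). replicate g LT @ b) ps) | ps.
        length ps = s \<and>
        (\<forall>(g, b)\<in>set ps. g \<ge> 1 \<and> b \<in> ordered_monomials r par (X_letters J) \<and> b \<noteq> [])}"

definition env_basis_words ::
  "('i, 'j) letter rel \<Rightarrow> (('i, 'j) letter \<Rightarrow> bit) \<Rightarrow> 'i set \<Rightarrow> 'j set \<Rightarrow> ('i, 'j) letter list set" where
  "env_basis_words r par I J =
     {\<alpha> @ \<beta> @ w @ replicate \<delta> LT | \<alpha> \<beta> w s \<delta>.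
        \<alpha> \<in> ordered_monomials r par (A_letters I) \<and>
        \<beta> \<in> ordered_monomials r par (X_letters J) \<and>
        w \<in> tX_products r par J s}"

definition hnn_basis_monomials ::
  "('i, 'j) letter rel \<Rightarrow> (('i, 'j) letter \<Rightarrow> bit) \<Rightarrow> 'i set \<Rightarrow> 'j set \<Rightarrow>
   (('i, 'j) letter list \<Rightarrow> ('i, 'j) letter bracketing) \<Rightarrow> ('i, 'j) letter bracketing set" where
  "hnn_basis_monomials r par I J bk =
     Letter ` (A_letters I \<union> X_letters J) \<union>
     {Letter LT} \<union> (if par LT = 1 then {Bracket (Letter LT) (Letter LT)} else {}) \<union>
     {bk u | u s. s \<ge> 1 \<and> u \<in> tX_products r par J s \<and> super_lyndon_shirshov r par u}"

end

theory Submission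
  imports Defs
begin

text \<open>
  Ordering words by length and, among rearrangements of one word, lexicographically, the defining
  relations become the rewriting system \<open>yz \<rightarrow> \<plusminus>zy + [y,z]\<close> (\<open>y > z\<close> in \<open>X'\<close>),
  \<open>yy \<rightarrow> [y,y]/2\<close> (\<open>y\<close> odd) and \<open>ta \<rightarrow> \<plusminus>at + d(a)\<close>. All its overlaps have
  length three, and they resolve because of the super Jacobi identity, the derivation rule and
  \<open>[y,[y,y]] = 0\<close> for odd \<open>y\<close>. By the diamond lemma the irreducible words form a basis of
  the associative algebra with these relations, which is the enveloping algebra of the HNN extension.

  The admissible bracketings of irreducible super-Lyndon--Shirshov words have distinct irreducible
  leading words, hence are independent. To see that they span the extension \<open>H\<close>, note that every
  irreducible word factors into a chain of such words, so the ordered products of the bracketings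
  already span \<open>U(H)\<close>. An element of \<open>H\<close> outside the span of the bracketings would therefore
  contradict the Poincare--Birkhoff--Witt theorem for \<open>H\<close>; the latter is the first part of the
  theorem with \<open>A = L\<close>, \<open>d = 0\<close>, applied to \<open>H\<close> in place of \<open>L\<close>.
\<close>

section \<open>Linear algebra in the free algebra\<close>

text \<open>The letters form an arbitrary, possibly infinite, totally ordered set, so the
  length-lexicographic order need not be well-founded. Lexicographic comparison is therefore
  confined to rearrangements of one word, of which there are finitely many; this suffices because a
  rule yields at most the transposed pair and a linear form. Division by 2 enters through squares of
  odd letters, and 3 is inverted to get \<open>[y,[y,y]] = 0\<close> from the Jacobi identity. For
  the Lie superalgebra the decisive point is that one element is written in two ways: as an element
  of \<open>H\<close> it is a linear form in the letters of the PBW presentation, while its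
  expansion into products of bracketings becomes a combination of words spelled by chains. Ordering
  a basis of \<open>H\<close> so that the bracketings are compared as their underlying words makes
  these words normal, and uniqueness of the normal form leaves only chains of length one.\<close>

lemma fscale_conv: "fscale c p = Poly_Mapping.single [] c * p"
  by (simp add: fscale_def mult_map_scale_conv_mult zero_list_def)

lemma lookup_fscale [simp]: "Poly_Mapping.lookup (fscale c p) w = c * Poly_Mapping.lookup p w"
  unfolding fscale_def by transfer (simp add: when_def)

lemma wmono_Nil: "wmono [] = 1"
  by (metis zero_list_def single_one)

lemma wmono_mult: "wmono u * wmono v = wmono (u @ v)"
  by (simp add: mult_single plus_list_def)

interpretation falg: vector_space "fscale :: 'k::field \<Rightarrow> ('k, 'x) free_alg \<Rightarrow> ('k, 'x) free_alg"
  by standard (rule poly_mapping_eqI, simp add: lookup_add algebra_simps)+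

lemma free_alg_decomp: "p = (\<Sum>w\<in>Poly_Mapping.keys p. fscale (Poly_Mapping.lookup p w) (wmono w))"
  by (rule poly_mapping_eqI)
    (simp add: lookup_sum lookup_single when_def if_distrib[of "\<lambda>x. _ * x"] in_keys_iff cong: if_cong)

text \<open>The word case is restricted to words occurring in \<open>p\<close>, so the rule also
  serves properties that depend on the support.\<close>

lemma free_alg_induct [case_names zero word add scale]:
  assumes "P 0"
    and "\<And>w. w \<in> Poly_Mapping.keys p \<Longrightarrow> P (wmono w)"
    and "\<And>p q. P p \<Longrightarrow> P q \<Longrightarrow> P (p + q)"
    and "\<And>c p. P p \<Longrightarrow> P (fscale c p)"
  shows "P p"
proof -
  have "P (\<Sum>w\<in>K. fscale (Poly_Mapping.lookup p w) (wmono w))"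
    if "finite K" "K \<subseteq> Poly_Mapping.keys p" for K
    using that by (induction rule: finite_induct) (auto intro!: assms)
  from this[OF finite_keys order_refl] show ?thesis
    using free_alg_decomp[of p] by simp
qed

lemma fscale_mult_left: "fscale c p * q = fscale c (p * q)"
  by (simp add: fscale_conv mult.assoc)

lemma fscale_mult_right: "p * fscale c q = fscale c (p * q)"
proof -
  have "p * Poly_Mapping.single [] c = Poly_Mapping.single [] c * p"
  proof (induction p rule: free_alg_induct)
    case (word w)
    then show ?case by (simp add: mult_single plus_list_def)
  next
    case (scale c' p)
    then show ?case
      by (simp add: fscale_mult_left) (simp add: fscale_conv mult_single plus_list_def mult.commute flip: mult.assoc)
  qed (simp_all add: algebra_simps)
  then show ?thesis by (simp add: fscale_conv flip: mult.assoc)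
qed

lemmas fscale_mult = fscale_mult_left fscale_mult_right

lemma fscale_minus_one: "fscale (-1) p = - p"
  by (rule poly_mapping_eqI) simp

lemma keys_fscale_subset: "Poly_Mapping.keys (fscale c p) \<subseteq> Poly_Mapping.keys p"
  by (auto simp: in_keys_iff)

lemma keys_mult_words:
  "w \<in> Poly_Mapping.keys (p * q) \<Longrightarrow>
    \<exists>u\<in>Poly_Mapping.keys p. \<exists>v\<in>Poly_Mapping.keys q. w = u @ v" for p :: "('k::field, 'x) free_alg"
  using keys_mult[of p q] unfolding plus_list_def by blast

lemma keys_sum_subset:
  "Poly_Mapping.keys (\<Sum>i\<in>I. f i) \<subseteq> (\<Union>i\<in>I. Poly_Mapping.keys (f i))"
proof (induction I rule: infinite_finite_induct)
  case (insert x F)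
  then show ?case using keys_add[of "f x" "\<Sum>i\<in>F. f i"] by auto
qed auto

section \<open>Linear extensions and algebra homomorphisms\<close>

definition lin_ext :: "('x list \<Rightarrow> ('k::field, 'y) free_alg) \<Rightarrow> ('k, 'x) free_alg \<Rightarrow> ('k, 'y) free_alg" where
  "lin_ext F p = (\<Sum>w\<in>Poly_Mapping.keys p. fscale (Poly_Mapping.lookup p w) (F w))"

lemma lin_ext_superset:
  "finite K \<Longrightarrow> Poly_Mapping.keys p \<subseteq> K \<Longrightarrow>
    lin_ext F p = (\<Sum>w\<in>K. fscale (Poly_Mapping.lookup p w) (F w))"
  unfolding lin_ext_def by (rule sum.mono_neutral_left) (auto simp: in_keys_iff)

lemma lin_ext_add [simp]: "lin_ext F (p + q) = lin_ext F p + lin_ext F q"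
  using keys_add[of p q]
  by (simp add: lin_ext_superset[of "Poly_Mapping.keys p \<union> Poly_Mapping.keys q"]
      lookup_add falg.scale_left_distrib sum.distrib)

lemma lin_ext_fscale [simp]: "lin_ext F (fscale c p) = fscale c (lin_ext F p)"
  using lin_ext_superset[OF finite_keys keys_fscale_subset, of F c p]
  by (simp add: lin_ext_def falg.scale_sum_right)

lemma lin_ext_wmono [simp]: "lin_ext F (wmono w) = F w"
  by (simp add: lin_ext_def)

lemma lin_ext_zero [simp]: "lin_ext F 0 = 0"
  by (simp add: lin_ext_def)

lemma lin_ext_diff [simp]: "lin_ext F (p - q) = lin_ext F p - lin_ext F q"
  using lin_ext_add[of F "p - q" q] by simp

lemma lin_ext_sum [simp]: "lin_ext F (\<Sum>i\<in>I. f i) = (\<Sum>i\<in>I. lin_ext F (f i))"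
  by (induction I rule: infinite_finite_induct) simp_all

lemma lin_ext_cong: "(\<And>w. w \<in> Poly_Mapping.keys p \<Longrightarrow> F w = G w) \<Longrightarrow> lin_ext F p = lin_ext G p"
  by (simp add: lin_ext_def)

lemma lin_ext_id [simp]: "lin_ext wmono p = p"
  using free_alg_decomp[of p] by (simp add: lin_ext_def)

definition alg_hom :: "('x \<Rightarrow> ('k::field, 'y) free_alg) \<Rightarrow> ('k, 'x) free_alg \<Rightarrow> ('k, 'y) free_alg" where
  "alg_hom f = lin_ext (\<lambda>w. prod_list (map f w))"

lemma alg_hom_linear [simp]:
  "alg_hom f (p + q) = alg_hom f p + alg_hom f q"
  "alg_hom f (p - q) = alg_hom f p - alg_hom f q"
  "alg_hom f (fscale c p) = fscale c (alg_hom f p)"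
  "alg_hom f 0 = 0"
  "alg_hom f (\<Sum>i\<in>I. g i) = (\<Sum>i\<in>I. alg_hom f (g i))"
  by (simp_all add: alg_hom_def)

lemma alg_hom_wmono: "alg_hom f (wmono w) = prod_list (map f w)"
  by (simp add: alg_hom_def)

lemma alg_hom_mult [simp]: "alg_hom f (p * q) = alg_hom f p * alg_hom f q"
proof (induction p rule: free_alg_induct)
  case (word u)
  show ?case
    by (induction q rule: free_alg_induct)
      (simp_all add: alg_hom_wmono wmono_mult algebra_simps fscale_mult)
qed (simp_all add: algebra_simps fscale_mult)

lemma lin_ext_in_subspace:
  "falg.subspace V \<Longrightarrow> (\<And>w. w \<in> Poly_Mapping.keys p \<Longrightarrow> F w \<in> V) \<Longrightarrow> lin_ext F p \<in> V"
  unfolding lin_ext_def by (intro falg.subspace_sum falg.subspace_scale)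

lemma alg_hom_in_subspace:
  "falg.subspace V \<Longrightarrow> (\<And>w. w \<in> Poly_Mapping.keys p \<Longrightarrow> alg_hom f (wmono w) \<in> V) \<Longrightarrow> alg_hom f p \<in> V"
  by (simp add: alg_hom_def lin_ext_in_subspace)

lemma in_subspace_if_words:
  "falg.subspace V \<Longrightarrow> (\<And>w. w \<in> Poly_Mapping.keys p \<Longrightarrow> wmono w \<in> V) \<Longrightarrow> p \<in> V"
  using lin_ext_in_subspace[of V p wmono] by simp

section \<open>Parity\<close>

lemma ssign_commute: "ssign i j = ssign j i"
  by (auto simp: ssign_def)

lemma ssign_square [simp]: "ssign i j * ssign i j = 1"
  by (auto simp: ssign_def)

lemma ssign_add_left: "ssign (i + j) k = ssign i k * ssign j k"
  by (cases i; cases j; cases k) (auto simp: ssign_def)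

lemma ssign_add_right: "ssign k (i + j) = ssign k i * ssign k j"
  by (cases i; cases j; cases k) (auto simp: ssign_def)

lemma word_parity_simps [simp]:
  "word_parity par [] = 0"
  "word_parity par (x # w) = par x + word_parity par w"
  "word_parity par (u @ v) = word_parity par u + word_parity par v"
  by (simp_all add: word_parity_def)

lemma homogeneous_subspace: "falg.subspace (homogeneous par i)"
proof (rule falg.subspaceI)
  fix p q :: "('a, 'b) free_alg" and c
  assume p: "p \<in> homogeneous par i"
  show "fscale c p \<in> homogeneous par i"
    using p keys_fscale_subset[of c p] by (auto simp: homogeneous_def)
  assume q: "q \<in> homogeneous par i"
  show "p + q \<in> homogeneous par i"
    using p q keys_add[of p q] by (auto simp: homogeneous_def)
qed (simp add: homogeneous_def)

lemma homogeneous_wmono: "wmono w \<in> homogeneous par i \<longleftrightarrow> word_parity par w = i"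
  by (simp add: homogeneous_def)

lemma homogeneous_mult:
  "p \<in> homogeneous par i \<Longrightarrow> q \<in> homogeneous par j \<Longrightarrow> p * q \<in> homogeneous par (i + j)"
  by (fastforce simp: homogeneous_def dest!: keys_mult_words)

lemma homogeneous_disjoint: "p \<in> homogeneous par 0 \<Longrightarrow> p \<in> homogeneous par 1 \<Longrightarrow> p = 0"
  by (rule poly_mapping_eqI) (use zero_neq_one[where ?'a = bit] in \<open>fastforce simp: homogeneous_def in_keys_iff\<close>)

lemma lookup_hom_part [simp]:
  "Poly_Mapping.lookup (hom_part par i p) w =
     (if word_parity par w = i then Poly_Mapping.lookup p w else 0)"
proof -
  have "finite {w \<in> Poly_Mapping.keys p. word_parity par w = i}" by simp
  then show ?thesis
    by (simp add: hom_part_def lookup_sum lookup_single when_def in_keys_iff)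
qed

lemma hom_part_linear [simp]:
  "hom_part par i (p + q) = hom_part par i p + hom_part par i q"
  "hom_part par i (fscale c p) = fscale c (hom_part par i p)"
  "hom_part par i 0 = 0"
  by (rule poly_mapping_eqI, simp add: lookup_add)+

lemma hom_part_homogeneous [intro, simp]: "hom_part par i p \<in> homogeneous par i"
  by (auto simp: homogeneous_def in_keys_iff split: if_splits)

lemma hom_part_eq: "p \<in> homogeneous par j \<Longrightarrow> hom_part par i p = (if i = j then p else 0)"
  by (rule poly_mapping_eqI) (auto simp: homogeneous_def in_keys_iff)

lemma hom_part_decomp: "p = hom_part par 0 p + hom_part par 1 p"
  by (rule poly_mapping_eqI) (auto simp: lookup_add)

text \<open>\<open>hom_part\<close> fixes or annihilates each homogeneous generator, so a span of
  homogeneous elements is graded.\<close>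

lemma span_hom_part:
  assumes "p \<in> falg.span S" "\<And>s. s \<in> S \<Longrightarrow> \<exists>j. s \<in> homogeneous par j"
  shows "hom_part par i p \<in> falg.span S"
  using assms(1)
proof (induction rule: falg.span_induct_alt)
  case base
  then show ?case by (simp add: falg.span_zero)
next
  case (step c s p)
  obtain j where "s \<in> homogeneous par j" using assms(2) step by blast
  then have "hom_part par i s \<in> falg.span S"
    using step by (auto simp: hom_part_eq falg.span_base falg.span_zero)
  then show ?case using step by (simp add: falg.span_add falg.span_scale)
qed

section \<open>The superbracket\<close>

text \<open>As an iterated linear extension the double sum inherits bilinearity from
  \<open>lin_ext\<close>, although its index sets depend on the arguments.\<close>

lemma superbracket_conv:
  "superbracket par p q = lin_ext (\<lambda>u. lin_ext (\<lambda>v. wmono u * wmono v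
     - fscale (ssign (word_parity par u) (word_parity par v)) (wmono v * wmono u)) q) p"
  by (simp add: superbracket_def lin_ext_def falg.scale_sum_right)

lemma superbracket_linear_left [simp]:
  "superbracket par (p + p') q = superbracket par p q + superbracket par p' q"
  "superbracket par (fscale c p) q = fscale c (superbracket par p q)"
  "superbracket par 0 q = 0"
  "superbracket par (p - p') q = superbracket par p q - superbracket par p' q"
  by (simp_all add: superbracket_conv)

lemma lin_ext_pointwise:
  "lin_ext (\<lambda>u. F u + G u) p = lin_ext F p + lin_ext G p"
  "lin_ext (\<lambda>u. fscale c (F u)) p = fscale c (lin_ext F p)"
  "lin_ext (\<lambda>u. F u - G u) p = lin_ext F p - lin_ext G p"
  "lin_ext (\<lambda>u. 0) p = 0"
  by (simp_all add: lin_ext_def sum.distrib sum_subtractf falg.scale_sum_right falg.scale_right_distrib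
      falg.scale_right_diff_distrib mult.commute)

lemma superbracket_linear_right [simp]:
  "superbracket par p (q + q') = superbracket par p q + superbracket par p q'"
  "superbracket par p (fscale c q) = fscale c (superbracket par p q)"
  "superbracket par p 0 = 0"
  "superbracket par p (q - q') = superbracket par p q - superbracket par p q'"
  by (simp_all add: superbracket_conv lin_ext_pointwise falg.scale_right_diff_distrib)

lemma lin_ext_mult:
  "lin_ext (\<lambda>v. p * wmono v) q = p * q"
  "lin_ext (\<lambda>v. wmono v * p) q = q * p"
  by (induction q rule: free_alg_induct) (simp_all add: algebra_simps fscale_mult)

lemma superbracket_homogeneous:
  assumes "p \<in> homogeneous par i" "q \<in> homogeneous par j"
  shows "superbracket par p q = p * q - fscale (ssign i j) (q * p)"
proof -
  have "superbracket par p q = lin_ext (\<lambda>u. lin_ext (\<lambda>v. wmono u * wmono v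
     - fscale (ssign i j) (wmono v * wmono u)) q) p"
    unfolding superbracket_conv using assms
    by (intro lin_ext_cong) (simp add: homogeneous_def)
  also have "\<dots> = p * q - fscale (ssign i j) (q * p)"
    by (simp add: lin_ext_pointwise lin_ext_mult)
  finally show ?thesis .
qed

lemma superbracket_in_homogeneous:
  assumes "p \<in> homogeneous par i" "q \<in> homogeneous par j"
  shows "superbracket par p q \<in> homogeneous par (i + j)"
  unfolding superbracket_homogeneous[OF assms]
  by (intro falg.subspace_diff falg.subspace_scale homogeneous_subspace homogeneous_mult assms
      homogeneous_mult[OF assms(2,1), unfolded add.commute[of j i]])

lemma superbracket_decomp:
  "superbracket par p q =
     superbracket par (hom_part par 0 p) (hom_part par 0 q) + superbracket par (hom_part par 0 p) (hom_part par 1 q) +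
     (superbracket par (hom_part par 1 p) (hom_part par 0 q) + superbracket par (hom_part par 1 p) (hom_part par 1 q))"
  by (metis hom_part_decomp superbracket_linear_left(1) superbracket_linear_right(1))

lemma superbracket_skew:
  assumes "p \<in> homogeneous par i" "q \<in> homogeneous par j"
  shows "superbracket par p q = fscale (- ssign i j) (superbracket par q p)"
  unfolding superbracket_homogeneous[OF assms] superbracket_homogeneous[OF assms(2,1)]
  by (simp add: ssign_commute[of j i] falg.scale_right_diff_distrib)

lemma superbracket_jacobi:
  assumes "p \<in> homogeneous par i" "q \<in> homogeneous par j" "s \<in> homogeneous par k"
  shows "superbracket par p (superbracket par q s) =
    superbracket par (superbracket par p q) s + fscale (ssign i j) (superbracket par q (superbracket par p s))"
proof -
  note sb = superbracket_homogeneous superbracket_in_homogeneous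
  show ?thesis
    unfolding sb(1)[OF assms(1) sb(2)[OF assms(2,3)]] sb(1)[OF sb(2)[OF assms(1,2)] assms(3)]
      sb(1)[OF assms(2) sb(2)[OF assms(1,3)]]
    unfolding sb(1)[OF assms(1,2)] sb(1)[OF assms(1,3)] sb(1)[OF assms(2,3)]
    by (cases i; cases j; cases k) (simp_all add: ssign_def algebra_simps fscale_minus_one)
qed

section \<open>The free Lie superalgebra is spanned by bracketings\<close>

definition lie_monomials :: "'x set \<Rightarrow> ('x \<Rightarrow> bit) \<Rightarrow> ('k::field, 'x) free_alg set" where
  "lie_monomials T par = bracket_value par ` {b. set (underlying_word b) \<subseteq> T}"

lemma bracket_value_homogeneous:
  "bracket_value par b \<in> homogeneous par (word_parity par (underlying_word b))"
proof (induction b)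
  case (Bracket b b')
  then show ?case
    unfolding bracket_value.simps underlying_word.simps word_parity_simps by (rule superbracket_in_homogeneous)
qed (simp add: homogeneous_wmono)

lemma superbracket_span:
  assumes "p \<in> falg.span S" "q \<in> falg.span S'" "falg.subspace V"
    "\<And>s s'. s \<in> S \<Longrightarrow> s' \<in> S' \<Longrightarrow> superbracket par s s' \<in> V"
  shows "superbracket par p q \<in> V"
  using assms(1)
proof (induction rule: falg.span_induct_alt)
  case base
  then show ?case by (simp add: assms falg.subspace_0)
next
  case (step c s p)
  have "superbracket par s q \<in> V"
    using assms(2)
    by (induction rule: falg.span_induct_alt)
      (auto simp: assms falg.subspace_0 step.hyps intro!: falg.subspace_add[OF assms(3)] falg.subspace_scale[OF assms(3)])
  with step.IH show ?case
    by (auto intro!: falg.subspace_add[OF assms(3)] falg.subspace_scale[OF assms(3)])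
qed

lemma graded_subspace_iff:
  "graded_subspace par S \<longleftrightarrow> falg.subspace S \<and> (\<forall>i. \<forall>p\<in>S. hom_part par i p \<in> S)"
  by (auto simp: graded_subspace_def falg.subspace_def)

text \<open>Bracketings are homogeneous and closed under bracketing, so their span is one of the
  graded subalgebras being intersected; conversely each of those contains every bracketing. This
  trades an intersection for a span, on which induction is possible.\<close>

lemma free_lie_eq_span:
  fixes T :: "'a set" and par :: "'a \<Rightarrow> bit"
  shows "free_lie T par = falg.span (lie_monomials T par :: ('b::field, 'a) free_alg set)" (is "_ = falg.span ?L")
proof
  have "graded_subspace par (falg.span ?L)"
    unfolding graded_subspace_iff
    by (auto simp: lie_monomials_def intro!: span_hom_part bracket_value_homogeneous)
  moreover have "wmono [z] \<in> falg.span ?L" if "z \<in> T" for z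
    using that by (auto simp: lie_monomials_def intro!: falg.span_base image_eqI[of _ _ "Letter z"])
  moreover have "superbracket par p q \<in> falg.span ?L"
    if "p \<in> falg.span ?L" "q \<in> falg.span ?L" for p q
    using that(1,2) falg.subspace_span
  proof (rule superbracket_span)
    fix s s' :: "('b, 'a) free_alg"
    assume "s \<in> ?L" "s' \<in> ?L"
    then obtain b b' where "s = bracket_value par b" "s' = bracket_value par b'"
      "set (underlying_word b) \<subseteq> T" "set (underlying_word b') \<subseteq> T"
      by (auto simp: lie_monomials_def)
    then show "superbracket par s s' \<in> falg.span ?L"
      by (auto simp: lie_monomials_def intro!: falg.span_base image_eqI[of _ _ "Bracket b b'"])
  qed
  ultimately show "free_lie T par \<subseteq> falg.span ?L"
    unfolding free_lie_def by (intro Inter_lower) blast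
  show "falg.span ?L \<subseteq> free_lie T par"
    unfolding free_lie_def
  proof (rule Inter_greatest, safe)
    fix S :: "('b, 'a) free_alg set" and p
    assume S: "graded_subspace par S" "\<forall>z\<in>T. wmono [z] \<in> S" "\<forall>p\<in>S. \<forall>q\<in>S. superbracket par p q \<in> S"
      and p: "p \<in> falg.span ?L"
    have "bracket_value par b \<in> S" if "set (underlying_word b) \<subseteq> T" for b
      using that by (induction b) (auto simp: S)
    then have "lie_monomials T par \<subseteq> S" by (auto simp: lie_monomials_def)
    with p show "p \<in> S"
      using S(1) falg.span_minimal by (auto simp: graded_subspace_iff)
  qed
qed

lemma bracket_value_in_free_lie: "set (underlying_word b) \<subseteq> T \<Longrightarrow> bracket_value par b \<in> free_lie T par"
  by (auto simp: free_lie_eq_span lie_monomials_def intro!: falg.span_base)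

lemma letter_in_free_lie: "z \<in> T \<Longrightarrow> wmono [z] \<in> free_lie T par"
  using bracket_value_in_free_lie[of "Letter z"] by simp

lemma free_lie_subspace: "falg.subspace (free_lie T par)"
  by (simp add: free_lie_eq_span)

lemma free_lie_hom_part: "p \<in> free_lie T par \<Longrightarrow> hom_part par i p \<in> free_lie T par"
  unfolding free_lie_eq_span
  by (erule span_hom_part) (auto simp: lie_monomials_def intro: bracket_value_homogeneous)

lemma free_lie_superbracket:
  "p \<in> free_lie T par \<Longrightarrow> q \<in> free_lie T par \<Longrightarrow> superbracket par p q \<in> free_lie T par"
  unfolding free_lie_def by blast

lemma free_alg_on_subspace: "falg.subspace (free_alg_on S)"
  by (rule falg.subspaceI)
    (auto simp: free_alg_on_def dest!: subsetD[OF keys_add] subsetD[OF keys_fscale_subset])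

lemma free_lie_subset:
  fixes T :: "'a set" and par :: "'a \<Rightarrow> bit"
  shows "(free_lie T par :: ('b::field, 'a) free_alg set) \<subseteq> free_alg_on T"
proof -
  have mono: "set (underlying_word b) \<subseteq> T \<Longrightarrow> (bracket_value par b :: ('b, 'a) free_alg) \<in> free_alg_on T" for b
  proof (induction b)
    case (Bracket b b')
    have "superbracket par p q \<in> free_alg_on T" if "p \<in> free_alg_on T" "q \<in> free_alg_on T" for p q :: "('b, 'a) free_alg"
      using that unfolding superbracket_def free_alg_on_def
      by (fastforce dest!: subsetD[OF keys_sum_subset] subsetD[OF keys_fscale_subset] subsetD[OF keys_diff]
          simp: wmono_mult)
    with Bracket show ?case by simp
  qed (simp add: free_alg_on_def)
  show ?thesis
    unfolding free_lie_eq_span by (intro falg.span_minimal free_alg_on_subspace) (use mono in \<open>auto simp: lie_monomials_def\<close>)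
qed

section \<open>Normal forms for quadratic rewriting systems\<close>

lemma lex_less_append_left:
  "irrefl r \<Longrightarrow> lex_less r (p @ u) (p @ v) \<longleftrightarrow> lex_less r u v"
  by (induction p) (auto simp: irrefl_def)

lemma lex_less_append:
  "lex_less r u v \<Longrightarrow> length u \<le> length v \<Longrightarrow> lex_less r (u @ p) (v @ q)"
  by (induction r u v rule: lex_less.induct) auto

lemma lex_less_irrefl: "irrefl r \<Longrightarrow> \<not> lex_less r u u"
  by (induction u) (auto simp: irrefl_def)

lemma lex_less_trans: "trans r \<Longrightarrow> lex_less r u v \<Longrightarrow> lex_less r v w \<Longrightarrow> lex_less r u w"
proof (induction r u v arbitrary: w rule: lex_less.induct)
  case (3 r y u z v)
  then show ?case by (cases w) (auto dest: transD)
qed (auto elim: lex_less.elims)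

lemma lex_less_total:
  "total_on T r \<Longrightarrow> set u \<subseteq> T \<Longrightarrow> set v \<subseteq> T \<Longrightarrow> lex_less r u v \<or> u = v \<or> lex_less r v u"
proof (induction r u v rule: lex_less.induct)
  case (1 r v)
  then show ?case by (cases v) auto
next
  case (3 r y u z v)
  then show ?case by (auto simp: total_on_def)
qed auto

definition word_less :: "'x rel \<Rightarrow> 'x list \<Rightarrow> 'x list \<Rightarrow> bool" where
  "word_less r u v \<longleftrightarrow> length u < length v \<or> (mset u = mset v \<and> lex_less r u v)"

lemma word_less_context:
  assumes "irrefl r" "word_less r u v"
  shows "word_less r (p @ u @ q) (p @ v @ q)"
  using assms lex_less_append[of r u v q q]
  by (auto simp: word_less_def lex_less_append_left dest: mset_eq_length)

lemma word_less_trans: "trans r \<Longrightarrow> word_less r u v \<Longrightarrow> word_less r v w \<Longrightarrow> word_less r u w"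
  by (auto simp: word_less_def dest: lex_less_trans mset_eq_length)

lemma word_less_irrefl: "irrefl r \<Longrightarrow> \<not> word_less r u u"
  by (simp add: word_less_def lex_less_irrefl)

text \<open>Either the length drops, or the number of smaller rearrangements does: by transitivity
  everything below \<open>u\<close> is below \<open>v\<close>, and \<open>u\<close> itself is lost
  by irreflexivity.\<close>

lemma wf_word_less:
  assumes "trans r" "irrefl r"
  shows "wf {(u, v). word_less r u v}"
proof (rule wf_subset)
  let ?below = "\<lambda>w. {v. mset v = mset w \<and> lex_less r v w}"
  show "wf (inv_image (less_than <*lex*> less_than) (\<lambda>w. (length w, card (?below w))))"
    by blast
  have "card (?below u) < card (?below v)" if "mset u = mset v" "lex_less r u v" for u v
  proof (rule psubset_card_mono)
    have "?below v \<subseteq> {w. set w \<subseteq> set v \<and> length w = length v}"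
      by (auto dest: mset_eq_setD mset_eq_length)
    then show "finite (?below v)"
      by (rule finite_subset) (simp add: finite_lists_length_eq)
    have "u \<in> ?below v" "u \<notin> ?below u"
      using that lex_less_irrefl[OF assms(2)] by auto
    moreover have "?below u \<subseteq> ?below v"
      using that lex_less_trans[OF assms(1)] by auto
    ultimately show "?below u \<subset> ?below v" by blast
  qed
  then show "{(u, v). word_less r u v} \<subseteq> inv_image (less_than <*lex*> less_than) (\<lambda>w. (length w, card (?below w)))"
    by (auto simp: word_less_def dest: mset_eq_length)
qed

lemma not_successivelyD: "\<not> successively Q ls \<Longrightarrow> \<exists>p u v q. ls = p @ [u, v] @ q \<and> \<not> Q u v"
proof (induction ls rule: induct_list012)
  case (3 y z w)
  show ?case
  proof (cases "Q y z")
    case False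
    then show ?thesis by (intro exI[of _ "[]"]) auto
  next
    case True
    with 3 obtain p u v q where "z # w = p @ [u, v] @ q" "\<not> Q u v" by auto
    then show ?thesis by (intro exI[of _ "y # p"]) auto
  qed
qed auto

definition relator :: "('x \<Rightarrow> 'x \<Rightarrow> ('k::field, 'x) free_alg) \<Rightarrow> 'x \<Rightarrow> 'x \<Rightarrow> ('k, 'x) free_alg" where
  "relator rhs y z = wmono [y, z] - rhs y z"

text \<open>The part of the ideal spanned by relators in contexts whose leading word is strictly
  below \<open>\<omega>\<close>. A composition lying in it for its own overlap word is trivial in
  the sense of Shirshov, or resolvable relative to the order in the sense of Bergman.\<close>

definition relators_below ::
  "'x rel \<Rightarrow> ('x \<times> 'x) set \<Rightarrow> ('x \<Rightarrow> 'x \<Rightarrow> ('k::field, 'x) free_alg) \<Rightarrow> 'x list \<Rightarrow> ('k, 'x) free_alg set" where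
  "relators_below r P rhs \<omega> =
     falg.span {wmono u * relator rhs y z * wmono v | u y z v. (y, z) \<in> P \<and> word_less r (u @ [y, z] @ v) \<omega>}"

lemma mult_relator_below:
  assumes "(y, z) \<in> P"
    and less: "\<And>u v. u \<in> Poly_Mapping.keys p \<Longrightarrow> v \<in> Poly_Mapping.keys q \<Longrightarrow> word_less r (u @ [y, z] @ v) \<omega>"
  shows "p * relator rhs y z * q \<in> relators_below r P rhs \<omega>"
proof -
  have *: "wmono u * relator rhs y z * q \<in> relators_below r P rhs \<omega>" if "u \<in> Poly_Mapping.keys p" for u
  proof (induction q rule: free_alg_induct)
    case (word v)
    then show ?case
      using that assms(1) less unfolding relators_below_def by (intro falg.span_base) blast
  qed (simp_all add: relators_below_def falg.span_zero falg.span_add falg.span_scale fscale_mult distrib_left)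
  show ?thesis
    by (induction p rule: free_alg_induct)
      (use * in \<open>simp_all add: relators_below_def falg.span_zero falg.span_add falg.span_scale fscale_mult distrib_right\<close>)
qed

text \<open>All left-hand sides are words of length two with one right-hand side each, so
  ambiguities other than disjoint ones are overlaps in a single letter, and words of length three
  are the only ones to check.\<close>

locale rewriting =
  fixes r :: "'x rel" and P :: "('x \<times> 'x) set" and rhs :: "'x \<Rightarrow> 'x \<Rightarrow> ('k::field, 'x) free_alg"
  assumes r_trans: "trans r" and r_irrefl: "irrefl r"
    and rhs_less: "(y, z) \<in> P \<Longrightarrow> u \<in> Poly_Mapping.keys (rhs y z) \<Longrightarrow> word_less r u [y, z]"
    and overlap: "(y, z) \<in> P \<Longrightarrow> (z, w) \<in> P \<Longrightarrow>
      relator rhs y z * wmono [w] - wmono [y] * relator rhs z w \<in> relators_below r P rhs [y, z, w]"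
begin

abbreviation "below \<equiv> relators_below r P rhs"

definition normal :: "'x list \<Rightarrow> bool" where
  "normal = successively (\<lambda>y z. (y, z) \<notin> P)"

lemma not_normalD: "\<not> normal w \<Longrightarrow> \<exists>u y z v. w = u @ [y, z] @ v \<and> (y, z) \<in> P"
  using not_successivelyD[of "\<lambda>y z. (y, z) \<notin> P" w] by (auto simp: normal_def)

lemma reducible_not_normal: "(y, z) \<in> P \<Longrightarrow> \<not> normal (u @ [y, z] @ v)"
  by (auto simp: normal_def successively_append_iff)

lemma below_context:
  assumes "p \<in> below \<omega>"
  shows "wmono u * p * wmono v \<in> below (u @ \<omega> @ v)"
  using assms unfolding relators_below_def[of _ _ _ \<omega>]
proof (induction rule: falg.span_induct_alt)
  case base
  then show ?case by (simp add: relators_below_def falg.span_zero)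
next
  case (step c s p)
  then obtain u' y z v' where *: "s = wmono u' * relator rhs y z * wmono v'" "(y, z) \<in> P"
    "word_less r (u' @ [y, z] @ v') \<omega>" by blast
  have "wmono u * s * wmono v = wmono (u @ u') * relator rhs y z * wmono (v' @ v)"
    by (simp add: *(1) mult.assoc flip: wmono_mult)
  then have "wmono u * s * wmono v \<in> below (u @ \<omega> @ v)"
    using word_less_context[OF r_irrefl *(3), of u v] by (auto intro!: mult_relator_below *(2))
  with step.IH show ?case
    by (simp add: relators_below_def falg.span_add falg.span_scale fscale_mult algebra_simps)
qed

text \<open>The pair to be rewritten is an arbitrary choice; that the result does not depend on it
  is the content of \<open>NF_relator\<close>.\<close>

definition nf :: "'x list \<Rightarrow> ('k, 'x) free_alg" where
  "nf = wfrec {(u, v). word_less r u v} (\<lambda>f w. if normal w then wmono w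
     else case SOME (u, y, z, v). w = u @ [y, z] @ v \<and> (y, z) \<in> P of
       (u, y, z, v) \<Rightarrow> lin_ext f (wmono u * rhs y z * wmono v))"

lemma rhs_context_less:
  assumes "(y, z) \<in> P" "w \<in> Poly_Mapping.keys (wmono u * rhs y z * wmono v)"
  shows "word_less r w (u @ [y, z] @ v)"
proof -
  obtain w' where "w = u @ w' @ v" "w' \<in> Poly_Mapping.keys (rhs y z)"
    using assms(2) by (auto dest!: keys_mult_words)
  then show ?thesis
    using word_less_context[OF r_irrefl rhs_less[OF assms(1)]] by simp
qed

lemma nf_unfold:
  "nf w = (if normal w then wmono w
     else case SOME (u, y, z, v). w = u @ [y, z] @ v \<and> (y, z) \<in> P of
       (u, y, z, v) \<Rightarrow> lin_ext (cut nf {(u, v). word_less r u v} w) (wmono u * rhs y z * wmono v))"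
  unfolding nf_def by (subst wfrec[OF wf_word_less[OF r_trans r_irrefl]]) (rule refl)

lemma nf_normal [simp]: "normal w \<Longrightarrow> nf w = wmono w"
  by (simp add: nf_unfold)

lemma nf_step:
  assumes "\<not> normal w"
  obtains u y z v where "w = u @ [y, z] @ v" "(y, z) \<in> P"
    "nf w = lin_ext nf (wmono u * rhs y z * wmono v)"
proof -
  obtain u y z v where some: "(SOME (u, y, z, v). w = u @ [y, z] @ v \<and> (y, z) \<in> P) = (u, y, z, v)"
    by (rule prod_cases4)
  have "w = u @ [y, z] @ v \<and> (y, z) \<in> P"
    using someI_ex[of "\<lambda>(u, y, z, v). w = u @ [y, z] @ v \<and> (y, z) \<in> P"] not_normalD[OF assms]
    unfolding some by auto
  then have w: "w = u @ [y, z] @ v" and P: "(y, z) \<in> P" by auto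
  have "nf w = lin_ext (cut nf {(u, v). word_less r u v} w) (wmono u * rhs y z * wmono v)"
    using assms by (subst nf_unfold) (simp only: some if_False prod.case)
  \<comment> \<open>Every word of the reduct is smaller than \<open>w\<close>, so the truncation in
    the recursion equation has no effect here.\<close>
  also have "\<dots> = lin_ext nf (wmono u * rhs y z * wmono v)"
    using rhs_context_less[OF P] by (intro lin_ext_cong) (simp add: cut_def w)
  finally show thesis using w P that by blast
qed

abbreviation "NF \<equiv> lin_ext nf"

lemma NF_below:
  assumes "p \<in> below \<omega>"
    and "\<And>u y z v. (y, z) \<in> P \<Longrightarrow> word_less r (u @ [y, z] @ v) \<omega> \<Longrightarrow> NF (wmono u * relator rhs y z * wmono v) = 0"
  shows "NF p = 0"
  using assms(1) unfolding relators_below_def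
  by (induction rule: falg.span_induct_alt) (auto simp: assms(2))

text \<open>The diamond lemma, by induction on the word \<open>u y z v\<close>. Relators in smaller
  contexts are already annihilated, so it is enough that the given reduction of this word and the
  one chosen by \<open>nf\<close> differ by an element of \<open>below\<close> that word.\<close>

lemma NF_relator: "(y, z) \<in> P \<Longrightarrow> NF (wmono u * relator rhs y z * wmono v) = 0"
proof (induction "u @ [y, z] @ v" arbitrary: u y z v rule: wf_induct_rule[OF wf_word_less[OF r_trans r_irrefl]])
  case (1 u y z v)
  have small: "NF p = 0" if "p \<in> below (u @ [y, z] @ v)" for p
    using that by (rule NF_below) (use 1 in auto)
  let ?red = "\<lambda>u y z v. wmono u * rhs y z * wmono v"
  have confluent: "NF (?red u1 y1 z1 v1) = NF (?red u2 y2 z2 v2)"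
    if P: "(y1, z1) \<in> P" "(y2, z2) \<in> P" and w: "u @ [y, z] @ v = u1 @ [y1, z1] @ v1" "u1 @ [y1, z1] @ v1 = u2 @ [y2, z2] @ v2"
      and le: "length u1 \<le> length u2" for u1 y1 z1 v1 u2 y2 z2 v2
  proof -
    obtain m where m: "u2 = u1 @ m" "[y1, z1] @ v1 = m @ [y2, z2] @ v2"
      using w(2) le by (auto simp: append_eq_append_conv2)
    \<comment> \<open>The two pairs coincide, share one letter, or are disjoint.\<close>
    consider "m = []" | "m = [y1]" | m' where "m = [y1, z1] @ m'"
      using m(2) by (cases m rule: list.exhaust; cases "tl m") auto
    then show ?thesis
    proof cases
      case 1
      then show ?thesis using m by simp
    next
      case 2
      then have eq: "u2 = u1 @ [y1]" "z1 = y2" "v1 = z2 # v2" using m by auto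
      have "wmono u1 * (relator rhs y1 z1 * wmono [z2] - wmono [y1] * relator rhs z1 z2) * wmono v2
          \<in> below (u @ [y, z] @ v)"
        unfolding w(1) using below_context[OF overlap[of y1 z1 z2], of u1 v2] P eq by simp
      from small[OF this] have "NF (wmono u1 * (relator rhs y1 z1 * wmono [z2] - wmono [y1] * relator rhs z1 z2) * wmono v2) = 0" .
      moreover have "wmono u1 * (relator rhs y1 z1 * wmono [z2] - wmono [y1] * relator rhs z1 z2) * wmono v2
          = ?red u2 y2 z2 v2 - ?red u1 y1 z1 v1"
      proof -
        have "wmono u2 = wmono u1 * (wmono [y1] :: ('k, 'x) free_alg)" "wmono v1 = wmono [z2] * (wmono v2 :: ('k, 'x) free_alg)"
          "wmono [y1, z1] * (wmono [z2] * (wmono v2 :: ('k, 'x) free_alg)) = wmono [y1] * (wmono [z1, z2] * wmono v2)"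
          by (simp_all add: eq wmono_mult)
        then show ?thesis
          unfolding relator_def eq(2)[symmetric] by (simp add: algebra_simps)
      qed
      ultimately show ?thesis by simp
    next
      case 3
      then have eq: "u2 = u1 @ [y1, z1] @ m'" "v1 = m' @ [y2, z2] @ v2" using m by auto
      \<comment> \<open>For disjoint pairs the doubly rewritten term is added and subtracted: each
        relator then stands beside an already rewritten pair, hence in a smaller context.\<close>
      have "?red u1 y1 z1 m' * relator rhs y2 z2 * wmono v2 \<in> below (u @ [y, z] @ v)"
        using rhs_context_less[OF P(1), of _ u1 m'] word_less_context[OF r_irrefl, of _ _ "[]"] P(2)
        unfolding w(1) eq by (intro mult_relator_below) force+
      moreover have "wmono u1 * relator rhs y1 z1 * (wmono m' * rhs y2 z2 * wmono v2) \<in> below (u @ [y, z] @ v)"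
      proof (rule mult_relator_below[OF P(1)])
        fix u' v'
        assume "u' \<in> Poly_Mapping.keys (wmono u1 :: ('k, 'x) free_alg)" "v' \<in> Poly_Mapping.keys (wmono m' * rhs y2 z2 * wmono v2)"
        then show "word_less r (u' @ [y1, z1] @ v') (u @ [y, z] @ v)"
          using word_less_context[OF r_irrefl rhs_context_less[OF P(2)], of v' m' v2 "u1 @ [y1, z1]" "[]"]
          unfolding w(1) eq by simp
      qed
      ultimately have "NF (?red u1 y1 z1 m' * relator rhs y2 z2 * wmono v2) = 0"
        "NF (wmono u1 * relator rhs y1 z1 * (wmono m' * rhs y2 z2 * wmono v2)) = 0"
        using small by blast+
      moreover have "?red u1 y1 z1 m' * relator rhs y2 z2 * wmono v2 - wmono u1 * relator rhs y1 z1 * (wmono m' * rhs y2 z2 * wmono v2)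
         = ?red u1 y1 z1 v1 - ?red u2 y2 z2 v2"
      proof -
        have "wmono u2 = wmono u1 * wmono [y1, z1] * (wmono m' :: ('k, 'x) free_alg)"
          "wmono v1 = wmono m' * wmono [y2, z2] * (wmono v2 :: ('k, 'x) free_alg)"
          by (simp_all add: eq wmono_mult)
        then show ?thesis
          unfolding relator_def by (simp add: algebra_simps)
      qed
      ultimately show ?thesis
        by (metis lin_ext_diff eq_iff_diff_eq_0)
    qed
  qed
  obtain u0 y0 z0 v0 where c: "u @ [y, z] @ v = u0 @ [y0, z0] @ v0" "(y0, z0) \<in> P"
    "nf (u @ [y, z] @ v) = NF (?red u0 y0 z0 v0)"
    using nf_step reducible_not_normal[OF 1(2)] by metis
  \<comment> \<open>The comparison of reductions assumed an order of the two positions; it is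
    applied in whichever direction fits.\<close>
  have "NF (?red u0 y0 z0 v0) = NF (?red u y z v)"
    using confluent[OF c(2) 1(2) c(1)] confluent[OF 1(2) c(2) refl c(1)] c(1)
    by (metis nat_le_linear)
  then have "NF (wmono (u @ [y, z] @ v)) = NF (?red u y z v)"
    using c(3) by simp
  then show ?case
    by (simp add: relator_def algebra_simps wmono_mult)
qed

text \<open>Rewriting never raises a word, which later lets a normal leading word survive
  normalization.\<close>

lemma nf_keys:
  "w' \<in> Poly_Mapping.keys (nf w) \<Longrightarrow> normal w' \<and> (w' = w \<or> word_less r w' w)"
proof (induction w arbitrary: w' rule: wf_induct_rule[OF wf_word_less[OF r_trans r_irrefl]])
  case (1 w)
  show ?case
  proof (cases "normal w")
    case True
    then show ?thesis using 1 by simp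
  next
    case False
    then obtain u y z v where w: "w = u @ [y, z] @ v" "(y, z) \<in> P" "nf w = NF (wmono u * rhs y z * wmono v)"
      by (rule nf_step)
    obtain w'' where w'': "w'' \<in> Poly_Mapping.keys (wmono u * rhs y z * wmono v)" "w' \<in> Poly_Mapping.keys (nf w'')"
      using 1(2) unfolding w(3) lin_ext_def
      by (blast dest!: subsetD[OF keys_sum_subset] subsetD[OF keys_fscale_subset])
    have "word_less r w'' w" using rhs_context_less[OF w(2) w''(1)] w(1) by simp
    then show ?thesis using 1(1)[of w'' w'] w''(2) word_less_trans[OF r_trans] by blast
  qed
qed

end

section \<open>The rewriting system of an HNN extension\<close>

locale hnn_data = lie_superalgebra scale gr br
  for scale :: "'k::field \<Rightarrow> 'l::ab_group_add \<Rightarrow> 'l" and gr :: "bit \<Rightarrow> 'l set" and br :: "'l \<Rightarrow> 'l \<Rightarrow> 'l" +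
  fixes A :: "'l set" and e :: bit and d :: "'l \<Rightarrow> 'l"
    and a :: "'i \<Rightarrow> 'l" and I :: "'i set" and C :: "'l set" and x :: "'j \<Rightarrow> 'l" and J :: "'j set"
    and r :: "('i, 'j) letter rel"
  assumes char: "CHAR('k) \<noteq> 2" "CHAR('k) \<noteq> 3"
    and A: "lie_subalgebra scale gr br A"
    and d: "superderivation scale gr br A e d"
    and a: "homogeneous_basis scale gr A a I"
    and C: "subspace C" "complementary A C"
    and x: "homogeneous_basis scale gr C x J"
    and r: "strict_linear_order_on (alphabet I J) r"
      "\<And>i j. i \<in> I \<Longrightarrow> j \<in> J \<Longrightarrow> (LA i, LX j) \<in> r"
      "\<And>i. i \<in> I \<Longrightarrow> (LA i, LT) \<in> r"
      "\<And>j. j \<in> J \<Longrightarrow> (LX j, LT) \<in> r"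
begin

abbreviation "par \<equiv> letter_parity gr a x e"
abbreviation "val \<equiv> letter_val a x"
abbreviation "lin \<equiv> linear_form scale a I x J"
abbreviation "Y \<equiv> A_letters I \<union> X_letters J"

lemma two_neq_0: "(2::'k) \<noteq> 0"
proof
  assume "(2::'k) = 0"
  then have "CHAR('k) dvd 2" by (metis of_nat_eq_0_iff_char_dvd of_nat_numeral)
  then show False using char(1) by (metis CHAR_not_1' One_nat_def prime_nat_iff two_is_prime_nat)
qed

lemma three_neq_0: "(3::'k) \<noteq> 0"
proof
  assume "(3::'k) = 0"
  then have "CHAR('k) dvd 3" by (metis of_nat_eq_0_iff_char_dvd of_nat_numeral)
  moreover have "prime (3::nat)" by (simp add: prime_nat_numeral_eq)
  ultimately show False using char(2) by (metis CHAR_not_1' One_nat_def prime_nat_iff)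
qed

lemma LT_notin_Y [simp]: "LT \<notin> Y"
  by (auto simp: A_letters_def X_letters_def)

lemma A_subspace: "subspace A"
  using A by (simp add: lie_subalgebra_def)

section \<open>Coordinates of \<open>L\<close> in the basis of letters\<close>

lemma independent_basis: "independent (val ` Y)"
proof -
  have val: "val ` Y = a ` I \<union> x ` J"
    by (auto simp: A_letters_def X_letters_def image_image image_Un)
  have ia: "independent (a ` I)" and sa: "span (a ` I) = A" and ix: "independent (x ` J)" and sx: "span (x ` J) = C"
    using a x by (auto simp: homogeneous_basis_def)
  show ?thesis
    unfolding val independent_explicit_module
  proof (intro allI impI)
    fix t u v
    assume t: "finite t" "t \<subseteq> a ` I \<union> x ` J" "(\<Sum>v\<in>t. scale (u v) v) = 0" "v \<in> t"
    let ?t1 = "t \<inter> a ` I" and ?t2 = "t - a ` I"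
    have "(\<Sum>v\<in>t. scale (u v) v) = (\<Sum>v\<in>?t1. scale (u v) v) + (\<Sum>v\<in>?t2. scale (u v) v)"
      using t(1) by (subst sum.union_disjoint[symmetric]) (auto intro: arg_cong[where f = "sum _"])
    then have eq: "(\<Sum>v\<in>?t1. scale (u v) v) = - (\<Sum>v\<in>?t2. scale (u v) v)"
      using t(3) by (simp add: eq_neg_iff_add_eq_0)
    have s1: "(\<Sum>v\<in>?t1. scale (u v) v) \<in> A" unfolding sa[symmetric]
      by (rule span_sum, rule span_scale, rule span_base) auto
    have s2: "(\<Sum>v\<in>?t2. scale (u v) v) \<in> C" unfolding sx[symmetric]
      by (rule span_sum, rule span_scale, rule span_base) (use t(2) in auto)
    have "(\<Sum>v\<in>?t1. scale (u v) v) \<in> C"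
      unfolding eq by (rule subspace_neg[OF C(1) s2])
    with s1 have 1: "(\<Sum>v\<in>?t1. scale (u v) v) = 0"
      using C(2) by (auto simp: complementary_def)
    with eq have 2: "(\<Sum>v\<in>?t2. scale (u v) v) = 0" by simp
    show "u v = 0"
    proof (cases "v \<in> a ` I")
      case True
      then show ?thesis using independentD[OF ia _ _ 1] t by auto
    next
      case False
      have "?t2 \<subseteq> x ` J" using t(2) by auto
      then show ?thesis using independentD[OF ix _ _ 2] t(1,4) False by auto
    qed
  qed
qed

lemma span_basis: "span (val ` Y) = UNIV"
proof -
  have "val ` Y = a ` I \<union> x ` J"
    by (auto simp: A_letters_def X_letters_def image_image image_Un)
  then have "span (val ` Y) = {u + v | u v. u \<in> A \<and> v \<in> C}"
    using a x by (simp add: span_Un homogeneous_basis_def)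
  then show ?thesis
    using C(2) by (auto simp: complementary_def) blast
qed

lemma val_neq_0: "y \<in> Y \<Longrightarrow> val y \<noteq> 0"
  using independent_basis dependent_zero by force

lemma inj_val: "inj_on val Y"
proof (rule inj_onI)
  fix y z assume yz: "y \<in> Y" "z \<in> Y" "val y = val z"
  have "val y \<in> A" if "y \<in> A_letters I" for y
    using a that span_base by (fastforce simp: homogeneous_basis_def A_letters_def)
  moreover have "val y \<in> C" if "y \<in> X_letters J" for y
    using x that span_base by (fastforce simp: homogeneous_basis_def X_letters_def)
  ultimately have "y \<in> A_letters I \<longleftrightarrow> z \<in> A_letters I"
    using yz val_neq_0 C(2) by (fastforce simp: complementary_def)
  then show "y = z"
    using yz a x by (auto simp: homogeneous_basis_def A_letters_def X_letters_def dest: inj_onD)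
qed

lemma lookup_lin:
  "Poly_Mapping.lookup (lin v) w =
     (case w of [y] \<Rightarrow> if y \<in> Y then representation (val ` Y) v (val y) else 0 | _ \<Rightarrow> 0)"
proof -
  have eq: "a ` I \<union> x ` J = val ` Y"
    by (auto simp: A_letters_def X_letters_def image_image image_Un)
  let ?K = "{y \<in> Y. representation (val ` Y) v (val y) \<noteq> 0}"
  have "finite (val ` ?K)"
    by (rule finite_subset[OF _ finite_representation]) auto
  then have fin: "finite ?K"
    by (rule finite_imageD) (rule inj_on_subset[OF inj_val], auto)
  have "Poly_Mapping.lookup (lin v) w =
      (\<Sum>y\<in>?K. Poly_Mapping.lookup (Poly_Mapping.single [y] (representation (val ` Y) v (val y))) w)"
    by (simp add: linear_form_def Let_def lookup_sum eq)
  also have "\<dots> = (\<Sum>y\<in>?K. if w = [y] then representation (val ` Y) v (val y) else 0)"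
    by (intro sum.cong) (auto simp: lookup_single when_def)
  also have "\<dots> = (case w of [y] \<Rightarrow> if y \<in> Y then representation (val ` Y) v (val y) else 0 | _ \<Rightarrow> 0)"
    using fin by (auto split: list.split)
  finally show ?thesis .
qed

lemma lin_add: "lin (u + v) = lin u + lin v"
  by (rule poly_mapping_eqI)
    (simp add: lookup_add lookup_lin representation_add[OF independent_basis] span_basis split: list.split)

lemma lin_scale: "lin (scale c v) = fscale c (lin v)"
  by (rule poly_mapping_eqI)
    (simp add: lookup_lin representation_scale[OF independent_basis] span_basis split: list.split)

lemma lin_0 [simp]: "lin 0 = 0"
  using lin_scale[of 0 0] by simp

lemma lin_uminus: "lin (- v) = - lin v"
  using lin_add[of v "- v"] by (simp add: eq_neg_iff_add_eq_0 add.commute)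

lemma lin_val: "y \<in> Y \<Longrightarrow> lin (val y) = wmono [y]"
  by (rule poly_mapping_eqI)
    (use inj_onD[OF inj_val, of _ y] in \<open>auto simp: lookup_lin lookup_single when_def
      representation_basis[OF independent_basis] split: list.split\<close>)

lemma keys_lin: "w \<in> Poly_Mapping.keys (lin v) \<Longrightarrow> \<exists>y\<in>Y. w = [y]"
  by (auto simp: in_keys_iff lookup_lin split: list.splits if_splits)

lemma A_letters_val: "y \<in> A_letters I \<Longrightarrow> val y \<in> A"
  using a span_base by (fastforce simp: homogeneous_basis_def A_letters_def)

lemma span_A_letters: "span (val ` A_letters I) = A"
  using a by (simp add: homogeneous_basis_def A_letters_def image_image)

lemma val_homogeneous: "y \<in> Y \<Longrightarrow> val y \<in> gr (par y)"
  using a x by (auto simp: homogeneous_basis_def A_letters_def X_letters_def parity_of_def)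

lemma gr_unique: "v \<in> gr i \<Longrightarrow> v \<in> gr j \<Longrightarrow> i \<noteq> j \<Longrightarrow> v = 0"
  using gr_disjoint by (cases i; cases j) auto

text \<open>The part of \<open>v\<close> along letters of the other parity lies in
  \<open>gr (1 + i)\<close> and, as a difference of two elements of \<open>gr i\<close>, also in
  \<open>gr i\<close>; hence it vanishes. Linear statements about homogeneous elements thereby
  reduce to letters of one fixed parity.\<close>

lemma span_graded:
  assumes "S \<subseteq> Y" "v \<in> span (val ` S)" "v \<in> gr i"
  shows "v \<in> span (val ` {y \<in> S. par y = i})"
proof -
  let ?S = "\<lambda>j. val ` {y \<in> S. par y = j}"
  have sub: "span (?S j) \<subseteq> gr j" for j
    using assms(1) val_homogeneous by (intro span_minimal gr_subspace) auto
  have "val ` S = ?S i \<union> ?S (1 + i)"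
  proof -
    have "par y = i \<or> par y = 1 + i" for y by (cases i; cases "par y") auto
    then have "S = {y \<in> S. par y = i} \<union> {y \<in> S. par y = 1 + i}" by blast
    then show ?thesis by (metis image_Un)
  qed
  then obtain v0 v1 where v: "v = v0 + v1" "v0 \<in> span (?S i)" "v1 \<in> span (?S (1 + i))"
    using assms(2) by (auto simp: span_Un)
  have "v1 = v - v0" using v(1) by simp
  then have "v1 \<in> gr i" using assms(3) v(2) sub gr_subspace subspace_diff by (metis subsetD)
  moreover have "v1 \<in> gr (1 + i)" using v(3) sub by blast
  moreover have "i \<noteq> 1 + i" by (cases i) auto
  ultimately have "v1 = 0" using gr_unique by blast
  then show ?thesis using v by simp
qed

section \<open>The defining relations as rewriting rules\<close>

definition pairs :: "(('i, 'j) letter \<times> ('i, 'j) letter) set" where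
  "pairs = {(y, z). y \<in> Y \<and> z \<in> Y \<or> y = LT \<and> z \<in> A_letters I}"

text \<open>Among the pairs with a defining relation, these are the reducible ones: descending
  pairs, which include every \<open>t a\<close>, and squares of odd letters.\<close>

definition P :: "(('i, 'j) letter \<times> ('i, 'j) letter) set" where
  "P = {(y, z). (y, z) \<in> pairs \<and> ((z, y) \<in> r \<or> y = z \<and> par y = 1)}"

definition bra :: "('i, 'j) letter \<Rightarrow> ('i, 'j) letter \<Rightarrow> 'l" where
  "bra y z = (if y = LT then d (val z) else br (val y) (val z))"

definition rhs :: "('i, 'j) letter \<Rightarrow> ('i, 'j) letter \<Rightarrow> ('k, ('i, 'j) letter) free_alg" where
  "rhs y z = (if y = z then fscale (1 / 2) (lin (bra y y))
     else fscale (ssign (par y) (par z)) (wmono [z, y]) + lin (bra y z))"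

text \<open>The defining relation itself, for any pair; \<open>rel\<close> is its version with
  leading coefficient 1 for pairs in \<open>P\<close>. The two differ, by the factor 2, only on
  squares of odd letters.\<close>

definition defect :: "('i, 'j) letter \<Rightarrow> ('i, 'j) letter \<Rightarrow> ('k, ('i, 'j) letter) free_alg" where
  "defect y z = wmono [y, z] - fscale (ssign (par y) (par z)) (wmono [z, y]) - lin (bra y z)"

abbreviation "rel \<equiv> relator rhs"

definition defects :: "('k, ('i, 'j) letter) free_alg set" where
  "defects = falg.span {rel y z | y z. (y, z) \<in> P}"

lemma r_trans: "trans r" and r_irrefl: "irrefl r" and r_total: "total_on (alphabet I J) r"
  using r(1) by (auto simp: strict_linear_order_on_def)

lemma r_neq: "(y, z) \<in> r \<Longrightarrow> y \<noteq> z"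
  using r_irrefl by (auto simp: irrefl_def)

lemma Y_less_LT: "y \<in> Y \<Longrightarrow> (y, LT) \<in> r"
  using r by (auto simp: A_letters_def X_letters_def)

lemma P_less: "(y, z) \<in> P \<Longrightarrow> y \<noteq> z \<Longrightarrow> (z, y) \<in> r"
  by (auto simp: P_def)

lemma br_zero [simp]: "br u 0 = 0" "br 0 u = 0"
  using br_scale_right[of u 0 0] br_scale_left[of 0 0 u] by simp_all

lemma even_square: "v \<in> gr 0 \<Longrightarrow> br v v = 0"
proof -
  assume "v \<in> gr 0"
  then have "br v v = - br v v" using br_skew[of v 0 v 0] by (simp add: ssign_def)
  then have "br v v + br v v = 0" by (simp add: eq_neg_iff_add_eq_0)
  moreover have "(2::'k) = 1 + 1" by simp
  ultimately have "scale 2 (br v v) = 0" by (simp only: scale_left_distrib scale_one)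
  then show ?thesis using two_neq_0 by simp
qed

text \<open>For three equal odd arguments the Jacobi identity and skew symmetry combine to
  \<open>3 [v,[v,v]] = 0\<close>; here the characteristic must not be 3.\<close>

lemma odd_cube: "v \<in> gr 1 \<Longrightarrow> br v (br v v) = 0"
proof -
  assume v: "v \<in> gr 1"
  have 0: "br v v \<in> gr 0" using br_graded[OF v v] by simp
  have "br v (br v v) = br (br v v) v - br v (br v v)"
    using br_jacobi[OF v v v] by (simp add: ssign_def)
  moreover have "br (br v v) v = - br v (br v v)"
    using br_skew[OF 0 v] by (simp add: ssign_def)
  ultimately have "br v (br v v) + br v (br v v) + br v (br v v) = 0"
    by (simp add: algebra_simps)
  moreover have "(3::'k) = 1 + 1 + 1" by simp
  ultimately have "scale 3 (br v (br v v)) = 0" by (simp only: scale_left_distrib scale_one)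
  then show ?thesis using three_neq_0 by simp
qed

lemma defect_eq_relator:
  assumes "(y, z) \<in> P"
  shows "defect y z = (if y = z then fscale 2 (rel y z) else rel y z)"
proof (cases "y = z")
  case True
  with assms have "par y = 1" using r_neq by (auto simp: P_def)
  then have "defect y y = wmono [y, y] + wmono [y, y] - lin (bra y y)"
    by (simp add: defect_def ssign_def fscale_minus_one)
  also have "\<dots> = fscale 2 (rel y y)"
    using two_neq_0 falg.scale_left_distrib[of "1::'k" 1 "wmono [y, y]"]
    by (simp add: relator_def rhs_def falg.scale_right_diff_distrib)
  finally show ?thesis using True by simp
qed (simp add: defect_def relator_def rhs_def)

text \<open>An ascending pair gives a scalar multiple of the relation of the reversed pair, by skew
  symmetry, and the square of an even letter gives 0. So the relators of \<open>P\<close> already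
  span all defining relations.\<close>

lemma defect_in_defects:
  assumes "(y, z) \<in> pairs"
  shows "defect y z \<in> defects"
proof -
  have P: "defect y z \<in> defects" if "(y, z) \<in> P" for y z
  proof -
    have "rel y z \<in> defects" unfolding defects_def using that by (auto intro!: falg.span_base)
    then show ?thesis unfolding defect_eq_relator[OF that] by (auto simp: defects_def intro: falg.span_scale)
  qed
  show ?thesis
  proof (cases "y = LT")
    case True
    then show ?thesis using assms Y_less_LT by (intro P) (auto simp: P_def pairs_def)
  next
    case False
    then have Y: "y \<in> Y" "z \<in> Y" using assms by (auto simp: pairs_def)
    then have "(y, z) \<in> r \<or> y = z \<or> (z, y) \<in> r"
      using r_total by (auto simp: total_on_def alphabet_def)
    then consider "(y, z) \<in> P" | "(z, y) \<in> P" "y \<noteq> z" | "y = z" "par y = 0"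
      using Y r_neq by (cases "par y"; force simp: P_def pairs_def)
    then show ?thesis
    proof cases
      case 1
      then show ?thesis by (rule P)
    next
      case 2
      have "lin (bra y z) = - fscale (ssign (par y) (par z)) (lin (bra z y))"
        using br_skew[OF val_homogeneous[OF Y(1)] val_homogeneous[OF Y(2)]] Y LT_notin_Y
        by (auto simp: bra_def simp flip: lin_scale lin_uminus)
      then have "defect y z = - fscale (ssign (par y) (par z)) (defect z y)"
        by (simp add: defect_def falg.scale_right_diff_distrib ssign_commute[of "par z" "par y"])
      then show ?thesis using P[OF 2(1)] by (simp add: defects_def falg.span_scale falg.span_neg)
    next
      case 3
      then have "bra y y = 0" using Y LT_notin_Y val_homogeneous[of y] even_square by (auto simp: bra_def)
      then have "defect y z = 0" using 3 by (simp add: defect_def ssign_def)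
      then show ?thesis by (simp add: defects_def falg.span_zero)
    qed
  qed
qed

text \<open>For letters this is a defining relation, and the expression is bilinear on elements of
  fixed parities. No words surround the relators, which keeps the error term at words of length
  two.\<close>

lemma lin_br:
  assumes "u \<in> gr i" "v \<in> gr j"
  shows "lin u * lin v - fscale (ssign i j) (lin v * lin u) - lin (br u v) \<in> defects"
proof -
  have "u \<in> span (val ` {y \<in> Y. par y = i})" "v \<in> span (val ` {y \<in> Y. par y = j})"
    using span_graded[OF order_refl] assms span_basis by auto
  then show ?thesis
  proof (induction u rule: span_induct_alt)
    case base
    then show ?case by (simp add: defects_def falg.span_zero)
  next
    case (step c s u)
    then obtain y where y: "y \<in> Y" "par y = i" "s = val y" by auto
    have "lin s * lin v - fscale (ssign i j) (lin v * lin s) - lin (br s v) \<in> defects"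
      using step.prems
    proof (induction v rule: span_induct_alt)
      case base
      then show ?case by (simp add: defects_def falg.span_zero)
    next
      case (step c t v)
      then obtain z where z: "z \<in> Y" "par z = j" "t = val z" by auto
      have "lin s * lin t - fscale (ssign i j) (lin t * lin s) - lin (br s t) = defect y z"
        using y z LT_notin_Y by (auto simp: defect_def lin_val wmono_mult bra_def)
      then have "lin s * lin t - fscale (ssign i j) (lin t * lin s) - lin (br s t) \<in> defects"
        using defect_in_defects y z by (auto simp: pairs_def)
      then have "fscale c (lin s * lin t - fscale (ssign i j) (lin t * lin s) - lin (br s t))
          + (lin s * lin v - fscale (ssign i j) (lin v * lin s) - lin (br s v)) \<in> defects"
        using step.IH by (simp add: defects_def falg.span_scale falg.span_add)
      then show ?case
        by (simp add: lin_add lin_scale br_add_right br_scale_right algebra_simps fscale_mult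
            falg.scale_right_distrib falg.scale_right_diff_distrib)
    qed
    then have "fscale c (lin s * lin v - fscale (ssign i j) (lin v * lin s) - lin (br s v))
        + (lin u * lin v - fscale (ssign i j) (lin v * lin u) - lin (br u v)) \<in> defects"
      using step.IH step.prems by (simp add: defects_def falg.span_scale falg.span_add)
    then show ?case
      by (simp add: lin_add lin_scale br_add_left br_scale_left algebra_simps fscale_mult
          falg.scale_right_distrib falg.scale_right_diff_distrib)
  qed
qed

lemma d_linear: "u \<in> A \<Longrightarrow> v \<in> A \<Longrightarrow> d (u + v) = d u + d v" "u \<in> A \<Longrightarrow> d (scale c u) = scale c (d u)"
  and d_graded: "u \<in> A \<Longrightarrow> u \<in> gr i \<Longrightarrow> d u \<in> gr (i + e)"
  and d_br: "u \<in> A \<Longrightarrow> v \<in> A \<Longrightarrow> u \<in> gr i \<Longrightarrow> v \<in> gr j \<Longrightarrow>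
      d (br u v) = br (d u) v + scale (ssign e i) (br u (d v))"
  using d by (simp_all add: superderivation_def)

lemma lin_d:
  assumes "v \<in> A" "v \<in> gr i"
  shows "wmono [LT] * lin v - fscale (ssign e i) (lin v * wmono [LT]) - lin (d v) \<in> defects"
proof -
  have "v \<in> span (val ` {y \<in> A_letters I. par y = i})"
    using span_graded[OF _ _ assms(2)] assms(1) span_A_letters by auto
  \<comment> \<open>Membership in \<open>A\<close> is carried through the induction because
    \<open>d\<close> is linear only there.\<close>
  then have "v \<in> A \<and> wmono [LT] * lin v - fscale (ssign e i) (lin v * wmono [LT]) - lin (d v) \<in> defects"
  proof (induction v rule: span_induct_alt)
    case base
    have "d 0 = 0" using d_linear(2)[of 0 0] A_subspace subspace_0 by simp
    then show ?case using A_subspace by (simp add: defects_def falg.span_zero subspace_0)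
  next
    case (step c s v)
    then obtain y where y: "y \<in> A_letters I" "par y = i" "s = val y" by auto
    have sv: "s \<in> A" "v \<in> A"
      using y A_letters_val step by auto
    have "wmono [LT] * lin s - fscale (ssign e i) (lin s * wmono [LT]) - lin (d s) = defect LT y"
      using y by (simp add: defect_def lin_val wmono_mult bra_def)
    then have "wmono [LT] * lin s - fscale (ssign e i) (lin s * wmono [LT]) - lin (d s) \<in> defects"
      using defect_in_defects y by (auto simp: pairs_def)
    then have "fscale c (wmono [LT] * lin s - fscale (ssign e i) (lin s * wmono [LT]) - lin (d s))
        + (wmono [LT] * lin v - fscale (ssign e i) (lin v * wmono [LT]) - lin (d v)) \<in> defects"
      using step.IH by (simp add: defects_def falg.span_scale falg.span_add)
    moreover have "d (scale c s + v) = scale c (d s) + d v"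
      using sv d_linear A_subspace subspace_scale by simp
    ultimately show ?case
      using sv A_subspace by (simp add: lin_add lin_scale algebra_simps fscale_mult subspace_add subspace_scale
          falg.scale_right_distrib falg.scale_right_diff_distrib)
  qed
  then show ?thesis by blast
qed

text \<open>The Jacobi identity for supercommutators holds identically in the free associative
  algebra, so all words of length three cancel among the six products. What is left are
  supercommutators of a letter with a bracket; by \<open>lin_br\<close> and \<open>lin_d\<close>
  they become linear up to \<open>defects\<close>, and the linear forms cancel by the Jacobi
  identity of \<open>L\<close> or, if \<open>y = LT\<close>, by the derivation rule.\<close>

lemma resolution:
  assumes "(y, z) \<in> pairs" "(z, w) \<in> pairs" "(y, w) \<in> pairs"
  defines "s1 \<equiv> ssign (par y) (par z) :: 'k" and "s2 \<equiv> ssign (par z) (par w) :: 'k" and "s3 \<equiv> ssign (par y) (par w) :: 'k"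
  shows "defect y z * wmono [w] - wmono [y] * defect z w
      + fscale s1 (wmono [z] * defect y w) - fscale s2 (defect y w * wmono [z])
      + fscale (s1 * s3) (defect z w * wmono [y]) - fscale (s2 * s3) (wmono [w] * defect y z) \<in> defects" (is "?K \<in> _")
proof -
  let ?c1 = "lin (bra y z)" and ?c2 = "lin (bra z w)" and ?c3 = "lin (bra y w)"
  have zw: "z \<in> Y" "w \<in> Y" using assms(1,2) LT_notin_Y by (auto simp: pairs_def)
  have K: "?K = - (?c1 * wmono [w] - fscale (s2 * s3) (wmono [w] * ?c1))
      + (wmono [y] * ?c2 - fscale (s1 * s3) (?c2 * wmono [y]))
      - fscale s1 (wmono [z] * ?c3 - fscale (s1 * s2) (?c3 * wmono [z]))"
    unfolding s1_def s2_def s3_def defect_def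
    by (cases "par y"; cases "par z"; cases "par w")
      (simp_all add: ssign_def algebra_simps wmono_mult fscale_minus_one)
  have "\<exists>l1 l2 l3. ?c1 * wmono [w] - fscale (s2 * s3) (wmono [w] * ?c1) - lin l1 \<in> defects \<and>
      wmono [y] * ?c2 - fscale (s1 * s3) (?c2 * wmono [y]) - lin l2 \<in> defects \<and>
      wmono [z] * ?c3 - fscale (s1 * s2) (?c3 * wmono [z]) - lin l3 \<in> defects \<and>
      l2 = l1 + scale s1 l3"
  proof (cases "y = LT")
    case False
    then have y: "y \<in> Y" using assms(1) by (auto simp: pairs_def)
    then have bra: "bra y z = br (val y) (val z)" "bra z w = br (val z) (val w)" "bra y w = br (val y) (val w)"
      using y zw LT_notin_Y by (auto simp: bra_def)
    note v = val_homogeneous[OF y] val_homogeneous[OF zw(1)] val_homogeneous[OF zw(2)]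
    have "br (val y) (br (val z) (val w)) = br (br (val y) (val z)) (val w) + scale s1 (br (val z) (br (val y) (val w)))"
      unfolding s1_def by (rule br_jacobi[OF v])
    moreover have "?c1 * wmono [w] - fscale (s2 * s3) (wmono [w] * ?c1) - lin (br (bra y z) (val w)) \<in> defects"
      using lin_br[OF br_graded[OF v(1,2)] v(3), unfolded ssign_add_left] zw by (simp add: lin_val bra s2_def s3_def mult.commute)
    moreover have "wmono [y] * ?c2 - fscale (s1 * s3) (?c2 * wmono [y]) - lin (br (val y) (bra z w)) \<in> defects"
      using lin_br[OF v(1) br_graded[OF v(2,3)], unfolded ssign_add_right] y by (simp add: lin_val bra s1_def s3_def)
    moreover have "wmono [z] * ?c3 - fscale (s1 * s2) (?c3 * wmono [z]) - lin (br (val z) (bra y w)) \<in> defects"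
      using lin_br[OF v(2) br_graded[OF v(1,3)], unfolded ssign_add_right] zw
      by (simp add: lin_val bra s1_def s2_def ssign_commute[of "par z" "par y"])
    ultimately show ?thesis unfolding bra by blast
  next
    case True
    then have AI: "z \<in> A_letters I" "w \<in> A_letters I" using assms(1,3) LT_notin_Y by (auto simp: pairs_def)
    have bra: "bra y z = d (val z)" "bra z w = br (val z) (val w)" "bra y w = d (val w)"
      using True zw LT_notin_Y by (auto simp: bra_def)
    note v = val_homogeneous[OF zw(1)] val_homogeneous[OF zw(2)]
    note vA = A_letters_val[OF AI(1)] A_letters_val[OF AI(2)]
    have vwA: "br (val z) (val w) \<in> A"
      using A vA by (simp add: lie_subalgebra_def)
    have "d (br (val z) (val w)) = br (d (val z)) (val w) + scale s1 (br (val z) (d (val w)))"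
      unfolding s1_def using d_br[OF vA v] True by simp
    moreover have "?c1 * wmono [w] - fscale (s2 * s3) (wmono [w] * ?c1) - lin (br (bra y z) (val w)) \<in> defects"
      unfolding bra using lin_br[OF d_graded[OF vA(1) v(1)] v(2), unfolded ssign_add_left] zw True
      by (simp add: lin_val s2_def s3_def)
    moreover have "wmono [y] * ?c2 - fscale (s1 * s3) (?c2 * wmono [y]) - lin (d (bra z w)) \<in> defects"
      using lin_d[OF vwA br_graded[OF v], unfolded ssign_add_right] True by (simp add: lin_val bra s1_def s3_def)
    moreover have "wmono [z] * ?c3 - fscale (s1 * s2) (?c3 * wmono [z]) - lin (br (val z) (bra y w)) \<in> defects"
      unfolding bra using lin_br[OF v(1) d_graded[OF vA(2) v(2)], unfolded ssign_add_right] zw True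
      by (simp add: lin_val s1_def s2_def ssign_commute[of "par z" e] mult.commute)
    ultimately show ?thesis unfolding bra by blast
  qed
  then obtain l1 l2 l3 where l: "?c1 * wmono [w] - fscale (s2 * s3) (wmono [w] * ?c1) - lin l1 \<in> defects"
      "wmono [y] * ?c2 - fscale (s1 * s3) (?c2 * wmono [y]) - lin l2 \<in> defects"
      "wmono [z] * ?c3 - fscale (s1 * s2) (?c3 * wmono [z]) - lin l3 \<in> defects"
      and l2: "l2 = l1 + scale s1 l3" by blast
  have "?K = - (?c1 * wmono [w] - fscale (s2 * s3) (wmono [w] * ?c1) - lin l1)
      + (wmono [y] * ?c2 - fscale (s1 * s3) (?c2 * wmono [y]) - lin l2)
      - fscale s1 (wmono [z] * ?c3 - fscale (s1 * s2) (?c3 * wmono [z]) - lin l3)"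
    unfolding K l2 by (simp add: lin_add lin_scale falg.scale_right_diff_distrib)
  then show ?thesis
    using l by (simp only: defects_def falg.span_add falg.span_diff falg.span_neg falg.span_scale)
qed

lemma rhs_smaller:
  assumes "(y, z) \<in> P" "w \<in> Poly_Mapping.keys (rhs y z)"
  shows "word_less r w [y, z]"
proof (cases "length w = 1")
  case True
  then show ?thesis by (simp add: word_less_def)
next
  case False
  then have "w \<notin> Poly_Mapping.keys (lin v)" for v using keys_lin by fastforce
  then have "w = [z, y]" "y \<noteq> z"
    using assms(2) by (auto simp: rhs_def dest!: subsetD[OF keys_add] subsetD[OF keys_fscale_subset] split: if_splits)
  then show ?thesis using P_less[OF assms(1)] by (simp add: word_less_def)
qed

text \<open>A relator without context has a leading word of length two, which lies below every
  longer word.\<close>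

lemma defects_below:
  assumes "p \<in> defects" "length \<omega> \<ge> 3"
  shows "p \<in> relators_below r P rhs \<omega>"
proof -
  have "rel y z \<in> relators_below r P rhs \<omega>" if "(y, z) \<in> P" for y z
    using mult_relator_below[OF that, of 1 1 r \<omega> rhs] assms(2)
    by (simp add: word_less_def wmono_Nil zero_list_def)
  then have "defects \<subseteq> relators_below r P rhs \<omega>"
    unfolding defects_def by (intro falg.span_minimal) (auto simp: relators_below_def)
  then show ?thesis using assms(1) by blast
qed

text \<open>The first two terms of \<open>resolution\<close> are the composition. The other four
  products are relators in smaller rearrangements of \<open>y z w\<close>, so they may be
  subtracted. Repeated letters need separate cases, because there some defects are twice a relator
  and some of the six products coincide.\<close>

lemma overlaps_resolve:
  assumes yz: "(y, z) \<in> P" and zw: "(z, w) \<in> P"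
  shows "rel y z * wmono [w] - wmono [y] * rel z w \<in> relators_below r P rhs [y, z, w]" (is "?G \<in> ?B")
proof -
  let ?s1 = "ssign (par y) (par z) :: 'k" and ?s2 = "ssign (par z) (par w) :: 'k" and ?s3 = "ssign (par y) (par w) :: 'k"
  have sub: "falg.subspace ?B" by (simp add: relators_below_def)
  note closed = falg.subspace_add[OF sub] falg.subspace_diff[OF sub] falg.subspace_scale[OF sub]
  have zwY: "z \<in> Y" "w \<in> Y" using assms LT_notin_Y by (auto simp: P_def pairs_def)
  have yw: "(y, w) \<in> pairs"
  proof (cases "y = LT")
    case True
    then have z: "z \<in> A_letters I" using yz LT_notin_Y by (auto simp: P_def pairs_def)
    \<comment> \<open>From \<open>t z\<close> reducible, \<open>z\<close> is a letter of
      \<open>A\<close>; \<open>w\<close> does not exceed \<open>z\<close>, and the letters of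
      \<open>A\<close> precede all others.\<close>
    have "w \<in> A_letters I"
    proof (rule ccontr)
      assume "w \<notin> A_letters I"
      then have "(z, w) \<in> r" "z \<noteq> w" using z zwY r(2) by (auto simp: A_letters_def X_letters_def)
      then have "(w, z) \<in> r" "(z, w) \<in> r" using P_less[OF zw] by auto
      then have "(z, z) \<in> r" using r_trans by (blast dest: transD)
      then show False using r_neq by blast
    qed
    then show ?thesis using True by (simp add: pairs_def)
  qed (use yz zwY in \<open>auto simp: P_def pairs_def\<close>)
  have K: "defect y z * wmono [w] - wmono [y] * defect z w
      + fscale ?s1 (wmono [z] * defect y w) - fscale ?s2 (defect y w * wmono [z])
      + fscale (?s1 * ?s3) (defect z w * wmono [y]) - fscale (?s2 * ?s3) (wmono [w] * defect y z) \<in> ?B"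
    using assms yw by (intro defects_below resolution) (auto simp: P_def)
  have left: "wmono [u] * rel u' v' \<in> ?B" if "(u', v') \<in> P" "word_less r [u, u', v'] [y, z, w]" for u u' v'
    using mult_relator_below[OF that(1), of "wmono [u]" 1 r "[y, z, w]" rhs] that(2) by (simp add: wmono_Nil zero_list_def)
  have right: "rel u' v' * wmono [u] \<in> ?B" if "(u', v') \<in> P" "word_less r [u', v', u] [y, z, w]" for u u' v'
    using mult_relator_below[OF that(1), of 1 "wmono [u]" r "[y, z, w]" rhs] that(2) by (simp add: wmono_Nil zero_list_def)
  have half: "p \<in> ?B" if "fscale 2 p \<in> ?B" for p
    using falg.subspace_scale[OF sub that, of "1 / 2"] two_neq_0 by simp
  have double: "fscale (2 * c) p = fscale c p + fscale c p" "fscale 2 p = p + p" for c :: 'k and p :: "('k, ('i, 'j) letter) free_alg"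
    by (metis falg.scale_left_distrib mult_2, metis falg.scale_left_distrib one_add_one falg.scale_one)
  have par_eq: "par u = 1" if "(u, u) \<in> P" for u using that r_neq by (auto simp: P_def)
  consider (distinct) "y \<noteq> z" "z \<noteq> w" | (first) "y = z" "z \<noteq> w" | (last) "y \<noteq> z" "z = w" | (all) "y = z" "z = w" by blast
  then show ?thesis
  proof cases
    case distinct
    have ord: "(z, y) \<in> r" "(w, z) \<in> r" using P_less assms distinct by auto
    then have wy: "(w, y) \<in> r" using r_trans by (blast dest: transD)
    then have ywP: "(y, w) \<in> P" "y \<noteq> w" using yw r_neq by (auto simp: P_def)
    have "?G = (defect y z * wmono [w] - wmono [y] * defect z w
      + fscale ?s1 (wmono [z] * defect y w) - fscale ?s2 (defect y w * wmono [z])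
      + fscale (?s1 * ?s3) (defect z w * wmono [y]) - fscale (?s2 * ?s3) (wmono [w] * defect y z))
      - fscale ?s1 (wmono [z] * rel y w) + fscale ?s2 (rel y w * wmono [z])
      - fscale (?s1 * ?s3) (rel z w * wmono [y]) + fscale (?s2 * ?s3) (wmono [w] * rel y z)"
      using distinct ywP by (simp add: defect_eq_relator assms)
    moreover have "wmono [z] * rel y w \<in> ?B" "rel y w * wmono [z] \<in> ?B" "rel z w * wmono [y] \<in> ?B" "wmono [w] * rel y z \<in> ?B"
      using assms ywP ord wy by (auto intro!: left right simp: word_less_def)
    ultimately show ?thesis using K by (simp only: closed)
  next
    case first
    have ord: "(w, z) \<in> r" using P_less assms first by auto
    have "par z = 1" using par_eq yz first by simp
    then have s: "?s1 = -1" "?s3 = ?s2" using first by (simp_all add: ssign_def)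
    \<comment> \<open>With \<open>y = z\<close> odd, the first and third products involving
      \<open>z w\<close> agree and \<open>defect z z\<close> is twice its relator, so the
      composition occurs doubled; \<open>half\<close> removes the factor.\<close>
    have "fscale 2 ?G = (defect y z * wmono [w] - wmono [y] * defect z w
      + fscale ?s1 (wmono [z] * defect y w) - fscale ?s2 (defect y w * wmono [z])
      + fscale (?s1 * ?s3) (defect z w * wmono [y]) - fscale (?s2 * ?s3) (wmono [w] * defect y z))
      + fscale (2 * ?s2) (rel z w * wmono [z]) + fscale 2 (wmono [w] * rel z z)"
      using first(2) zw yz unfolding s unfolding first(1)
      by (simp add: defect_eq_relator fscale_mult fscale_minus_one falg.scale_right_diff_distrib double distrib_left distrib_right)
    moreover have "rel z w * wmono [z] \<in> ?B"
      by (rule right) (use zw ord first(1) in \<open>simp_all add: word_less_def\<close>)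
    moreover have "wmono [w] * rel z z \<in> ?B"
      by (rule left) (use yz ord first(1) in \<open>simp_all add: word_less_def\<close>)
    ultimately have "fscale 2 ?G \<in> ?B" using K by (simp only: closed)
    then show ?thesis by (rule half)
  next
    case last
    have ord: "(z, y) \<in> r" using P_less assms last by auto
    have "par z = 1" using par_eq zw last by simp
    then have s: "?s2 = -1" "?s3 = ?s1" using last by (simp_all add: ssign_def)
    have "fscale 2 ?G = (defect y z * wmono [w] - wmono [y] * defect z w
      + fscale ?s1 (wmono [z] * defect y w) - fscale ?s2 (defect y w * wmono [z])
      + fscale (?s1 * ?s3) (defect z w * wmono [y]) - fscale (?s2 * ?s3) (wmono [w] * defect y z))
      - fscale (2 * ?s1) (wmono [z] * rel y z) - fscale 2 (rel z z * wmono [y])"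
      using last(1) zw yz unfolding s unfolding last(2)[symmetric]
      by (simp add: defect_eq_relator fscale_mult fscale_minus_one falg.scale_right_diff_distrib double distrib_left distrib_right)
    moreover have "wmono [z] * rel y z \<in> ?B"
      by (rule left) (use yz ord last(2) in \<open>simp_all add: word_less_def\<close>)
    moreover have "rel z z * wmono [y] \<in> ?B"
      by (rule right) (use zw ord last(2) in \<open>simp_all add: word_less_def\<close>)
    ultimately have "fscale 2 ?G \<in> ?B" using K by (simp only: closed)
    then show ?thesis by (rule half)
  next
    case all
    \<comment> \<open>For \<open>z z z\<close> the words of length three cancel directly and half
      the commutator of \<open>z\<close> with \<open>[z,z]\<close> remains, up to sign; modulo
      \<open>defects\<close> it is the linear form of a bracket that vanishes by
      \<open>odd_cube\<close>.\<close>
    have odd: "par z = 1" using par_eq yz all by simp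
    let ?v = "val z" and ?u = "br (val z) (val z)"
    have v: "?v \<in> gr 1" using val_homogeneous[OF zwY(1)] odd by simp
    have u: "?u \<in> gr 0" using br_graded[OF v v] by simp
    have "br ?u ?v = 0" using br_skew[OF u v] odd_cube[OF v] by simp
    then have "lin ?u * wmono [z] - wmono [z] * lin ?u \<in> ?B"
      using defects_below[OF lin_br[OF u v], of "[y, z, w]"] zwY by (simp add: lin_val ssign_def)
    then have "fscale (- (1 / 2)) (lin ?u * wmono [z] - wmono [z] * lin ?u) \<in> ?B" by (rule closed(3))
    moreover have "bra z z = ?u" using zwY LT_notin_Y by (auto simp: bra_def)
    then have "?G = fscale (- (1 / 2)) (lin ?u * wmono [z] - wmono [z] * lin ?u)"
      unfolding all(1) all(2)[symmetric]
      by (simp add: relator_def rhs_def wmono_mult fscale_mult algebra_simps falg.scale_right_diff_distrib)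
    ultimately show ?thesis by simp
  qed
qed

sublocale rewriting r P rhs
  by standard (use r_trans r_irrefl rhs_smaller overlaps_resolve in auto)

end

section \<open>Normal words\<close>

text \<open>Collecting equal adjacent letters recovers the exponents, and transitivity makes the
  condition on neighbours a condition on all pairs. The condition on neighbours is the one that can
  be compared with \<open>normal\<close>.\<close>

lemma ordered_monomials_iff:
  assumes "trans r" "irrefl r"
  shows "ordered_monomials r par S =
    {w. set w \<subseteq> S \<and> successively (\<lambda>y z. (y, z) \<in> r \<or> y = z \<and> par y \<noteq> 1) w}"
proof -
  let ?Q = "\<lambda>y z. (y, z) \<in> r \<or> y = z \<and> par y \<noteq> 1"
  have "transp ?Q" using assms(1) by (auto intro!: transpI dest: transD)
  then have sw: "successively ?Q w = sorted_wrt ?Q w" for w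
    by (rule successively_conv_sorted_wrt)
  have 1: "sorted_wrt ?Q (concat (map (\<lambda>z. replicate (n z) z) zs))"
    if "sorted_wrt (\<lambda>y z. (y, z) \<in> r) zs" "\<forall>z\<in>set zs. par z = 1 \<longrightarrow> n z \<le> (1::nat)" for zs n
    using that
  proof (induction zs)
    case (Cons z zs)
    have "sorted_wrt ?Q (replicate k z)" if "par z = 1 \<longrightarrow> k \<le> 1" for k
      using that by (induction k) auto
    with Cons show ?case by (auto simp: sorted_wrt_append)
  qed simp
  have 2: "\<exists>zs n. w = concat (map (\<lambda>z. replicate (n z) z) zs) \<and> set zs \<subseteq> set w \<and>
      sorted_wrt (\<lambda>y z. (y, z) \<in> r) zs \<and> (\<forall>z\<in>set zs. par z = 1 \<longrightarrow> n z \<le> (1::nat))"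
    if "sorted_wrt ?Q w" for w
    using that
  proof (induction w)
    case (Cons y w)
    then obtain zs n where IH: "w = concat (map (\<lambda>z. replicate (n z) z) zs)" "set zs \<subseteq> set w"
      "sorted_wrt (\<lambda>y z. (y, z) \<in> r) zs" "\<forall>z\<in>set zs. par z = 1 \<longrightarrow> n z \<le> (1::nat)" by auto
    have irr: "(z, z) \<notin> r" for z using assms(2) by (auto simp: irrefl_def)
    have asym: "(z, y) \<notin> r" if "(y, z) \<in> r" for y z
      using that irr assms(1) by (meson transD)
    have Qy: "?Q y z" if "z \<in> set w" for z using Cons.prems that by auto
    show ?case
    \<comment> \<open>The new letter either equals the first collected letter, whose exponent grows
      by one, or opens a new block of exponent 1.\<close>
    proof (cases "y \<in> set zs")
      case True
      obtain z0 zs' where zs: "zs = z0 # zs'" using True by (cases zs) auto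
      have "z0 \<in> set w" using IH(2) zs by auto
      have "z0 = y"
      proof (rule ccontr)
        assume "z0 \<noteq> y"
        then have "(z0, y) \<in> r" "(y, z0) \<in> r" using True zs IH(3) Qy[OF \<open>z0 \<in> set w\<close>] by auto
        then show False using asym by blast
      qed
      then have zs: "zs = y # zs'" using zs by simp
      have "y \<notin> set zs'" using IH(3) zs irr by auto
      then have "concat (map (\<lambda>z. replicate ((n(y := Suc (n y))) z) z) zs) = y # w"
        unfolding IH(1) zs by (auto intro!: arg_cong[where f = concat])
      moreover have "par y \<noteq> 1" using Qy[of y] IH(2) zs irr by auto
      ultimately show ?thesis
        using IH(2-4) by (intro exI[of _ zs] exI[of _ "n(y := Suc (n y))"]) auto
    next
      case False
      then have "concat (map (\<lambda>z. replicate ((n(y := 1)) z) z) (y # zs)) = y # w"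
        unfolding IH(1) by (auto intro!: arg_cong[where f = concat])
      then show ?thesis
        using IH(2-4) Qy False by (intro exI[of _ "y # zs"] exI[of _ "n(y := 1)"]) auto
    qed
  qed simp
  show ?thesis
  proof (intro equalityI subsetI)
    fix w assume "w \<in> ordered_monomials r par S"
    then show "w \<in> {w. set w \<subseteq> S \<and> successively ?Q w}"
      unfolding sw ordered_monomials_def using 1 by fastforce
  next
    fix w assume "w \<in> {w. set w \<subseteq> S \<and> successively ?Q w}"
    then show "w \<in> ordered_monomials r par S"
      unfolding sw ordered_monomials_def using 2[of w] by blast
  qed
qed

lemma tX_products_0: "tX_products r par J 0 = {[]}"
  by (auto simp: tX_products_def)

lemma tX_products_Suc:
  "tX_products r par J (Suc s) = {replicate g LT @ b @ w | g b w.
     g \<ge> 1 \<and> b \<in> ordered_monomials r par (X_letters J) \<and> b \<noteq> [] \<and> w \<in> tX_products r par J s}"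
proof (intro equalityI subsetI)
  fix w assume "w \<in> tX_products r par J (Suc s)"
  then obtain ps where ps: "w = concat (map (\<lambda>(g, b). replicate g LT @ b) ps)" "length ps = Suc s"
    "\<forall>(g, b)\<in>set ps. g \<ge> 1 \<and> b \<in> ordered_monomials r par (X_letters J) \<and> b \<noteq> []"
    by (auto simp: tX_products_def)
  then obtain g b ps' where "ps = (g, b) # ps'" by (cases ps) auto
  then show "w \<in> {replicate g LT @ b @ w | g b w.
     g \<ge> 1 \<and> b \<in> ordered_monomials r par (X_letters J) \<and> b \<noteq> [] \<and> w \<in> tX_products r par J s}"
    using ps by (auto simp: tX_products_def)
next
  fix w assume "w \<in> {replicate g LT @ b @ w | g b w.
     g \<ge> 1 \<and> b \<in> ordered_monomials r par (X_letters J) \<and> b \<noteq> [] \<and> w \<in> tX_products r par J s}"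
  then obtain g b ps where "w = concat (map (\<lambda>(g, b). replicate g LT @ b) ((g, b) # ps))" "length ps = s"
    "g \<ge> 1" "b \<in> ordered_monomials r par (X_letters J)" "b \<noteq> []"
    "\<forall>(g, b)\<in>set ps. g \<ge> 1 \<and> b \<in> ordered_monomials r par (X_letters J) \<and> b \<noteq> []"
    by (auto simp: tX_products_def)
  then show "w \<in> tX_products r par J (Suc s)"
    unfolding tX_products_def by (intro CollectI exI[of _ "(g, b) # ps"]) auto
qed

lemma tX_products_append:
  "u \<in> tX_products r par J s \<Longrightarrow> v \<in> tX_products r par J s' \<Longrightarrow> u @ v \<in> tX_products r par J (s + s')"
  by (induction s arbitrary: u) (fastforce simp: tX_products_0 tX_products_Suc)+

context hnn_data
begin

lemma normal_append:
  "normal (u @ v) \<longleftrightarrow> normal u \<and> normal v \<and> (u \<noteq> [] \<longrightarrow> v \<noteq> [] \<longrightarrow> (last u, hd v) \<notin> P)"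
  by (auto simp: normal_def successively_append_iff)

lemma normal_Nil [simp]: "normal []"
  by (simp add: normal_def)

lemma normal_Cons: "normal (y # w) \<longleftrightarrow> normal w \<and> (w \<noteq> [] \<longrightarrow> (y, hd w) \<notin> P)"
  by (auto simp: normal_def successively_Cons)

lemma notin_P [simp]: "(y, LT) \<notin> P"
  by (auto simp: P_def pairs_def A_letters_def X_letters_def)

lemma LT_X_notin_P: "z \<in> X_letters J \<Longrightarrow> (LT, z) \<notin> P"
  by (auto simp: P_def pairs_def A_letters_def X_letters_def)

lemma A_X_notin_P: "y \<in> A_letters I \<Longrightarrow> z \<in> X_letters J \<Longrightarrow> (y, z) \<notin> P"
proof
  assume "y \<in> A_letters I" "z \<in> X_letters J" "(y, z) \<in> P"
  then have "(y, z) \<in> r" "(z, y) \<in> r" using r(2) by (auto simp: P_def A_letters_def X_letters_def)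
  then show False using r_trans r_irrefl by (metis irrefl_def transD)
qed

lemma Y_A_in_P: "y \<in> X_letters J \<union> {LT} \<Longrightarrow> z \<in> A_letters I \<Longrightarrow> (y, z) \<in> P"
  using r(2,3) by (auto simp: P_def pairs_def A_letters_def X_letters_def)

lemma Y_notin_P: "y \<in> Y \<Longrightarrow> z \<in> Y \<Longrightarrow> (y, z) \<notin> P \<longleftrightarrow> (y, z) \<in> r \<or> y = z \<and> par y \<noteq> 1"
proof -
  assume Y: "y \<in> Y" "z \<in> Y"
  then have "(y, z) \<in> r \<or> y = z \<or> (z, y) \<in> r"
    using r_total by (auto simp: total_on_def alphabet_def)
  moreover have "\<not> ((y, z) \<in> r \<and> (z, y) \<in> r)" "(z, z) \<notin> r"
    using r_trans r_irrefl by (metis irrefl_def transD)+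
  ultimately show ?thesis using Y by (auto simp: P_def pairs_def)
qed

lemma ordered_monomials_normal:
  assumes "S \<subseteq> Y"
  shows "ordered_monomials r par S = {w. set w \<subseteq> S \<and> normal w}"
proof -
  have "successively (\<lambda>y z. (y, z) \<in> r \<or> y = z \<and> par y \<noteq> 1) w = normal w" if "set w \<subseteq> S" for w
    unfolding normal_def
  proof (rule successively_cong)
    fix y z assume "y \<in> set w" "z \<in> set w"
    then show "((y, z) \<in> r \<or> y = z \<and> par y \<noteq> 1) = ((y, z) \<notin> P)"
      using Y_notin_P that assms by blast
  qed simp
  then show ?thesis
    unfolding ordered_monomials_iff[OF r_trans r_irrefl] by blast
qed

lemma normal_replicate_LT: "normal (replicate g LT)"
  by (induction g) (auto simp: normal_Cons hd_replicate)

lemma tX_products_normal: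
  assumes "w \<in> tX_products r par J s"
  shows "set w \<subseteq> X_letters J \<union> {LT} \<and> normal w \<and> (w \<noteq> [] \<longrightarrow> hd w = LT \<and> last w \<in> X_letters J) \<and> (w = [] \<longleftrightarrow> s = 0)"
  using assms
proof (induction s arbitrary: w)
  case 0
  then show ?case by (simp add: tX_products_0 normal_def)
next
  case (Suc s)
  then obtain g b w' where w: "w = replicate g LT @ b @ w'" "g \<ge> 1" "b \<noteq> []"
    "b \<in> ordered_monomials r par (X_letters J)" "w' \<in> tX_products r par J s"
    by (auto simp: tX_products_Suc)
  have b: "set b \<subseteq> X_letters J" "normal b"
    using w(4) ordered_monomials_normal[of "X_letters J"] by auto
  have "hd b \<in> X_letters J" "last b \<in> X_letters J" using b w(3) by auto
  with b w Suc.IH[OF w(5)] show ?case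
    by (auto simp: normal_append normal_replicate_LT LT_X_notin_P hd_append last_append)
qed

text \<open>Split off the initial block of \<open>t\<close> and the following block of letters
  \<open>x\<close>, then recurse; a block of \<open>t\<close> with nothing after it becomes the
  final power.\<close>

lemma tX_decomposition:
  assumes "set w \<subseteq> X_letters J \<union> {LT}" "normal w" "w \<noteq> [] \<longrightarrow> hd w = LT"
  shows "\<exists>s w' \<delta>. w = w' @ replicate \<delta> LT \<and> w' \<in> tX_products r par J s"
  using assms
proof (induction "length w" arbitrary: w rule: less_induct)
  case less
  show ?case
  proof (cases "w = []")
    case True
    then show ?thesis by (intro exI[of _ 0] exI[of _ "[]"]) (simp add: tX_products_0)
  next
    case False
    define ts where "ts = takeWhile (\<lambda>z. z = LT) w"
    define v where "v = dropWhile (\<lambda>z. z = LT) w"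
    define b where "b = takeWhile (\<lambda>z. z \<noteq> LT) v"
    define w' where "w' = dropWhile (\<lambda>z. z \<noteq> LT) v"
    have w: "w = ts @ b @ w'" by (simp add: ts_def v_def b_def w'_def)
    have ts: "ts = replicate (length ts) LT"
      by (rule replicate_eqI) (auto simp: ts_def dest: set_takeWhileD)
    then obtain g where g: "ts = replicate g LT" by blast
    have "ts \<noteq> []" using False less.prems(3) by (cases w) (auto simp: ts_def)
    show ?thesis
    proof (cases "v = []")
      case True
      then have "w = ts" by (simp add: w b_def w'_def)
      then show ?thesis using ts
        by (intro exI[of _ 0] exI[of _ "[]"] exI[of _ "length ts"]) (simp add: tX_products_0)
    next
      case v: False
      have "hd v \<noteq> LT" using hd_dropWhile[of "\<lambda>z. z = LT" w] v unfolding v_def by blast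
      then have "b \<noteq> []" using v by (cases v) (auto simp: b_def)
      have "LT \<notin> set b" by (auto simp: b_def dest: set_takeWhileD)
      then have "b \<in> ordered_monomials r par (X_letters J)"
        using less.prems w by (auto simp: ordered_monomials_normal normal_append)
      moreover have "w' \<noteq> [] \<longrightarrow> hd w' = LT"
        using hd_dropWhile[of "\<lambda>z. z \<noteq> LT" v] unfolding w'_def by blast
      then obtain s w'' \<delta> where "w' = w'' @ replicate \<delta> LT" "w'' \<in> tX_products r par J s"
        using less.hyps[of w'] less.prems w \<open>ts \<noteq> []\<close> by (auto simp: normal_append)
      moreover have "g \<ge> 1" using \<open>ts \<noteq> []\<close> g by (cases g) auto
      ultimately have "ts @ b @ w'' \<in> tX_products r par J (Suc s)" "w = (ts @ b @ w'') @ replicate \<delta> LT"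
        using \<open>b \<noteq> []\<close> unfolding tX_products_Suc w g by (blast, simp)
      then show ?thesis by blast
    qed
  qed
qed

text \<open>A letter of \<open>A\<close> right after \<open>t\<close> or some \<open>x\<close> forms
  a reducible pair, so in a normal word the letters of \<open>A\<close> make up a prefix.\<close>

lemma no_A_letters:
  assumes "normal w" "set w \<subseteq> alphabet I J" "w \<noteq> [] \<longrightarrow> hd w \<notin> A_letters I"
  shows "set w \<subseteq> X_letters J \<union> {LT}"
  using assms
proof (induction w)
  case (Cons y w)
  have y: "y \<in> X_letters J \<union> {LT}" using Cons.prems by (auto simp: alphabet_def)
  have "w \<noteq> [] \<longrightarrow> hd w \<notin> A_letters I"
    using Cons.prems(1) Y_A_in_P[OF y] by (auto simp: normal_Cons)
  with Cons y show ?case by (auto simp: normal_Cons)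
qed simp

lemma env_basis_words_eq: "env_basis_words r par I J = {w. set w \<subseteq> alphabet I J \<and> normal w}"
proof (intro equalityI subsetI)
  fix w assume "w \<in> env_basis_words r par I J"
  then obtain \<alpha> \<beta> v s \<delta> where w: "w = \<alpha> @ \<beta> @ v @ replicate \<delta> LT"
    "\<alpha> \<in> ordered_monomials r par (A_letters I)" "\<beta> \<in> ordered_monomials r par (X_letters J)"
    "v \<in> tX_products r par J s"
    by (auto simp: env_basis_words_def)
  have \<alpha>: "set \<alpha> \<subseteq> A_letters I" "normal \<alpha>" and \<beta>: "set \<beta> \<subseteq> X_letters J" "normal \<beta>"
    using w ordered_monomials_normal by auto
  have v: "set v \<subseteq> X_letters J \<union> {LT}" "normal v" "v \<noteq> [] \<longrightarrow> hd v = LT"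
    using tX_products_normal[OF w(4)] by auto
  have 1: "normal (v @ replicate \<delta> LT)" "v @ replicate \<delta> LT \<noteq> [] \<longrightarrow> hd (v @ replicate \<delta> LT) = LT"
    using v by (auto simp: normal_append normal_replicate_LT hd_append)
  have 2: "normal (\<beta> @ v @ replicate \<delta> LT)"
    unfolding normal_append[of \<beta>] using \<beta> 1 by auto
  have "(last \<alpha>, hd (\<beta> @ v @ replicate \<delta> LT)) \<notin> P" if "\<alpha> \<noteq> []" "\<beta> @ v @ replicate \<delta> LT \<noteq> []"
  proof (cases "\<beta> = []")
    case True
    then show ?thesis using 1 that by simp
  next
    case False
    have "last \<alpha> \<in> A_letters I" "hd \<beta> \<in> X_letters J" using \<alpha> \<beta> that(1) False by auto
    then show ?thesis using A_X_notin_P False by simp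
  qed
  then have "normal w" unfolding w(1) normal_append[of \<alpha>] using \<alpha> 2 by auto
  moreover have "set w \<subseteq> alphabet I J" using \<alpha> \<beta> v by (auto simp: w(1) alphabet_def)
  ultimately show "w \<in> {w. set w \<subseteq> alphabet I J \<and> normal w}" by simp
next
  fix w assume "w \<in> {w. set w \<subseteq> alphabet I J \<and> normal w}"
  then have w: "set w \<subseteq> alphabet I J" "normal w" by auto
  define \<alpha> where "\<alpha> = takeWhile (\<lambda>z. z \<in> A_letters I) w"
  define v where "v = dropWhile (\<lambda>z. z \<in> A_letters I) w"
  define \<beta> where "\<beta> = takeWhile (\<lambda>z. z \<noteq> LT) v"
  define u where "u = dropWhile (\<lambda>z. z \<noteq> LT) v"
  have eq: "w = \<alpha> @ v" "v = \<beta> @ u" by (simp_all add: \<alpha>_def v_def \<beta>_def u_def)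
  have "v \<noteq> [] \<longrightarrow> hd v \<notin> A_letters I"
    unfolding v_def using hd_dropWhile by blast
  then have v: "set v \<subseteq> X_letters J \<union> {LT}"
    using w eq(1) by (intro no_A_letters) (auto simp: normal_append)
  have "LT \<notin> set \<beta>" by (auto simp: \<beta>_def dest: set_takeWhileD)
  then have "\<beta> \<in> ordered_monomials r par (X_letters J)"
    using w v eq by (auto simp: ordered_monomials_normal normal_append)
  moreover have "set \<alpha> \<subseteq> A_letters I" by (auto simp: \<alpha>_def dest: set_takeWhileD)
  then have "\<alpha> \<in> ordered_monomials r par (A_letters I)"
    using w(2) eq(1) by (simp add: ordered_monomials_normal normal_append)
  moreover have "u \<noteq> [] \<longrightarrow> hd u = LT"
    unfolding u_def using hd_dropWhile by blast
  then have "\<exists>s w' \<delta>. u = w' @ replicate \<delta> LT \<and> w' \<in> tX_products r par J s"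
    using w v eq by (intro tX_decomposition) (auto simp: normal_append)
  ultimately show "w \<in> env_basis_words r par I J"
    unfolding env_basis_words_def eq by blast
qed

end

section \<open>Quotients and bases\<close>

lemma coset_eq_iff:
  assumes "falg.subspace N"
  shows "coset N p = coset N q \<longleftrightarrow> p - q \<in> N"
proof
  assume "coset N p = coset N q"
  moreover have "p + 0 \<in> coset N p" unfolding coset_def using falg.subspace_0[OF assms] by blast
  ultimately obtain n where "p = q + n" "n \<in> N" by (auto simp: coset_def)
  then show "p - q \<in> N" by simp
next
  have sub: "coset N p \<subseteq> coset N q" if "p - q \<in> N" for p q
  proof
    fix y assume "y \<in> coset N p"
    then obtain n where "y = p + n" "n \<in> N" by (auto simp: coset_def)
    then have "y = q + ((p - q) + n)" "(p - q) + n \<in> N"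
      using that falg.subspace_add[OF assms] by auto
    then show "y \<in> coset N q" unfolding coset_def by (rule image_eqI)
  qed
  assume "p - q \<in> N"
  moreover from this have "q - p \<in> N" using falg.subspace_neg[OF assms, of "p - q"] by simp
  ultimately show "coset N p = coset N q" using sub by blast
qed

lemma coset_zero: "coset N 0 = (N :: ('k::field, 'x) free_alg set)"
  by (simp add: coset_def)

lemma coset_eq_self_iff: "falg.subspace N \<Longrightarrow> coset N p = N \<longleftrightarrow> p \<in> N"
  using coset_eq_iff[of N p 0] by (simp add: coset_zero)

lemma coset_add:
  assumes "falg.subspace N"
  shows "{u + v | u v. u \<in> coset N p \<and> v \<in> coset N q} = coset N (p + q)"
proof (intro equalityI subsetI)
  fix y assume "y \<in> {u + v | u v. u \<in> coset N p \<and> v \<in> coset N q}"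
  then obtain m n where "y = (p + m) + (q + n)" "m \<in> N" "n \<in> N" by (auto simp: coset_def)
  then have "y = (p + q) + (m + n)" "m + n \<in> N" using falg.subspace_add[OF assms] by auto
  then show "y \<in> coset N (p + q)" by (auto simp: coset_def)
next
  fix y assume "y \<in> coset N (p + q)"
  then obtain n where "y = (p + 0) + (q + n)" "n \<in> N" "0 \<in> N"
    using falg.subspace_0[OF assms] by (auto simp: coset_def)
  then show "y \<in> {u + v | u v. u \<in> coset N p \<and> v \<in> coset N q}" unfolding coset_def by blast
qed

lemma coset_scale:
  assumes "falg.subspace N"
  shows "{fscale c u + w | u w. u \<in> coset N p \<and> w \<in> N} = coset N (fscale c p)"
proof (intro equalityI subsetI)
  fix y assume "y \<in> {fscale c u + w | u w. u \<in> coset N p \<and> w \<in> N}"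
  then obtain m n where "y = fscale c (p + m) + n" "m \<in> N" "n \<in> N" by (auto simp: coset_def)
  then have "y = fscale c p + (fscale c m + n)" "fscale c m + n \<in> N"
    using falg.subspace_add[OF assms] falg.subspace_scale[OF assms] by (auto simp: falg.scale_right_distrib)
  then show "y \<in> coset N (fscale c p)" by (auto simp: coset_def)
next
  fix y assume "y \<in> coset N (fscale c p)"
  then obtain n where "y = fscale c (p + 0) + n" "n \<in> N" "0 \<in> N"
    using falg.subspace_0[OF assms] by (auto simp: coset_def)
  then show "y \<in> {fscale c u + w | u w. u \<in> coset N p \<and> w \<in> N}" unfolding coset_def by blast
qed

text \<open>The operations of the quotient act on cosets as sets; here they are transferred to
  representatives, so that being a basis means independence and spanning modulo
  \<open>N\<close>.\<close>

lemma is_basis_quotient: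
  fixes V :: "('k::field, ('k, 'x) free_alg set, 'm) vspace_scheme" and g :: "'s \<Rightarrow> ('k, 'x) free_alg"
  assumes N: "falg.subspace N"
    and V: "vcarrier V = coset N ` M" "vzero V = N"
      "vadd V = (\<lambda>X Y. {p + q | p q. p \<in> X \<and> q \<in> Y})"
      "vscale V = (\<lambda>c X. {fscale c p + w | p w. p \<in> X \<and> w \<in> N})"
    and g: "\<And>s. s \<in> S \<Longrightarrow> g s \<in> M"
    and indep: "\<And>K c s. finite K \<Longrightarrow> K \<subseteq> S \<Longrightarrow> (\<Sum>s\<in>K. fscale (c s) (g s)) \<in> N \<Longrightarrow> s \<in> K \<Longrightarrow> c s = 0"
    and gen: "\<And>m. m \<in> M \<Longrightarrow> \<exists>n\<in>N. m - n \<in> falg.span (g ` S)"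
  shows "is_basis V (\<lambda>s. coset N (g s)) S"
proof -
  have lincomb: "lincomb V c (\<lambda>s. coset N (g s)) ss = coset N (\<Sum>s\<leftarrow>ss. fscale (c s) (g s))" for c ss
    by (induction ss) (simp_all add: lincomb_def V coset_zero coset_scale[OF N] coset_add[OF N])
  have sum: "(\<Sum>s\<leftarrow>ss. fscale (c s) (g s)) = (\<Sum>s\<in>set ss. fscale (c s) (g s))" if "distinct ss" for c ss
    using that by (rule sum_list_distinct_conv_sum_set)
  show ?thesis
    unfolding is_basis_def
  proof (intro conjI allI impI ballI)
    show "(\<lambda>s. coset N (g s)) ` S \<subseteq> vcarrier V" using g by (auto simp: V)
  next
    fix ss c s assume *: "distinct ss \<and> set ss \<subseteq> S \<and> lincomb V c (\<lambda>s. coset N (g s)) ss = vzero V" "s \<in> set ss"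
    then have "(\<Sum>s\<in>set ss. fscale (c s) (g s)) \<in> N"
      using coset_eq_self_iff[OF N] sum[of ss c] by (simp add: V lincomb)
    then show "c s = 0" using indep[of "set ss" c s] * by auto
  next
    fix X assume "X \<in> vcarrier V"
    then obtain m where m: "m \<in> M" "X = coset N m" by (auto simp: V)
    obtain n where n: "n \<in> N" "m - n \<in> falg.span (g ` S)" using gen[OF m(1)] by blast
    then obtain t u where t: "finite t" "t \<subseteq> g ` S" "m - n = (\<Sum>v\<in>t. fscale (u v) v)"
      unfolding falg.span_explicit by blast
    \<comment> \<open>The span is taken over values of \<open>g\<close>; one index per value is
      selected so that each coefficient is used once.\<close>
    then obtain K where K: "K \<subseteq> S" "inj_on g K" "t = g ` K"
      by (auto simp: subset_image_inj)
    then have "finite K" using t(1) by (simp add: finite_image_iff)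
    then obtain ss where ss: "set ss = K" "distinct ss" using finite_distinct_list by blast
    have "m - n = (\<Sum>s\<in>set ss. fscale (u (g s)) (g s))"
      using t(3) K ss by (simp add: sum.reindex)
    then have "X = lincomb V (u \<circ> g) (\<lambda>s. coset N (g s)) ss"
      using n(1) unfolding m(2) lincomb coset_eq_iff[OF N] sum[OF ss(2)]
      by (simp add: algebra_simps)
    then show "\<exists>ss c. distinct ss \<and> set ss \<subseteq> S \<and> X = lincomb V c (\<lambda>s. coset N (g s)) ss"
      using ss K(1) by blast
  qed
qed

text \<open>A map which respects superbrackets up to an ideal agrees, up to that ideal, with the
  algebra homomorphism it determines on letters.\<close>

lemma free_lie_hom_unique:
  fixes \<theta> :: "('k::field, 'x) free_alg \<Rightarrow> ('k, 'y) free_alg"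
  assumes N: "falg.subspace N"
    and add: "\<And>p q. p \<in> free_lie T par \<Longrightarrow> q \<in> free_lie T par \<Longrightarrow> \<theta> (p + q) - (\<theta> p + \<theta> q) \<in> N"
    and scale: "\<And>c p. p \<in> free_lie T par \<Longrightarrow> \<theta> (fscale c p) - fscale c (\<theta> p) \<in> N"
    and letter: "\<And>z. z \<in> T \<Longrightarrow> \<theta> (wmono [z]) - f z \<in> N"
    and bracket: "\<And>p q i j. p \<in> free_lie T par \<Longrightarrow> q \<in> free_lie T par \<Longrightarrow> p \<in> homogeneous par i \<Longrightarrow> q \<in> homogeneous par j \<Longrightarrow>
       \<theta> (superbracket par p q) - (\<theta> p * \<theta> q - fscale (ssign i j) (\<theta> q * \<theta> p)) \<in> N"
    and mult: "\<And>m n. m \<in> M \<Longrightarrow> n \<in> N \<Longrightarrow> m * n \<in> N \<and> n * m \<in> N"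
    and M: "\<And>p. p \<in> free_lie T par \<Longrightarrow> \<theta> p \<in> M \<and> alg_hom f p \<in> M"
    and q: "q \<in> free_lie T par"
  shows "\<theta> q - alg_hom f q \<in> N"
proof -
  note closed = falg.subspace_add[OF N] falg.subspace_diff[OF N] falg.subspace_scale[OF N] falg.subspace_neg[OF N]
  have mono: "\<theta> (bracket_value par b) - alg_hom f (bracket_value par b) \<in> N" if "set (underlying_word b) \<subseteq> T" for b
    using that
  proof (induction b)
    case (Letter z)
    then show ?case using letter by (simp add: alg_hom_wmono)
  next
    case (Bracket b b')
    let ?p = "bracket_value par b :: ('k, 'x) free_alg" and ?q = "bracket_value par b' :: ('k, 'x) free_alg"
    let ?i = "word_parity par (underlying_word b)" and ?j = "word_parity par (underlying_word b')"
    have p: "?p \<in> free_lie T par" "?p \<in> homogeneous par ?i" and q: "?q \<in> free_lie T par" "?q \<in> homogeneous par ?j"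
      using Bracket.prems by (auto intro: bracket_value_in_free_lie bracket_value_homogeneous)
    have IH: "\<theta> ?p - alg_hom f ?p \<in> N" "\<theta> ?q - alg_hom f ?q \<in> N" using Bracket by auto
    have prod: "\<theta> u * \<theta> v - alg_hom f u * alg_hom f v \<in> N"
      if "u \<in> free_lie T par" "v \<in> free_lie T par" "\<theta> u - alg_hom f u \<in> N" "\<theta> v - alg_hom f v \<in> N" for u v
    proof -
      have "(\<theta> u - alg_hom f u) * \<theta> v + alg_hom f u * (\<theta> v - alg_hom f v) \<in> N"
        using that M mult by (blast intro: closed)
      then show ?thesis by (simp add: algebra_simps)
    qed
    have "(\<theta> (superbracket par ?p ?q) - (\<theta> ?p * \<theta> ?q - fscale (ssign ?i ?j) (\<theta> ?q * \<theta> ?p)))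
        + ((\<theta> ?p * \<theta> ?q - alg_hom f ?p * alg_hom f ?q)
          - fscale (ssign ?i ?j) (\<theta> ?q * \<theta> ?p - alg_hom f ?q * alg_hom f ?p)) \<in> N"
      using bracket[OF p(1) q(1) p(2) q(2)] prod[OF p(1) q(1) IH] closed(3)[OF prod[OF q(1) p(1) IH(2,1)]]
      by (rule_tac closed(1)[OF _ closed(2)])
    then show ?case
      by (simp add: superbracket_homogeneous[OF p(2) q(2)] algebra_simps falg.scale_right_diff_distrib)
  qed
  have "q \<in> free_lie T par \<and> \<theta> q - alg_hom f q \<in> N"
    using q unfolding free_lie_eq_span[of T par]
  proof (induction rule: falg.span_induct_alt)
    case base
    have "0 \<in> free_lie T par" using free_lie_subspace falg.subspace_0 by blast
    then show ?case using scale[of 0 0] by (simp add: falg.span_zero)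
  next
    case (step c s p)
    then obtain b where b: "s = bracket_value par b" "set (underlying_word b) \<subseteq> T"
      by (auto simp: lie_monomials_def)
    have s1: "s \<in> free_lie T par" using b by (auto intro: bracket_value_in_free_lie)
    have s: "s \<in> free_lie T par" "fscale c s \<in> free_lie T par" "p \<in> free_lie T par"
      using s1 falg.subspace_scale[OF free_lie_subspace s1] step.IH by (simp_all add: free_lie_eq_span[of T par])
    have "(\<theta> (fscale c s + p) - (\<theta> (fscale c s) + \<theta> p)) + (\<theta> (fscale c s) - fscale c (\<theta> s))
        + fscale c (\<theta> s - alg_hom f s) + (\<theta> p - alg_hom f p) \<in> N"
      using add[OF s(2,3)] scale[OF s(1)] closed(3)[OF mono[OF b(2), folded b(1)]] step.IH
      by (simp only: closed(1) simp_thms)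
    then have "\<theta> (fscale c s + p) - alg_hom f (fscale c s + p) \<in> N"
      by (simp add: falg.scale_right_diff_distrib diff_diff_eq)
    moreover have "fscale c s + p \<in> falg.span (lie_monomials T par)"
      using s unfolding free_lie_eq_span by (rule_tac falg.span_add)
    ultimately show ?case by blast
  qed
  then show ?thesis by blast
qed

section \<open>The ideals of the HNN extension\<close>

lemma lie_ideal_gen_graded: "graded_subspace par (lie_ideal_gen T par R)"
  unfolding graded_subspace_def lie_ideal_gen_def by blast

lemma lie_ideal_gen_relations: "R \<subseteq> lie_ideal_gen T par R"
  unfolding lie_ideal_gen_def by blast

lemma lie_ideal_gen_bracket:
  "f \<in> free_lie T par \<Longrightarrow> p \<in> lie_ideal_gen T par R \<Longrightarrow>
    superbracket par f p \<in> lie_ideal_gen T par R \<and> superbracket par p f \<in> lie_ideal_gen T par R"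
  unfolding lie_ideal_gen_def by blast

lemma lie_ideal_gen_subset:
  "graded_subspace par S \<Longrightarrow> R \<subseteq> S \<Longrightarrow>
    (\<And>f p. f \<in> free_lie T par \<Longrightarrow> p \<in> S \<Longrightarrow> superbracket par f p \<in> S \<and> superbracket par p f \<in> S) \<Longrightarrow>
    lie_ideal_gen T par R \<subseteq> S"
  unfolding lie_ideal_gen_def by blast

context hnn_data
begin

abbreviation "T \<equiv> alphabet I J"
abbreviation F :: "('k, ('i, 'j) letter) free_alg set" where "F \<equiv> free_lie T par"
abbreviation "W \<equiv> hnn_ideal scale gr br e d a I x J"

lemma LT_notin [simp]: "LT \<notin> A_letters I" "LT \<notin> X_letters J"
  by (auto simp: A_letters_def X_letters_def)

lemma Y_subset_T: "Y \<subseteq> T"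
  by (auto simp: alphabet_def)

lemma LT_in_T: "LT \<in> T"
  by (simp add: alphabet_def)

lemma lin_in_free_lie: "lin v \<in> F"
proof -
  have "wmono w \<in> F" if "w \<in> Poly_Mapping.keys (lin v)" for w
    using keys_lin[OF that] Y_subset_T by (auto intro: letter_in_free_lie)
  then show ?thesis
    by (subst free_alg_decomp)
      (intro falg.subspace_sum[OF free_lie_subspace] falg.subspace_scale[OF free_lie_subspace])
qed

lemma lin_homogeneous:
  assumes "v \<in> gr i"
  shows "lin v \<in> homogeneous par i"
proof -
  have "v \<in> span (val ` {y \<in> Y. par y = i})"
    using span_graded[OF order_refl] assms span_basis by auto
  then show ?thesis
  proof (induction rule: span_induct_alt)
    case (step c s v)
    then show ?case
      by (auto simp: lin_add lin_scale lin_val homogeneous_wmono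
          intro!: falg.subspace_add[OF homogeneous_subspace] falg.subspace_scale[OF homogeneous_subspace])
  qed (simp add: homogeneous_def)
qed

lemma superbracket_letters:
  "superbracket par (wmono [y]) (wmono [z]) = wmono [y, z] - fscale (ssign (par y) (par z)) (wmono [z, y])"
  by (subst superbracket_homogeneous[of _ _ "par y" _ "par z"]) (simp_all add: homogeneous_wmono wmono_mult)

lemma hnn_relations_eq:
  "hnn_relations scale gr br e d a I x J = {defect y z | y z. (y, z) \<in> pairs}"
proof -
  have 1: "superbracket par (wmono [y]) (wmono [z]) - lin (br (val y) (val z)) = defect y z" if "y \<in> Y" "z \<in> Y" for y z
    using that LT_notin_Y by (auto simp: superbracket_letters defect_def bra_def)
  have 2: "superbracket par (wmono [LT]) (wmono [LA i]) - lin (d (a i)) = defect LT (LA i)" for i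
    by (simp add: superbracket_letters defect_def bra_def)
  show ?thesis
  proof -
    have "{superbracket par (wmono [y]) (wmono [z]) - lin (br (val y) (val z)) | y z. y \<in> Y \<and> z \<in> Y}
        = {defect y z | y z. y \<in> Y \<and> z \<in> Y}"
      by (intro Collect_cong ex_cong1) (use 1 in auto)
    moreover have "{superbracket par (wmono [LT]) (wmono [LA i]) - lin (d (a i)) | i. i \<in> I} = {defect LT (LA i) | i. i \<in> I}"
      by (simp add: 2)
    moreover have "{defect y z | y z. y \<in> Y \<and> z \<in> Y} \<union> {defect LT (LA i) | i. i \<in> I} = {defect y z | y z. (y, z) \<in> pairs}"
      unfolding pairs_def A_letters_def by blast
    ultimately show ?thesis unfolding hnn_relations_def Let_def by simp
  qed
qed

lemma bra_homogeneous:
  assumes "(y, z) \<in> pairs"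
  shows "bra y z \<in> gr (par y + par z)"
proof (cases "y = LT")
  case True
  then have "z \<in> A_letters I" using assms by (auto simp: pairs_def)
  then have "d (val z) \<in> gr (par z + e)"
    using A_letters_val val_homogeneous by (intro d_graded) auto
  moreover have "bra y z = d (val z)" "par y + par z = par z + e"
    unfolding True by (simp add: bra_def, simp only: letter_parity.simps add.commute)
  ultimately show ?thesis by (simp only:)
next
  case False
  then show ?thesis using assms br_graded val_homogeneous by (auto simp: pairs_def bra_def)
qed

lemma defect_homogeneous:
  assumes "(y, z) \<in> pairs"
  shows "defect y z \<in> homogeneous par (par y + par z)"
  unfolding defect_def
  by (intro falg.subspace_diff[OF homogeneous_subspace] falg.subspace_scale[OF homogeneous_subspace]
      lin_homogeneous bra_homogeneous assms) (simp_all only: homogeneous_wmono word_parity_simps add_0_right add_0_left add.commute)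

lemma defect_in_free_lie:
  assumes "(y, z) \<in> pairs"
  shows "defect y z \<in> F"
proof -
  have "y \<in> T" "z \<in> T" using assms by (auto simp: pairs_def alphabet_def)
  then show ?thesis
    unfolding defect_def superbracket_letters[symmetric]
    by (intro falg.subspace_diff[OF free_lie_subspace] free_lie_superbracket letter_in_free_lie lin_in_free_lie)
qed

section \<open>The Lie ideal and the associative ideal of the relations\<close>

lemma W_eq: "W = lie_ideal_gen T par {defect y z | y z. (y, z) \<in> pairs}"
  by (simp add: hnn_ideal_def hnn_relations_eq)

lemma W_subspace: "falg.subspace W"
  and W_hom_part: "p \<in> W \<Longrightarrow> hom_part par i p \<in> W"
  using lie_ideal_gen_graded unfolding W_eq graded_subspace_iff by blast+

lemma W_bracket: "f \<in> F \<Longrightarrow> p \<in> W \<Longrightarrow> superbracket par f p \<in> W"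
  "f \<in> F \<Longrightarrow> p \<in> W \<Longrightarrow> superbracket par p f \<in> W"
  using lie_ideal_gen_bracket unfolding W_eq by blast+

lemma defect_in_W: "(y, z) \<in> pairs \<Longrightarrow> defect y z \<in> W"
  unfolding W_eq by (rule subsetD[OF lie_ideal_gen_relations]) blast

lemma W_subset_F: "W \<subseteq> F"
  unfolding W_eq
proof (rule lie_ideal_gen_subset)
  show "graded_subspace par F"
    using free_lie_subspace free_lie_hom_part by (auto simp: graded_subspace_iff)
next
  show "{defect y z | y z. (y, z) \<in> pairs} \<subseteq> F" using defect_in_free_lie by blast
next
  fix f p assume "f \<in> F" "p \<in> F"
  then show "superbracket par f p \<in> F \<and> superbracket par p f \<in> F"
    by (simp add: free_lie_superbracket)
qed

lemma relator_eq_defect: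
  assumes "(y, z) \<in> P"
  shows "rel y z = (if y = z then fscale (1 / 2) (defect y z) else defect y z)"
  unfolding defect_eq_relator[OF assms] using two_neq_0 by simp

lemma P_pairs: "P \<subseteq> pairs"
  by (auto simp: P_def)

lemma relator_in_W: "(y, z) \<in> P \<Longrightarrow> rel y z \<in> W"
  using defect_in_W P_pairs falg.subspace_scale[OF W_subspace] by (auto simp: relator_eq_defect)

lemma relator_homogeneous: "(y, z) \<in> P \<Longrightarrow> rel y z \<in> homogeneous par (par y + par z)"
  using defect_homogeneous[of y z] P_pairs falg.subspace_scale[OF homogeneous_subspace, of "defect y z"]
  by (auto simp only: relator_eq_defect split: if_splits)

text \<open>The two-sided ideal of the relators. The quotient by it is the concrete model of
  \<open>U(H)\<close> in which normal forms are computed.\<close>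

definition assoc_ideal :: "('k, ('i, 'j) letter) free_alg set" where
  "assoc_ideal = falg.span {wmono u * rel y z * wmono v | u y z v. (y, z) \<in> P}"

lemma assoc_ideal_subspace: "falg.subspace assoc_ideal"
  by (simp add: assoc_ideal_def)

lemma NF_assoc_ideal: "p \<in> assoc_ideal \<Longrightarrow> NF p = 0"
  unfolding assoc_ideal_def by (induction rule: falg.span_induct_alt) (auto simp: NF_relator)

lemma assoc_ideal_mult:
  assumes "p \<in> assoc_ideal"
  shows "q * p \<in> assoc_ideal" "p * q \<in> assoc_ideal"
proof -
  note closed = falg.subspace_0[OF assoc_ideal_subspace] falg.subspace_add[OF assoc_ideal_subspace]
    falg.subspace_scale[OF assoc_ideal_subspace]
  have gen: "wmono u * rel y z * wmono v \<in> assoc_ideal" if "(y, z) \<in> P" for u y z v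
    unfolding assoc_ideal_def using that by (auto intro!: falg.span_base)
  have left: "wmono w * p \<in> assoc_ideal" for w
    using assms unfolding assoc_ideal_def[unfolded atomize_eq]
  proof (induction rule: falg.span_induct_alt)
    case (step c s p)
    then obtain u y z v where s: "s = wmono u * rel y z * wmono v" "(y, z) \<in> P" by blast
    have "wmono w * s = wmono (w @ u) * rel y z * wmono v"
      by (simp add: s mult.assoc flip: wmono_mult)
    then have "wmono w * s \<in> assoc_ideal" using gen[OF s(2)] by simp
    then show ?case using step.IH unfolding assoc_ideal_def
      by (simp add: distrib_left fscale_mult falg.span_add falg.span_scale)
  qed (simp add: falg.span_zero)
  have right: "p * wmono w \<in> assoc_ideal" for w
    using assms unfolding assoc_ideal_def
  proof (induction rule: falg.span_induct_alt)
    case (step c s p)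
    then obtain u y z v where s: "s = wmono u * rel y z * wmono v" "(y, z) \<in> P" by blast
    have "s * wmono w = wmono u * rel y z * wmono (v @ w)"
      by (simp add: s mult.assoc flip: wmono_mult)
    then have "s * wmono w \<in> assoc_ideal" using gen[OF s(2)] by simp
    then show ?case using step.IH unfolding assoc_ideal_def
      by (simp add: distrib_right fscale_mult falg.span_add falg.span_scale)
  qed (simp add: falg.span_zero)
  show "q * p \<in> assoc_ideal"
    by (induction q rule: free_alg_induct) (simp_all add: left closed distrib_right fscale_mult)
  show "p * q \<in> assoc_ideal"
    by (induction q rule: free_alg_induct) (simp_all add: right closed distrib_left fscale_mult)
qed

lemma defects_subset_assoc_ideal: "defects \<subseteq> assoc_ideal"
  unfolding defects_def
proof (rule falg.span_minimal[OF _ assoc_ideal_subspace], safe)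
  fix y z assume "(y, z) \<in> P"
  then have "wmono [] * rel y z * wmono [] \<in> assoc_ideal"
    unfolding assoc_ideal_def by (blast intro: falg.span_base)
  then show "rel y z \<in> assoc_ideal" by (simp add: wmono_Nil)
qed

lemma assoc_ideal_hom_part: "p \<in> assoc_ideal \<Longrightarrow> hom_part par i p \<in> assoc_ideal"
  unfolding assoc_ideal_def
proof (erule span_hom_part)
  fix s assume "s \<in> {wmono u * rel y z * wmono v | u y z v. (y, z) \<in> P}"
  then obtain u y z v where s: "s = wmono u * rel y z * wmono v" "(y, z) \<in> P" by blast
  then show "\<exists>j. s \<in> homogeneous par j"
    using homogeneous_mult[OF homogeneous_mult[OF _ relator_homogeneous[OF s(2)]]] homogeneous_wmono by blast
qed

lemma superbracket_assoc_ideal: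
  assumes "p \<in> assoc_ideal"
  shows "superbracket par f p \<in> assoc_ideal" "superbracket par p f \<in> assoc_ideal"
proof -
  note closed = falg.subspace_add[OF assoc_ideal_subspace] falg.subspace_scale[OF assoc_ideal_subspace]
    falg.subspace_diff[OF assoc_ideal_subspace] assoc_ideal_mult assoc_ideal_hom_part[OF assms]
  have hom: "superbracket par (hom_part par i f) (hom_part par j p) \<in> assoc_ideal"
    "superbracket par (hom_part par j p) (hom_part par i f) \<in> assoc_ideal" for i j
    by (simp_all add: superbracket_homogeneous[of _ par i _ j] superbracket_homogeneous[of _ par j _ i] closed)
  show "superbracket par f p \<in> assoc_ideal" "superbracket par p f \<in> assoc_ideal"
    using hom by (subst superbracket_decomp, simp add: closed)+
qed

text \<open>A graded two-sided ideal absorbs superbrackets, so it contains the Lie ideal of the same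
  relations. Hence independence modulo \<open>assoc_ideal\<close> gives independence in
  \<open>H\<close>.\<close>

lemma W_subset_assoc_ideal: "W \<subseteq> assoc_ideal"
  unfolding W_eq
proof (rule lie_ideal_gen_subset)
  show "graded_subspace par assoc_ideal"
    using assoc_ideal_subspace assoc_ideal_hom_part by (simp add: graded_subspace_iff)
qed (use defect_in_defects defects_subset_assoc_ideal superbracket_assoc_ideal in auto)

lemma normal_independent:
  assumes "finite K" "\<And>w. w \<in> K \<Longrightarrow> normal w" "(\<Sum>w\<in>K. fscale (c w) (wmono w)) \<in> assoc_ideal" "w \<in> K"
  shows "c w = 0"
proof -
  have "NF (\<Sum>w\<in>K. fscale (c w) (wmono w)) = (\<Sum>w\<in>K. fscale (c w) (wmono w))"
    using assms(2) by simp
  then have "(\<Sum>w\<in>K. fscale (c w) (wmono w)) = 0"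
    using NF_assoc_ideal[OF assms(3)] by simp
  then have "Poly_Mapping.lookup (\<Sum>w\<in>K. fscale (c w) (wmono w)) w = 0" by simp
  also have "Poly_Mapping.lookup (\<Sum>w\<in>K. fscale (c w) (wmono w)) w = c w"
    using assms(1,4) by (simp add: lookup_sum lookup_single when_def if_distrib[of "\<lambda>x. _ * x"] cong: if_cong)
  finally show ?thesis .
qed

lemma rhs_letters:
  assumes "(y, z) \<in> P" "w \<in> Poly_Mapping.keys (rhs y z)"
  shows "set w \<subseteq> T"
proof -
  have yz: "y \<in> T" "z \<in> T" using assms(1) by (auto simp: P_def pairs_def alphabet_def)
  have "set w \<subseteq> T" if "w \<in> Poly_Mapping.keys (lin v)" for v
    using keys_lin[OF that] Y_subset_T by auto
  then show ?thesis
    using yz assms(2)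
    by (auto simp: rhs_def dest!: subsetD[OF keys_add] subsetD[OF keys_fscale_subset] split: if_splits)
qed

section \<open>The basis of the enveloping algebra\<close>

abbreviation "hnn \<equiv> hnn_extension scale gr br e d a I x J"
abbreviation "cl \<equiv> coset W"

lemma hnn_simps:
  "vcarrier hnn = cl ` F" "vzero hnn = W" "lgrade hnn i = cl ` (F \<inter> homogeneous par i)"
  "vadd hnn (cl p) (cl q) = cl (p + q)" "vscale hnn c (cl p) = cl (fscale c p)"
  by (simp_all add: hnn_extension_def lie_quotient_def coset_add coset_scale W_subspace)

text \<open>Other representatives \<open>p + m\<close>, \<open>q + n\<close> change the superbracket
  by three brackets with an entry in \<open>W\<close>, and \<open>W\<close> absorbs brackets with
  \<open>F\<close>.\<close>

lemma hnn_bracket: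
  assumes "p \<in> F" "q \<in> F"
  shows "lbracket hnn (cl p) (cl q) = cl (superbracket par p q)"
proof -
  note closed = falg.subspace_add[OF W_subspace] falg.subspace_0[OF W_subspace]
  have "{superbracket par u v + w | u v w. u \<in> cl p \<and> v \<in> cl q \<and> w \<in> W} = cl (superbracket par p q)"
  proof (intro equalityI subsetI)
    fix y assume "y \<in> {superbracket par u v + w | u v w. u \<in> cl p \<and> v \<in> cl q \<and> w \<in> W}"
    then obtain m n w where y: "y = superbracket par (p + m) (q + n) + w" "m \<in> W" "n \<in> W" "w \<in> W"
      by (auto simp: coset_def)
    have "superbracket par p n + superbracket par m q + superbracket par m n + w \<in> W"
      using assms y W_subset_F by (intro closed W_bracket) auto
    moreover have "y = superbracket par p q + (superbracket par p n + superbracket par m q + superbracket par m n + w)"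
      by (simp add: y algebra_simps)
    ultimately show "y \<in> cl (superbracket par p q)" unfolding coset_def by (rule_tac image_eqI)
  next
    fix y assume "y \<in> cl (superbracket par p q)"
    then obtain w where "y = superbracket par (p + 0) (q + 0) + w" "w \<in> W" by (auto simp: coset_def)
    then show "y \<in> {superbracket par u v + w | u v w. u \<in> cl p \<and> v \<in> cl q \<and> w \<in> W}"
      using closed(2) unfolding coset_def by blast
  qed
  then show ?thesis by (simp add: hnn_extension_def lie_quotient_def)
qed

section \<open>Comparison of the enveloping algebra with the associative quotient\<close>

abbreviation "E \<equiv> env_ideal hnn"
abbreviation "env_words \<equiv> free_alg_on (vcarrier hnn)"

lemma E_relations: "env_relations hnn \<subseteq> E"
  and E_0: "0 \<in> E"
  and E_add: "p \<in> E \<Longrightarrow> q \<in> E \<Longrightarrow> p + q \<in> E"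
  and E_mult: "f \<in> env_words \<Longrightarrow> p \<in> E \<Longrightarrow> f * p \<in> E \<and> p * f \<in> E"
  unfolding env_ideal_def by blast+

lemma E_subspace: "falg.subspace E"
proof (rule falg.subspaceI)
  fix c :: 'k and p assume "p \<in> E"
  \<comment> \<open>Closure under scalars is a case of closure under products, with a multiple of
    the empty word as factor.\<close>
  moreover have "Poly_Mapping.single [] c \<in> env_words" by (auto simp: free_alg_on_def)
  ultimately show "fscale c p \<in> E" using E_mult by (simp add: fscale_conv)
qed (simp_all add: E_0 E_add)

lemma E_vadd: "p \<in> F \<Longrightarrow> q \<in> F \<Longrightarrow> wmono [cl (p + q)] - (wmono [cl p] + wmono [cl q]) \<in> E"
proof -
  assume "p \<in> F" "q \<in> F"
  then have "wmono [vadd hnn (cl p) (cl q)] - wmono [cl p] - wmono [cl q] \<in> env_relations hnn"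
    unfolding env_relations_def hnn_simps(1) by blast
  then show ?thesis using E_relations by (auto simp: hnn_simps diff_diff_eq)
qed

lemma E_vscale: "p \<in> F \<Longrightarrow> wmono [cl (fscale c p)] - fscale c (wmono [cl p]) \<in> E"
proof -
  assume "p \<in> F"
  then have "wmono [vscale hnn c (cl p)] - fscale c (wmono [cl p]) \<in> env_relations hnn"
    unfolding env_relations_def hnn_simps(1) by blast
  then show ?thesis using E_relations by (auto simp: hnn_simps)
qed

lemma E_bracket:
  assumes "p \<in> F" "q \<in> F" "p \<in> homogeneous par i" "q \<in> homogeneous par j"
  shows "wmono [cl (superbracket par p q)]
    - (wmono [cl p] * wmono [cl q] - fscale (ssign i j) (wmono [cl q] * wmono [cl p])) \<in> E"
proof -
  have "cl p \<in> lgrade hnn i" "cl q \<in> lgrade hnn j" using assms by (auto simp: hnn_simps)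
  then have "wmono [lbracket hnn (cl p) (cl q)]
    - (wmono [cl p] * wmono [cl q] - fscale (ssign i j) (wmono [cl q] * wmono [cl p])) \<in> env_relations hnn"
    unfolding env_relations_def by blast
  then show ?thesis using E_relations by (auto simp: hnn_bracket assms)
qed

lemma free_alg_on_mult:
  "p \<in> free_alg_on S \<Longrightarrow> q \<in> free_alg_on S \<Longrightarrow> p * q \<in> free_alg_on S" for p q :: "('c::field, 'b) free_alg"
  by (fastforce simp: free_alg_on_def dest!: keys_mult_words)

text \<open>Every letter becomes the one-letter word consisting of its class in \<open>H\<close>.
  This is the comparison map from the associative presentation to \<open>U(H)\<close>;
  \<open>alg_hom rep\<close> goes back.\<close>

definition \<Psi> :: "('k, ('i, 'j) letter) free_alg \<Rightarrow> ('k, ('k, ('i, 'j) letter) free_alg set) free_alg" where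
  "\<Psi> = alg_hom (\<lambda>z. wmono [cl (wmono [z])])"

lemma \<Psi>_wmono: "\<Psi> (wmono w) = wmono (map (\<lambda>z. cl (wmono [z])) w)"
  unfolding \<Psi>_def alg_hom_wmono
  by (induction w) (simp_all add: wmono_Nil wmono_mult)

lemma \<Psi>_in_subspace:
  "falg.subspace V \<Longrightarrow> (\<And>w. w \<in> Poly_Mapping.keys p \<Longrightarrow> \<Psi> (wmono w) \<in> V) \<Longrightarrow> \<Psi> p \<in> V"
  unfolding \<Psi>_def by (rule alg_hom_in_subspace)

lemma \<Psi>_free_alg_on: "p \<in> free_alg_on T \<Longrightarrow> \<Psi> p \<in> env_words"
proof -
  assume p: "p \<in> free_alg_on T"
  have *: "set w \<subseteq> T \<Longrightarrow> \<Psi> (wmono w) \<in> env_words" for w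
    by (auto simp: \<Psi>_wmono free_alg_on_def hnn_simps intro!: imageI letter_in_free_lie)
  show ?thesis
  proof (rule \<Psi>_in_subspace[OF free_alg_on_subspace])
    fix w assume "w \<in> Poly_Mapping.keys p"
    then have "set w \<subseteq> T" using p by (simp add: free_alg_on_def)
    then show "\<Psi> (wmono w) \<in> env_words" by (rule *)
  qed
qed

lemma \<Psi>_F:
  assumes "q \<in> F"
  shows "wmono [cl q] - \<Psi> q \<in> E"
  unfolding \<Psi>_def
proof (rule free_lie_hom_unique[where T = T and par = par and M = env_words and N = E])
  fix p assume "p \<in> F"
  then have "wmono [cl p] \<in> env_words" by (simp add: free_alg_on_def hnn_simps)
  with \<open>p \<in> F\<close> show "wmono [cl p] \<in> env_words \<and> alg_hom (\<lambda>z. wmono [cl (wmono [z])]) p \<in> env_words"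
    using \<Psi>_free_alg_on[of p] free_lie_subset unfolding \<Psi>_def by blast
qed (use assms E_mult in \<open>auto simp: E_subspace E_vadd E_vscale E_bracket E_0\<close>)

lemma \<Psi>_W: "q \<in> W \<Longrightarrow> \<Psi> q \<in> E"
proof -
  assume q: "q \<in> W"
  \<comment> \<open>The scaling relation with scalar 0 shows that the one-letter word of the zero
    class lies in \<open>E\<close>.\<close>
  then have "cl q = cl (fscale 0 0)" by (simp add: coset_eq_iff W_subspace)
  then have "wmono [cl q] \<in> E"
    using E_vscale[OF falg.subspace_0[OF free_lie_subspace], of 0] by simp
  moreover have "wmono [cl q] - \<Psi> q \<in> E" using q W_subset_F \<Psi>_F by blast
  ultimately show ?thesis using falg.subspace_diff[OF E_subspace] by fastforce
qed

text \<open>Modulo \<open>E\<close>, every word in elements of \<open>H\<close> is the image of a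
  polynomial in the letters, by \<open>\<Psi>_F\<close>. A word in the letters reduces to normal
  ones by well-founded induction, since the relators lie in \<open>W\<close> and
  \<open>\<Psi>\<close> sends \<open>W\<close> into \<open>E\<close>.\<close>

lemma enveloping_spans:
  assumes "m \<in> env_words"
  shows "\<exists>n\<in>E. m - n \<in> falg.span ((\<lambda>w. \<Psi> (wmono w)) ` {w. set w \<subseteq> T \<and> normal w})"
proof -
  let ?S = "falg.span ((\<lambda>w. \<Psi> (wmono w)) ` {w. set w \<subseteq> T \<and> normal w})"
  let ?G = "{m. \<exists>n\<in>E. m - n \<in> ?S}"
  have Geq: "?G = {u + v | u v. u \<in> ?S \<and> v \<in> E}"
  proof (intro equalityI subsetI)
    fix m assume "m \<in> ?G"
    then obtain n where "n \<in> E" "m - n \<in> ?S" by blast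
    moreover have "m = (m - n) + n" by simp
    ultimately show "m \<in> {u + v | u v. u \<in> ?S \<and> v \<in> E}" by blast
  next
    fix m assume "m \<in> {u + v | u v. u \<in> ?S \<and> v \<in> E}"
    then obtain u v where "m = u + v" "u \<in> ?S" "v \<in> E" by blast
    then show "m \<in> ?G" by (auto intro!: bexI[of _ v])
  qed
  have G: "falg.subspace ?G"
    unfolding Geq by (rule falg.subspace_sums[OF falg.subspace_span E_subspace])
  have EG: "p \<in> ?G" if "p \<in> E" for p using that by (auto intro!: bexI[of _ p] falg.span_zero)
  have word: "set w \<subseteq> T \<Longrightarrow> \<Psi> (wmono w) \<in> ?G" for w
  proof (induction w rule: wf_induct_rule[OF wf_word_less[OF r_trans r_irrefl]])
    case (1 w)
    show ?case
    proof (cases "normal w")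
      case True
      with 1 have "\<Psi> (wmono w) - 0 \<in> ?S" by (auto intro!: falg.span_base)
      then show ?thesis using E_0 by blast
    next
      case False
      then obtain u y z v where w: "w = u @ [y, z] @ v" "(y, z) \<in> P" using not_normalD by blast
      have \<Psi>rhs: "\<Psi> (wmono u * rhs y z * wmono v) \<in> ?G"
      proof -
        have keys: "k \<in> Poly_Mapping.keys (wmono u * rhs y z * wmono v) \<Longrightarrow> word_less r k w \<and> set k \<subseteq> T" for k
          using rhs_context_less[OF w(2), of k u v] 1(2) w(1) rhs_letters[OF w(2)]
          by (fastforce dest!: keys_mult_words)
        show ?thesis
        proof (rule \<Psi>_in_subspace[OF G])
          fix k assume "k \<in> Poly_Mapping.keys (wmono u * rhs y z * wmono v)"
          then show "\<Psi> (wmono k) \<in> ?G" using 1(1)[of k] keys by blast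
        qed
      qed
      have uv: "\<Psi> (wmono u) \<in> env_words" "\<Psi> (wmono v) \<in> env_words"
        by (rule \<Psi>_free_alg_on, use 1(2) w(1) in \<open>simp add: free_alg_on_def\<close>)+
      have "\<Psi> (wmono u * rel y z * wmono v) = \<Psi> (wmono u) * \<Psi> (rel y z) * \<Psi> (wmono v)" by (simp add: \<Psi>_def)
      then have "\<Psi> (wmono u * rel y z * wmono v) \<in> E"
        using E_mult[OF uv(2)] E_mult[OF uv(1)] \<Psi>_W[OF relator_in_W[OF w(2)]] by simp
      moreover have "wmono w = wmono u * rel y z * wmono v + wmono u * rhs y z * wmono v"
        by (simp add: relator_def w(1) algebra_simps wmono_mult)
      then have "\<Psi> (wmono w) = \<Psi> (wmono u * rel y z * wmono v) + \<Psi> (wmono u * rhs y z * wmono v)"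
        unfolding \<Psi>_def by (simp del: alg_hom_mult)
      ultimately show ?thesis using \<Psi>rhs EG falg.subspace_add[OF G] by simp
    qed
  qed
  have poly: "\<Psi> p \<in> ?G" if "p \<in> free_alg_on T" for p
    by (rule \<Psi>_in_subspace[OF G], rule word) (use that in \<open>simp add: free_alg_on_def\<close>)
  have approx: "\<exists>p\<in>free_alg_on T. wmono gs - \<Psi> p \<in> E" if "set gs \<subseteq> vcarrier hnn" for gs
    using that
  proof (induction gs)
    case Nil
    have "wmono [] - \<Psi> (wmono []) = 0" by (simp add: \<Psi>_wmono)
    then show ?case using E_0 by (intro bexI[of _ "wmono []"]) (auto simp: free_alg_on_def)
  next
    case (Cons g gs)
    then obtain p where p: "p \<in> free_alg_on T" "wmono gs - \<Psi> p \<in> E" by auto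
    obtain q where q: "q \<in> F" "g = cl q" using Cons.prems by (auto simp: hnn_simps)
    have "wmono [g] * (wmono gs - \<Psi> p) + (wmono [g] - \<Psi> q) * \<Psi> p \<in> E"
      using E_mult \<Psi>_F[OF q(1)] p \<Psi>_free_alg_on[OF p(1)] Cons.prems q(2)
      by (auto intro!: E_add simp: free_alg_on_def[of "vcarrier hnn"])
    then have "wmono (g # gs) - \<Psi> (q * p) \<in> E"
      by (simp add: algebra_simps wmono_mult \<Psi>_def)
    then show ?case using p(1) q(1) free_lie_subset free_alg_on_mult by blast
  qed
  have in_G: "wmono gs \<in> ?G" if gs: "set gs \<subseteq> vcarrier hnn" for gs
  proof -
    obtain p where p: "p \<in> free_alg_on T" "wmono gs - \<Psi> p \<in> E"
      using approx[OF gs] by blast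
    have "(wmono gs - \<Psi> p) + \<Psi> p \<in> ?G"
      by (rule falg.subspace_add[OF G EG[OF p(2)] poly[OF p(1)]])
    then show ?thesis by simp
  qed
  have "m \<in> ?G"
  proof (rule in_subspace_if_words[OF G])
    fix w assume "w \<in> Poly_Mapping.keys m"
    then have "set w \<subseteq> vcarrier hnn" using assms by (simp add: free_alg_on_def)
    then show "wmono w \<in> ?G" by (rule in_G)
  qed
  then show ?thesis by blast
qed

text \<open>An arbitrary representative of a coset, compatible with the operations only modulo
  \<open>W\<close>; this is enough because \<open>W\<close> is contained in
  \<open>assoc_ideal\<close>.\<close>

definition rep :: "('k, ('i, 'j) letter) free_alg set \<Rightarrow> ('k, ('i, 'j) letter) free_alg" where
  "rep X = (SOME p. p \<in> X)"

lemma rep_cl: "rep (cl p) - p \<in> W"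
proof -
  have "p + 0 \<in> cl p" using falg.subspace_0[OF W_subspace] unfolding coset_def by blast
  then have "rep (cl p) \<in> cl p" unfolding rep_def by (rule someI)
  then show ?thesis by (auto simp: coset_def)
qed

lemma rep_env_ideal:
  assumes "p \<in> E"
  shows "alg_hom rep p \<in> assoc_ideal"
proof -
  note closed = falg.subspace_0[OF assoc_ideal_subspace] falg.subspace_add[OF assoc_ideal_subspace]
    falg.subspace_diff[OF assoc_ideal_subspace] falg.subspace_scale[OF assoc_ideal_subspace] assoc_ideal_mult
  have rep: "rep (cl p) - p \<in> assoc_ideal" for p using rep_cl W_subset_assoc_ideal by blast
  let ?S = "{p. alg_hom rep p \<in> assoc_ideal}"
  have rel: "env_relations hnn \<subseteq> ?S"
  proof -
    have 1: "rep (cl (p + q)) - rep (cl p) - rep (cl q) \<in> assoc_ideal" for p q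
      using closed(3)[OF closed(3)[OF rep[of "p + q"] rep[of p]] rep[of q]] by (simp add: algebra_simps)
    have 2: "rep (cl (fscale c p)) - fscale c (rep (cl p)) \<in> assoc_ideal" for c p
      using closed(3)[OF rep[of "fscale c p"] closed(4)[OF rep[of p]], of c]
      by (simp add: algebra_simps falg.scale_right_diff_distrib)
    have 3: "rep (cl p) * rep (cl q) - p * q \<in> assoc_ideal" for p q
    proof -
      have "(rep (cl p) - p) * rep (cl q) + p * (rep (cl q) - q) \<in> assoc_ideal"
        by (intro closed(2) closed(5,6) rep)
      then show ?thesis by (simp add: algebra_simps)
    qed
    have 4: "rep (cl (superbracket par p q)) - (rep (cl p) * rep (cl q) - fscale (ssign i j) (rep (cl q) * rep (cl p))) \<in> assoc_ideal"
      if "p \<in> homogeneous par i" "q \<in> homogeneous par j" for p q i j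
    proof -
      have "(rep (cl (superbracket par p q)) - superbracket par p q)
        - ((rep (cl p) * rep (cl q) - p * q) - fscale (ssign i j) (rep (cl q) * rep (cl p) - q * p)) \<in> assoc_ideal"
        by (intro closed(3,4) rep 3)
      then show ?thesis by (simp add: superbracket_homogeneous[OF that] algebra_simps falg.scale_right_diff_distrib)
    qed
    show ?thesis
      unfolding env_relations_def using 1 2 4
      by (auto simp: hnn_simps hnn_bracket alg_hom_wmono simp del: falg.scale_eq_0_iff)
  qed
  have "E \<subseteq> ?S"
    unfolding env_ideal_def using rel closed by (intro Inter_lower) auto
  with assms show ?thesis by blast
qed

text \<open>\<open>alg_hom rep\<close> undoes \<open>\<Psi>\<close> modulo
  \<open>assoc_ideal\<close> and sends \<open>E\<close> into \<open>assoc_ideal\<close>, so a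
  relation in \<open>U(H)\<close> becomes one between normal words modulo
  \<open>assoc_ideal\<close>.\<close>

lemma enveloping_independent:
  assumes "finite K" "\<And>w. w \<in> K \<Longrightarrow> normal w" "(\<Sum>w\<in>K. fscale (c w) (\<Psi> (wmono w))) \<in> E" "w \<in> K"
  shows "c w = 0"
proof -
  note closed = falg.subspace_0[OF assoc_ideal_subspace] falg.subspace_add[OF assoc_ideal_subspace]
    falg.subspace_diff[OF assoc_ideal_subspace] falg.subspace_scale[OF assoc_ideal_subspace] assoc_ideal_mult
    falg.subspace_sum[OF assoc_ideal_subspace]
  have "alg_hom rep (\<Psi> (wmono w)) - wmono w \<in> assoc_ideal" for w
  proof (induction w)
    case Nil
    then show ?case by (simp add: \<Psi>_wmono alg_hom_wmono closed del: single_one) (simp add: wmono_Nil closed)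
  next
    case (Cons z w)
    have "(rep (cl (wmono [z])) - wmono [z]) * alg_hom rep (\<Psi> (wmono w)) + wmono [z] * (alg_hom rep (\<Psi> (wmono w)) - wmono w) \<in> assoc_ideal"
      using rep_cl W_subset_assoc_ideal Cons.IH by (intro closed(2) closed(5,6)) auto
    then show ?case
      by (simp add: \<Psi>_wmono alg_hom_wmono algebra_simps wmono_mult)
  qed
  then have "(\<Sum>w\<in>K. fscale (c w) (alg_hom rep (\<Psi> (wmono w)) - wmono w)) \<in> assoc_ideal"
    by (intro closed(7) closed(4))
  then have "alg_hom rep (\<Sum>w\<in>K. fscale (c w) (\<Psi> (wmono w))) - (\<Sum>w\<in>K. fscale (c w) (wmono w)) \<in> assoc_ideal"
    by (simp add: falg.scale_right_diff_distrib sum_subtractf)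
  then have "(\<Sum>w\<in>K. fscale (c w) (wmono w)) \<in> assoc_ideal"
    using closed(3)[OF rep_env_ideal[OF assms(3)]] by fastforce
  then show ?thesis using normal_independent assms by blast
qed

theorem enveloping_basis:
  "is_basis (enveloping hnn) (\<lambda>w. env_product hnn (map (\<lambda>z. cl (wmono [z])) w)) (env_basis_words r par I J)"
  unfolding env_product_def \<Psi>_wmono[symmetric]
proof (rule is_basis_quotient[where M = env_words])
  fix w assume "w \<in> env_basis_words r par I J"
  then show "\<Psi> (wmono w) \<in> env_words"
    by (intro \<Psi>_free_alg_on) (simp add: env_basis_words_eq free_alg_on_def)
next
  fix K c w
  assume "finite K" "K \<subseteq> env_basis_words r par I J" "(\<Sum>w\<in>K. fscale (c w) (\<Psi> (wmono w))) \<in> E" "w \<in> K"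
  then show "c w = 0"
    using enveloping_independent[of K c w] by (auto simp: env_basis_words_eq)
next
  fix m :: "('k, ('k, ('i, 'j) letter) free_alg set) free_alg" assume "m \<in> env_words"
  then show "\<exists>n\<in>E. m - n \<in> falg.span ((\<lambda>w. \<Psi> (wmono w)) ` env_basis_words r par I J)"
    unfolding env_basis_words_eq by (rule enveloping_spans)
qed (simp_all add: enveloping_def E_subspace)

end

section \<open>Lyndon--Shirshov factorizations\<close>

lemma lex_less_extension: "v \<noteq> [] \<Longrightarrow> irrefl r \<Longrightarrow> lex_less r (u @ v) u"
  using lex_less_append_left[of r u v "[]"] by (cases v) auto

text \<open>Either the words differ at some letter, and then continuing \<open>u\<close> changes
  nothing, or \<open>v\<close> properly extends \<open>u\<close>; extensions are smaller in this
  order.\<close>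

lemma lex_less_cases:
  "lex_less r v u \<Longrightarrow> (\<forall>q. lex_less r v (u @ q)) \<or> (\<exists>v'. v' \<noteq> [] \<and> v = u @ v')"
  by (induction r v u rule: lex_less.induct) auto

lemma lex_less_appendD:
  "lex_less r v (l @ w) \<Longrightarrow> lex_less r v l \<or> (\<exists>v'. v = l @ v' \<and> lex_less r v' w)"
  by (induction r v l rule: lex_less.induct) auto

text \<open>The description of Lyndon--Shirshov words by suffixes instead of rotations, which
  behaves better under concatenation.\<close>

definition dominant :: "'x rel \<Rightarrow> 'x list \<Rightarrow> bool" where
  "dominant r w \<longleftrightarrow> w \<noteq> [] \<and> (\<forall>u v. w = u @ v \<longrightarrow> u \<noteq> [] \<longrightarrow> v \<noteq> [] \<longrightarrow> lex_less r v w)"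

lemma dominant_imp_lyndon_shirshov: "dominant r w \<Longrightarrow> lyndon_shirshov r w"
  unfolding dominant_def lyndon_shirshov_def
  using lex_less_append[of r _ w _ "[]"] by fastforce

lemma dominant_singleton [simp]: "dominant r [z]"
  by (auto simp: dominant_def Cons_eq_append_conv)

text \<open>The delicate point is \<open>v < u v\<close> when \<open>v = u v'\<close>: dominance of
  \<open>v\<close> gives \<open>v' < v\<close>, and the common prefix \<open>u\<close> is put in
  front.\<close>

lemma dominant_append:
  assumes r: "trans r" "irrefl r" and u: "dominant r u" and v: "dominant r v" and less: "lex_less r v u"
  shows "dominant r (u @ v)"
proof -
  have ne: "u \<noteq> []" "v \<noteq> []" using u v by (auto simp: dominant_def)
  have v_less: "lex_less r v (u @ v)"
    using lex_less_cases[OF less]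
  proof
    assume "\<exists>v'. v' \<noteq> [] \<and> v = u @ v'"
    then obtain v' where v': "v' \<noteq> []" "v = u @ v'" by blast
    then have "lex_less r v' v" using v ne unfolding dominant_def by blast
    then have "lex_less r (u @ v') (u @ v)" by (simp add: lex_less_append_left r)
    then show ?thesis using v' by simp
  qed blast
  have "lex_less r s (u @ v)" if "u @ v = p @ s" "p \<noteq> []" "s \<noteq> []" for p s
    using that(1) unfolding append_eq_append_conv2
  proof (elim exE disjE conjE)
    fix p' assume p': "u = p @ p'" "p' @ v = s"
    show ?thesis
    proof (cases "p' = []")
      case True
      then show ?thesis using p' v_less by simp
    next
      case False
      then have "lex_less r p' u" using u p' that unfolding dominant_def by blast
      then show ?thesis using lex_less_append[of r p' u v v] p' by simp
    qed
  next
    fix p' assume p': "u @ p' = p" "v = p' @ s"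
    show ?thesis
    proof (cases "p' = []")
      case True
      then show ?thesis using p' v_less by simp
    next
      case False
      then have "lex_less r s v" using v p' that unfolding dominant_def by blast
      then show ?thesis using lex_less_trans[OF r(1)] v_less by blast
    qed
  qed
  then show ?thesis using ne by (auto simp: dominant_def)
qed

text \<open>If \<open>u = v u'\<close>, then \<open>u' < v u'\<close> by dominance, whence
  \<open>u' < v\<close>. The result is needed when the right neighbour of a factor has been merged
  into a square.\<close>

lemma dominant_less_square:
  assumes r: "irrefl r" and u: "dominant r u" and v: "dominant r v" and less: "lex_less r u v"
  shows "lex_less r u (v @ v)"
  using lex_less_cases[OF less]
proof
  assume "\<exists>u'. u' \<noteq> [] \<and> u = v @ u'"
  then obtain u' where u': "u' \<noteq> []" "u = v @ u'" by blast
  then have "lex_less r u' (v @ u')" using u v unfolding dominant_def by blast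
  then have "lex_less r u' v"
    by (auto dest!: lex_less_appendD intro!: lex_less_extension r)
  then show ?thesis by (simp add: u' lex_less_append_left r)
qed blast

text \<open>Take a factorization with the fewest dominant factors, starting from single letters:
  neighbours with \<open>v < u\<close> could be merged by \<open>dominant_append\<close>.\<close>

lemma lyndon_factorization:
  assumes r: "trans r" "irrefl r" "total_on T r" and w: "set w \<subseteq> T"
  shows "\<exists>ls. concat ls = w \<and> (\<forall>l\<in>set ls. dominant r l) \<and> successively (\<lambda>u v. lex_less r u v \<or> u = v) ls"
proof -
  let ?F = "\<lambda>ls. concat ls = w \<and> (\<forall>l\<in>set ls. dominant r l)"
  have "?F (map (\<lambda>z. [z]) w)" by auto
  then obtain ls where ls: "?F ls" "\<And>ls'. ?F ls' \<Longrightarrow> length ls \<le> length ls'"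
    using ex_has_least_nat[of ?F _ length] by blast
  have "successively (\<lambda>u v. lex_less r u v \<or> u = v) ls"
  proof (rule ccontr)
    assume "\<not> ?thesis"
    then obtain p u v q where *: "ls = p @ [u, v] @ q" "\<not> (lex_less r u v \<or> u = v)"
      using not_successivelyD by blast
    have "set u \<subseteq> T" "set v \<subseteq> T" using ls(1) w *(1) by auto
    then have "lex_less r v u" using lex_less_total[OF r(3)] *(2) by blast
    then have "?F (p @ [u @ v] @ q)" using ls(1) *(1) dominant_append[OF r(1,2)] by auto
    from ls(2)[OF this] show False using *(1) by simp
  qed
  with ls(1) show ?thesis by blast
qed

text \<open>Pairs up equal neighbours satisfying \<open>f\<close>, which will mean being odd. A run
  of such factors becomes squares followed by at most one single factor, in increasing order because
  \<open>u u < u\<close>.\<close>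

fun square_odd :: "('x list \<Rightarrow> bool) \<Rightarrow> 'x list list \<Rightarrow> 'x list list" where
  "square_odd f (u # v # ls) =
     (if u = v \<and> f u then (u @ u) # square_odd f ls else u # square_odd f (v # ls))"
| "square_odd f ls = ls"

lemma square_odd_concat: "concat (square_odd f ls) = concat ls"
  by (induction f ls rule: square_odd.induct) auto

lemma square_odd_elems: "u \<in> set (square_odd f ls) \<Longrightarrow> u \<in> set ls \<or> (\<exists>l\<in>set ls. u = l @ l \<and> f l)"
  by (induction f ls rule: square_odd.induct) (auto split: if_splits)

lemma square_odd_hd:
  "ls \<noteq> [] \<Longrightarrow> square_odd f ls \<noteq> [] \<and>
     (hd (square_odd f ls) = hd ls \<or> f (hd ls) \<and> hd (square_odd f ls) = hd ls @ hd ls)"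
  by (induction f ls rule: square_odd.induct) auto

lemma square_odd_chain:
  assumes r: "trans r" "irrefl r" and f: "\<And>u. \<not> f (u @ u)"
    and "\<forall>l\<in>set ls. dominant r l" "successively (\<lambda>u v. lex_less r u v \<or> u = v) ls"
  shows "successively (\<lambda>u v. lex_less r u v \<or> u = v \<and> \<not> f u) (square_odd f ls)"
  using assms(3-5)
proof (induction f ls rule: square_odd.induct)
  case (1 f u v ls)
  have dom: "dominant r u" "dominant r v" "\<forall>l\<in>set ls. dominant r l"
    and uv: "lex_less r u v \<or> u = v" and chain: "successively (\<lambda>u v. lex_less r u v \<or> u = v) (v # ls)"
    using "1.prems" by auto
  have square: "lex_less r (w @ w) w" if "dominant r w" for w
    using that by (intro lex_less_extension r(2)) (auto simp: dominant_def)
  show ?case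
  proof (cases "u = v \<and> f u")
    case True
    have IH: "successively (\<lambda>u v. lex_less r u v \<or> u = v \<and> \<not> f u) (square_odd f ls)"
      using "1.IH"(1)[OF True] "1.prems" dom(3) chain by (auto simp: successively_Cons)
    have "lex_less r (u @ u) (hd (square_odd f ls)) \<or> u @ u = hd (square_odd f ls) \<and> \<not> f (u @ u)"
      if "square_odd f ls \<noteq> []"
    proof -
      have ls: "ls \<noteq> []" using that by auto
      let ?w = "hd ls"
      have w: "dominant r ?w" "lex_less r u ?w \<or> u = ?w"
        using ls dom chain True by (auto simp: successively_Cons)
      have "lex_less r (u @ u) ?w" "lex_less r (u @ u) (?w @ ?w) \<or> u @ u = ?w @ ?w"
        using w square[OF dom(1)] dominant_less_square[OF r(2) dom(1) w(1)] lex_less_trans[OF r(1)] by auto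
      then show ?thesis using square_odd_hd[OF ls, of f] "1.prems"(1) by auto
    qed
    then show ?thesis using True IH by (auto simp: successively_Cons)
  next
    case False
    have IH: "successively (\<lambda>u v. lex_less r u v \<or> u = v \<and> \<not> f u) (square_odd f (v # ls))"
      using "1.IH"(2)[OF False] "1.prems" by auto
    have "lex_less r u (hd (square_odd f (v # ls))) \<or> u = hd (square_odd f (v # ls)) \<and> \<not> f u"
      using square_odd_hd[of "v # ls" f] uv False dominant_less_square[OF r(2) dom(1,2)] by auto
    then show ?thesis using False IH by (auto simp: successively_Cons)
  qed
qed auto

text \<open>The squares are even and may repeat, odd factors may not: this is the normality
  condition for words over a homogeneous basis of a Lie superalgebra.\<close>

lemma super_lyndon_factorization:
  assumes r: "trans r" "irrefl r" "total_on T r" and w: "set w \<subseteq> T"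
  shows "\<exists>ss. concat ss = w \<and>
    (\<forall>u\<in>set ss. dominant r u \<or> (\<exists>l. u = l @ l \<and> dominant r l \<and> word_parity par l = 1)) \<and>
    successively (\<lambda>u v. lex_less r u v \<or> u = v \<and> word_parity par u \<noteq> 1) ss"
proof -
  obtain ls where ls: "concat ls = w" "\<forall>l\<in>set ls. dominant r l" "successively (\<lambda>u v. lex_less r u v \<or> u = v) ls"
    using lyndon_factorization[OF assms] by blast
  let ?f = "\<lambda>u. word_parity par u = 1"
  have "\<not> ?f (u @ u)" for u by simp
  from square_odd_chain[of r ?f, OF r(1,2) this ls(2,3)] square_odd_concat[of ?f ls] square_odd_elems[of _ ?f ls] ls
  show ?thesis by (intro exI[of _ "square_odd ?f ls"]) blast
qed

section \<open>Leading words\<close>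

text \<open>Sharper than \<open>leading_word\<close>: the other words are rearrangements of
  \<open>u\<close>, hence smaller for \<open>word_less\<close> too. Any nonzero coefficient is
  allowed, since products collect powers of 2.\<close>

definition has_lead :: "'x rel \<Rightarrow> ('k::field, 'x) free_alg \<Rightarrow> 'x list \<Rightarrow> bool" where
  "has_lead r p u \<longleftrightarrow> (\<exists>c p'. c \<noteq> 0 \<and> p = fscale c (wmono u) + p' \<and>
     (\<forall>w\<in>Poly_Mapping.keys p'. mset w = mset u \<and> lex_less r w u))"

lemma has_lead_Nil: "has_lead r 1 []"
  unfolding has_lead_def by (intro exI[of _ 1] exI[of _ 0]) (simp add: wmono_Nil)

text \<open>Rearrangements have the same length, so products of words are compared block by
  block.\<close>

lemma has_lead_mult:
  assumes "irrefl r" "has_lead r p u" "has_lead r q v"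
  shows "has_lead r (p * q) (u @ v)"
proof -
  obtain c p' where p: "c \<noteq> 0" "p = fscale c (wmono u) + p'"
    "\<And>w. w \<in> Poly_Mapping.keys p' \<Longrightarrow> mset w = mset u \<and> lex_less r w u"
    using assms(2) by (auto simp: has_lead_def)
  obtain b q' where q: "b \<noteq> 0" "q = fscale b (wmono v) + q'"
    "\<And>w. w \<in> Poly_Mapping.keys q' \<Longrightarrow> mset w = mset v \<and> lex_less r w v"
    using assms(3) by (auto simp: has_lead_def)
  let ?s = "fscale c (wmono u * q') + fscale b (p' * wmono v) + p' * q'"
  have "p * q = fscale (c * b) (wmono (u @ v)) + ?s"
    by (simp add: p q algebra_simps fscale_mult wmono_mult falg.scale_right_distrib)
  moreover have "mset w = mset (u @ v) \<and> lex_less r w (u @ v)" if "w \<in> Poly_Mapping.keys ?s" for w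
  proof -
    have "w \<in> Poly_Mapping.keys (wmono u * q') \<union> Poly_Mapping.keys (p' * wmono v) \<union> Poly_Mapping.keys (p' * q')"
      using that by (auto dest!: subsetD[OF keys_add] subsetD[OF keys_fscale_subset])
    then obtain u' v' where w: "w = u' @ v'" "u' = u \<and> v' \<in> Poly_Mapping.keys q' \<or> u' \<in> Poly_Mapping.keys p' \<and> (v' = v \<or> v' \<in> Poly_Mapping.keys q')"
      by (auto dest!: keys_mult_words)
    from w(2) show ?thesis
    proof
      assume "u' = u \<and> v' \<in> Poly_Mapping.keys q'"
      then show ?thesis using q(3)[of v'] w(1) by (simp add: lex_less_append_left assms)
    next
      assume *: "u' \<in> Poly_Mapping.keys p' \<and> (v' = v \<or> v' \<in> Poly_Mapping.keys q')"
      then have "mset u' = mset u" "lex_less r u' u" "mset v' = mset v" using p(3) q(3) by auto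
      then show ?thesis using w(1) lex_less_append[of r u' u v' v] by (auto dest: mset_eq_length)
    qed
  qed
  ultimately show ?thesis
    unfolding has_lead_def using p(1) q(1) by (intro exI[of _ "c * b"] exI[of _ ?s]) auto
qed

lemma bracket_value_keys:
  "w \<in> Poly_Mapping.keys (bracket_value par b :: ('k::field, 'x) free_alg) \<Longrightarrow> mset w = mset (underlying_word b)"
proof (induction b arbitrary: w)
  case (Bracket b b')
  have "w \<in> Poly_Mapping.keys (bracket_value par b * bracket_value par b' :: ('k, 'x) free_alg) \<union>
      Poly_Mapping.keys (bracket_value par b' * bracket_value par b :: ('k, 'x) free_alg)"
    using Bracket.prems
    unfolding bracket_value.simps superbracket_homogeneous[OF bracket_value_homogeneous bracket_value_homogeneous]
    by (auto dest!: subsetD[OF keys_diff] subsetD[OF keys_fscale_subset])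
  then show ?case using Bracket.IH by (auto dest!: keys_mult_words)
qed simp

lemma leading_word_has_lead:
  assumes "leading_word r (bracket_value par b :: ('k::field, 'x) free_alg) u" "underlying_word b = u"
  shows "has_lead r (bracket_value par b :: ('k, 'x) free_alg) u"
proof -
  let ?p = "bracket_value par b :: ('k, 'x) free_alg"
  let ?c = "Poly_Mapping.lookup ?p u"
  let ?p' = "?p - fscale ?c (wmono u)"
  have "mset w = mset u \<and> lex_less r w u" if "w \<in> Poly_Mapping.keys ?p'" for w
  proof -
    have "w \<noteq> u" using that by (auto simp: in_keys_iff lookup_minus)
    moreover from this have "w \<in> Poly_Mapping.keys ?p"
      using that by (auto simp: in_keys_iff lookup_minus lookup_single)
    moreover from this have "mset w = mset u" "length w = length u"
      using bracket_value_keys[of w par b] mset_eq_length[of w u] assms(2) by auto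
    ultimately show ?thesis
      using assms(1) by (auto simp: leading_word_def deglex_less_def)
  qed
  moreover have "?c \<noteq> 0" using assms(1) by (auto simp: leading_word_def in_keys_iff)
  ultimately show ?thesis unfolding has_lead_def by (intro exI[of _ ?c] exI[of _ ?p']) simp
qed

section \<open>Independence and spanning for the Lie superalgebra\<close>

text \<open>Indexes all three kinds of basis monomials by their words; on letters and on
  \<open>t t\<close> the bracketing is prescribed rather than taken from \<open>bk\<close>.\<close>

definition monomial_of :: "(('i, 'j) letter list \<Rightarrow> ('i, 'j) letter bracketing) \<Rightarrow> ('i, 'j) letter list \<Rightarrow> ('i, 'j) letter bracketing" where
  "monomial_of bk u = (if length u = 1 then Letter (hd u) else if u = [LT, LT] then Bracket (Letter LT) (Letter LT) else bk u)"

locale hnn_bracketings = hnn_data scale gr br A e d a I C x J r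
  for scale :: "'k::field \<Rightarrow> 'l::ab_group_add \<Rightarrow> 'l" and gr and br and A and e and d
    and a :: "'i \<Rightarrow> 'l" and I and C and x :: "'j \<Rightarrow> 'l" and J and r +
  fixes bk :: "('i, 'j) letter list \<Rightarrow> ('i, 'j) letter bracketing"
  assumes bk: "\<And>u. set u \<subseteq> alphabet I J \<Longrightarrow> super_lyndon_shirshov r par u \<Longrightarrow> admissible TYPE('k) r par u (bk u)"
begin

definition basis_words :: "('i, 'j) letter list set" where
  "basis_words = {[y] | y. y \<in> T} \<union> (if e = 1 then {[LT, LT]} else {}) \<union>
     {u. \<exists>s\<ge>1. u \<in> tX_products r par J s \<and> super_lyndon_shirshov r par u}"

lemma tX_not_short:
  assumes "u \<in> tX_products r par J s" "s \<ge> 1"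
  shows "length u \<noteq> 1" "u \<noteq> [LT, LT]"
proof -
  have "u \<noteq> []" "hd u = LT" "last u \<in> X_letters J" using tX_products_normal[OF assms(1)] assms(2) by auto
  then show "length u \<noteq> 1" "u \<noteq> [LT, LT]" by (auto simp: length_Suc_conv)
qed

lemma hnn_basis_monomials_eq: "hnn_basis_monomials r par I J bk = monomial_of bk ` basis_words"
proof -
  have "{[y] | y. y \<in> T} = (\<lambda>y. [y]) ` T" by blast
  moreover have "(\<lambda>y. monomial_of bk [y]) ` T = Letter ` T" by (simp add: monomial_of_def)
  ultimately have "monomial_of bk ` {[y] | y. y \<in> T} = Letter ` T" by (simp only: image_image)
  also have "\<dots> = Letter ` Y \<union> {Letter LT}" unfolding alphabet_def by blast
  finally have 1: "monomial_of bk ` {[y] | y. y \<in> T} = Letter ` Y \<union> {Letter LT}" .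
  have 2: "monomial_of bk ` {u. \<exists>s\<ge>1. u \<in> tX_products r par J s \<and> super_lyndon_shirshov r par u}
      = {bk u | u s. s \<ge> 1 \<and> u \<in> tX_products r par J s \<and> super_lyndon_shirshov r par u}"
  proof -
    have "monomial_of bk u = bk u" if "s \<ge> 1" "u \<in> tX_products r par J s" for u s
      using tX_not_short[OF that(2,1)] by (simp add: monomial_of_def)
    then have "monomial_of bk ` {u. \<exists>s\<ge>1. u \<in> tX_products r par J s \<and> super_lyndon_shirshov r par u}
        = bk ` {u. \<exists>s\<ge>1. u \<in> tX_products r par J s \<and> super_lyndon_shirshov r par u}"
      by (intro image_cong) auto
    then show ?thesis by blast
  qed
  show ?thesis
    unfolding hnn_basis_monomials_def basis_words_def image_Un 1 2
    by (auto simp: monomial_of_def)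
qed

lemma basis_words_normal:
  assumes "u \<in> basis_words"
  shows "set u \<subseteq> T" "normal u"
proof -
  consider y where "u = [y]" "y \<in> T" | "u = [LT, LT]" | s where "u \<in> tX_products r par J s"
    using assms by (auto simp: basis_words_def split: if_splits)
  then have "set u \<subseteq> T \<and> normal u"
  proof cases
    case (3 s)
    then show ?thesis using tX_products_normal[OF 3] by (auto simp: alphabet_def)
  qed (auto simp: normal_Cons LT_in_T)
  then show "set u \<subseteq> T" "normal u" by auto
qed

abbreviation bv :: "('i, 'j) letter list \<Rightarrow> ('k, ('i, 'j) letter) free_alg" where
  "bv u \<equiv> bracket_value par (monomial_of bk u)"

lemma basis_words_lead:
  assumes "u \<in> basis_words"
  shows "underlying_word (monomial_of bk u) = u \<and> has_lead r (bv u) u"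
proof -
  consider y where "u = [y]" | "u = [LT, LT]" "e = 1"
    | s where "s \<ge> 1" "u \<in> tX_products r par J s" "super_lyndon_shirshov r par u"
    using assms by (auto simp: basis_words_def split: if_splits)
  then show ?thesis
  proof cases
    case (1 y)
    have "has_lead r (wmono [y]) [y]"
      unfolding has_lead_def by (intro exI[of _ 1] exI[of _ 0]) simp
    then show ?thesis by (simp add: monomial_of_def 1)
  next
    case 2
    have "ssign (par LT) (par LT) = (-1 :: 'k)"
      unfolding letter_parity.simps ssign_def using 2(2) by simp
    then have "superbracket par (wmono [LT]) (wmono [LT]) = fscale 2 (wmono [LT, LT] :: ('k, ('i, 'j) letter) free_alg) + 0"
      using falg.scale_left_distrib[of "1::'k" 1 "wmono [LT, LT] :: ('k, ('i, 'j) letter) free_alg"]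
      unfolding superbracket_letters by (simp add: fscale_minus_one)
    then show ?thesis
      unfolding has_lead_def using two_neq_0
      by (intro conjI exI[of _ 2] exI[of _ 0]) (simp_all add: monomial_of_def 2(1))
  next
    case (3 s)
    have "admissible TYPE('k) r par u (bk u)" using bk basis_words_normal(1)[OF assms] 3(3) by blast
    then show ?thesis
      using tX_not_short[OF 3(2,1)] leading_word_has_lead[of r par "bk u" u]
      by (auto simp: admissible_def monomial_of_def)
  qed
qed

lemma bv_in_F: "u \<in> basis_words \<Longrightarrow> bv u \<in> F"
  using basis_words_lead basis_words_normal(1) by (metis bracket_value_in_free_lie)

lemma bv_homogeneous: "u \<in> basis_words \<Longrightarrow> bv u \<in> homogeneous par (word_parity par u)"
  using bracket_value_homogeneous[of par "monomial_of bk u"] basis_words_lead by metis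

text \<open>The normal word \<open>u\<close> is fixed by reduction, while everything below it stays
  below it and cannot cancel it.\<close>

lemma lead_NF:
  assumes "has_lead r p u" "normal u"
  shows "Poly_Mapping.lookup (NF p) u \<noteq> 0"
    and "v \<in> Poly_Mapping.keys (NF p) \<Longrightarrow> v = u \<or> word_less r v u"
proof -
  obtain c p' where p: "c \<noteq> 0" "p = fscale c (wmono u) + p'"
    "\<And>w. w \<in> Poly_Mapping.keys p' \<Longrightarrow> mset w = mset u \<and> lex_less r w u"
    using assms(1) by (auto simp: has_lead_def)
  have *: "word_less r v u" if "v \<in> Poly_Mapping.keys (NF p')" for v
  proof -
    obtain w where "w \<in> Poly_Mapping.keys p'" "v \<in> Poly_Mapping.keys (nf w)"
      using \<open>v \<in> Poly_Mapping.keys (NF p')\<close> unfolding lin_ext_def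
      by (blast dest!: subsetD[OF keys_sum_subset] subsetD[OF keys_fscale_subset])
    then have "word_less r w u" "v = w \<or> word_less r v w"
      using p(3) nf_keys[of v w] by (auto simp: word_less_def)
    then show ?thesis using word_less_trans[OF r_trans] by blast
  qed
  have "u \<notin> Poly_Mapping.keys (NF p')" using * word_less_irrefl[OF r_irrefl] by blast
  moreover have NF: "NF p = fscale c (wmono u) + NF p'" using assms(2) by (simp add: p(2))
  ultimately show "Poly_Mapping.lookup (NF p) u \<noteq> 0"
    using p(1) by (simp add: lookup_add in_keys_iff)
  assume "v \<in> Poly_Mapping.keys (NF p)"
  then have "v = u \<or> v \<in> Poly_Mapping.keys (NF p')"
    unfolding NF by (auto dest!: subsetD[OF keys_add] subsetD[OF keys_fscale_subset])
  then show "v = u \<or> word_less r v u" using * by blast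
qed

lemma bv_independent:
  assumes "finite K" "K \<subseteq> basis_words" "(\<Sum>u\<in>K. fscale (c u) (bv u)) \<in> assoc_ideal" "u \<in> K"
  shows "c u = 0"
proof (rule ccontr)
  assume "c u \<noteq> 0"
  let ?K = "{u \<in> K. c u \<noteq> 0}"
  \<comment> \<open>\<open>word_less\<close> is only a partial order, but a maximal word suffices:
    another term containing \<open>m\<close> in its normal form would have its own leading word
    above \<open>m\<close>.\<close>
  have "\<exists>m\<in>?K. \<forall>v\<in>?K. v \<noteq> m \<longrightarrow> \<not> word_less r m v"
  proof (rule Finite_Set.bex_max_element)
    show "asymp_on ?K (word_less r)"
      by (rule asymp_onI) (meson word_less_trans[OF r_trans] word_less_irrefl[OF r_irrefl])
    show "transp_on ?K (word_less r)"
      by (rule transp_onI) (meson word_less_trans[OF r_trans])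
  qed (use assms \<open>c u \<noteq> 0\<close> in auto)
  then obtain m where m: "m \<in> K" "c m \<noteq> 0" "\<And>v. v \<in> K \<Longrightarrow> c v \<noteq> 0 \<Longrightarrow> v \<noteq> m \<Longrightarrow> \<not> word_less r m v"
    by blast
  have zero: "c v * Poly_Mapping.lookup (NF (bv v)) m = 0" if "v \<in> K" "v \<noteq> m" for v
  proof (cases "c v = 0")
    case False
    have "v \<in> basis_words" using that assms(2) by blast
    then have "m \<notin> Poly_Mapping.keys (NF (bv v))"
      using lead_NF(2)[OF conjunct2[OF basis_words_lead] basis_words_normal(2), of v m] m(3)[OF that(1) False that(2)] that(2)
      by blast
    then show ?thesis by (simp add: in_keys_iff)
  qed simp
  have "0 = Poly_Mapping.lookup (NF (\<Sum>u\<in>K. fscale (c u) (bv u))) m"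
    using NF_assoc_ideal[OF assms(3)] by simp
  also have "\<dots> = (\<Sum>v\<in>K. c v * Poly_Mapping.lookup (NF (bv v)) m)"
    by (simp add: lookup_sum)
  also have "\<dots> = (\<Sum>v\<in>K. if v = m then c m * Poly_Mapping.lookup (NF (bv m)) m else 0)"
    using zero by (intro sum.cong) auto
  also have "\<dots> = c m * Poly_Mapping.lookup (NF (bv m)) m"
    using assms(1) m(1) by simp
  finally show False
    using m(1,2) assms(2) lead_NF(1)[OF conjunct2[OF basis_words_lead] basis_words_normal(2), of m] by auto
qed

text \<open>A normal super-Lyndon--Shirshov word of length at least two begins with \<open>t\<close>, since a normal
  word without \<open>t\<close> is nondecreasing, and it cannot end with \<open>t\<close>.\<close>

lemma dominant_normal_tX:
  assumes "dominant r u" "normal u" "set u \<subseteq> T" "length u \<noteq> 1"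
  shows "\<exists>s\<ge>1. u \<in> tX_products r par J s"
proof -
  have ne: "u \<noteq> []" using assms(1) by (auto simp: dominant_def)
  with assms(4) obtain y z v where u: "u = y # z # v" by (cases u; cases "tl u") auto
  have irr: "(w, w) \<notin> r" for w using r_irrefl by (auto simp: irrefl_def)
  \<comment> \<open>Compare \<open>u\<close> with its last letter as a suffix; equality of the first
    letters is excluded because a proper prefix is larger.\<close>
  have last: "(last u, y) \<in> r"
  proof -
    have "u = butlast u @ [last u]" "butlast u \<noteq> []" using u by auto
    then have "lex_less r [last u] u" using assms(1) unfolding dominant_def by (metis list.distinct(1))
    then show ?thesis using u by simp
  qed
  have hd: "y = LT"
  proof (rule ccontr)
    assume "y \<noteq> LT"
    have le: "w \<in> set u \<Longrightarrow> w = y \<or> (w, y) \<in> r" for w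
    proof -
      assume "w \<in> set u"
      then obtain p q where pq: "u = p @ w # q" by (meson split_list)
      show ?thesis
      proof (cases "p = []")
        case True
        then show ?thesis using pq u by simp
      next
        case False
        then have "lex_less r (w # q) u" using assms(1) pq unfolding dominant_def by blast
        then show ?thesis using u by auto
      qed
    qed
    have Y: "set u \<subseteq> Y"
    proof
      fix w assume w: "w \<in> set u"
      have "w \<noteq> LT"
      proof
        assume "w = LT"
        then have "(LT, y) \<in> r" using le[OF w] \<open>y \<noteq> LT\<close> by auto
        moreover have "(y, LT) \<in> r" using Y_less_LT assms(3) u \<open>y \<noteq> LT\<close> by (auto simp: alphabet_def)
        ultimately show False using r_trans irr by (meson transD)
      qed
      then show "w \<in> Y" using w assms(3) by (auto simp: alphabet_def)
    qed
    let ?Q = "\<lambda>y z. (y, z) \<in> r \<or> y = z"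
    have "successively ?Q u"
      using assms(2) unfolding normal_def
      by (rule successively_mono) (use Y Y_notin_P in blast)
    moreover have "transp ?Q" using r_trans by (auto intro!: transpI dest: transD)
    ultimately have "sorted_wrt ?Q u" by (simp add: successively_conv_sorted_wrt)
    then have "?Q y (last u)" using u by auto
    then show False using last r_trans irr by (metis transD)
  qed
  have X: "set u \<subseteq> X_letters J \<union> {LT}"
    using no_A_letters[OF assms(2,3)] u hd by simp
  then obtain s w' \<delta> where w: "u = w' @ replicate \<delta> LT" "w' \<in> tX_products r par J s"
    using tX_decomposition[OF X assms(2)] u hd by auto
  have "last u \<noteq> LT" using last hd irr by auto
  then have "\<delta> = 0" using w(1) by (cases \<delta>) (auto simp: replicate_append_same[symmetric])
  then have "u \<in> tX_products r par J s" using w by simp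
  moreover from this have "s \<noteq> 0" using ne tX_products_0[of r par J] by (cases s) auto
  ultimately show ?thesis by (intro exI[of _ s]) auto
qed

text \<open>Squares of longer words are again products of the required shape. If a single odd letter
  is squared, normality excludes the letters of \<open>L\<close>, so only \<open>t t\<close> with
  \<open>t\<close> odd remains.\<close>

lemma normal_factor_basis_word:
  assumes "normal u" "set u \<subseteq> T" "dominant r u \<or> (\<exists>l. u = l @ l \<and> dominant r l \<and> word_parity par l = 1)"
  shows "u \<in> basis_words"
  using assms(3)
proof
  assume dom: "dominant r u"
  show ?thesis
  proof (cases "length u = 1")
    case True
    then show ?thesis using assms(2) by (auto simp: basis_words_def length_Suc_conv)
  next
    case False
    then show ?thesis
      using dominant_normal_tX[OF dom assms(1,2)] dominant_imp_lyndon_shirshov[OF dom]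
      by (auto simp: basis_words_def super_lyndon_shirshov_def)
  qed
next
  assume "\<exists>l. u = l @ l \<and> dominant r l \<and> word_parity par l = 1"
  then obtain l where l: "u = l @ l" "dominant r l" "word_parity par l = 1" by blast
  have nl: "normal l" "set l \<subseteq> T" using assms l(1) by (auto simp: normal_append)
  show ?thesis
  proof (cases "length l = 1")
    case True
    then obtain y where y: "l = [y]" by (auto simp: length_Suc_conv)
    then have "(y, y) \<notin> P" using assms(1) l(1) by (simp add: normal_Cons)
    then have "y = LT" using y l(3) nl Y_notin_P[of y y] r_neq by (fastforce simp: alphabet_def)
    moreover from this have "e = 1" using y l(3) by simp
    ultimately show ?thesis using y l(1) unfolding basis_words_def by simp
  next
    case False
    then obtain s where "s \<ge> 1" "l \<in> tX_products r par J s"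
      using dominant_normal_tX[OF l(2) nl] by blast
    then have "u \<in> tX_products r par J (s + s)" "s + s \<ge> 1" using l(1) tX_products_append by auto
    then show ?thesis
      using dominant_imp_lyndon_shirshov[OF l(2)] l unfolding basis_words_def super_lyndon_shirshov_def by blast
  qed
qed

section \<open>Products of bracketings along chains\<close>

definition chains :: "('i, 'j) letter list list set" where
  "chains = {ss. set ss \<subseteq> basis_words \<and> successively (\<lambda>u v. lex_less r u v \<or> u = v \<and> word_parity par u \<noteq> 1) ss}"

lemma products_span:
  assumes "p \<in> free_alg_on T"
  shows "\<exists>n\<in>assoc_ideal. p - n \<in> falg.span ((\<lambda>ss. prod_list (map bv ss)) ` chains)"
proof -
  let ?S = "falg.span ((\<lambda>ss. prod_list (map bv ss)) ` chains)"
  let ?G = "{u + v | u v. u \<in> ?S \<and> v \<in> assoc_ideal}"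
  have G: "falg.subspace ?G"
    by (rule falg.subspace_sums[OF falg.subspace_span assoc_ideal_subspace])
  have SG: "p \<in> ?G" if "p \<in> ?S" for p
    using that falg.subspace_0[OF assoc_ideal_subspace] by force
  have IG: "p \<in> ?G" if "p \<in> assoc_ideal" for p using that falg.span_zero by force
  have word: "set w \<subseteq> T \<Longrightarrow> wmono w \<in> ?G" for w
  proof (induction w rule: wf_induct_rule[OF wf_word_less[OF r_trans r_irrefl]])
    case (1 w)
    show ?case
    proof (cases "normal w")
      case True
      obtain ss where ss: "concat ss = w"
        "\<forall>u\<in>set ss. dominant r u \<or> (\<exists>l. u = l @ l \<and> dominant r l \<and> word_parity par l = 1)"
        "successively (\<lambda>u v. lex_less r u v \<or> u = v \<and> word_parity par u \<noteq> 1) ss"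
        using super_lyndon_factorization[OF r_trans r_irrefl r_total 1(2)] by blast
      have "u \<in> basis_words" if u: "u \<in> set ss" for u
      proof -
        obtain p q where "ss = p @ u # q" using u by (meson split_list)
        then have "normal u" "set u \<subseteq> T" using True 1(2) unfolding ss(1)[symmetric] by (auto simp: normal_append)
        then show ?thesis using ss(2) u normal_factor_basis_word by blast
      qed
      then have "ss \<in> chains" and bw: "set ss \<subseteq> basis_words" using ss(3) by (auto simp: chains_def)
      have "has_lead r (prod_list (map bv ss)) (concat ss)"
        using bw
      proof (induction ss)
        case (Cons u ss)
        then show ?case using basis_words_lead by (auto intro!: has_lead_mult[OF r_irrefl])
      qed (simp add: has_lead_Nil)
      then obtain c p' where p': "c \<noteq> 0" "prod_list (map bv ss) = fscale c (wmono w) + p'"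
        "\<And>k. k \<in> Poly_Mapping.keys p' \<Longrightarrow> mset k = mset w \<and> lex_less r k w"
        using ss(1) by (auto simp: has_lead_def)
      have "prod_list (map bv ss) \<in> ?S" using \<open>ss \<in> chains\<close> by (blast intro: falg.span_base)
      moreover have "p' \<in> ?G"
      proof (rule in_subspace_if_words[OF G])
        fix k assume "k \<in> Poly_Mapping.keys p'"
        then have k: "mset k = mset w" "lex_less r k w" using p'(3) by auto
        have "set k \<subseteq> T" using 1(2) mset_eq_setD[OF k(1)] by simp
        then show "wmono k \<in> ?G" using 1(1)[of k] k by (simp add: word_less_def)
      qed
      \<comment> \<open>The product along the factorization of \<open>w\<close> has leading word
        \<open>w\<close>, and its other words are smaller rearrangements covered by the induction;
        so \<open>w\<close> is solved for.\<close>
      ultimately have "fscale (1 / c) (prod_list (map bv ss) - p') \<in> ?G"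
        by (intro falg.subspace_scale[OF G falg.subspace_diff[OF G SG]])
      then show ?thesis using p' by simp
    next
      case False
      then obtain u y z v where w: "w = u @ [y, z] @ v" "(y, z) \<in> P" using not_normalD by blast
      have "wmono u * rhs y z * wmono v \<in> ?G"
      proof (rule in_subspace_if_words[OF G])
        fix k assume k: "k \<in> Poly_Mapping.keys (wmono u * rhs y z * wmono v)"
        have "set k \<subseteq> T"
          using k 1(2) w(1) rhs_letters[OF w(2)] by (fastforce dest!: keys_mult_words)
        then show "wmono k \<in> ?G" using 1(1)[of k] rhs_context_less[OF w(2) k] w(1) by simp
      qed
      moreover have "wmono u * rel y z * wmono v \<in> assoc_ideal"
        unfolding assoc_ideal_def using w(2) by (blast intro: falg.span_base)
      moreover have "wmono w = wmono u * rel y z * wmono v + wmono u * rhs y z * wmono v"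
        by (simp add: relator_def w(1) algebra_simps wmono_mult)
      ultimately show ?thesis using falg.subspace_add[OF G IG] by simp
    qed
  qed
  have "p \<in> ?G"
    by (rule in_subspace_if_words[OF G], rule word) (use assms in \<open>simp add: free_alg_on_def\<close>)
  then obtain u v where "p = u + v" "u \<in> ?S" "v \<in> assoc_ideal" by blast
  then show ?thesis by (intro bexI[of _ v]) simp_all
qed

end

section \<open>The basis of the Lie superalgebra\<close>

lemma graded_subspace_span:
  assumes "graded_subspace par V"
  shows "V \<subseteq> falg.span (V \<inter> (homogeneous par 0 \<union> homogeneous par 1))"
proof
  fix p assume "p \<in> V"
  then have "hom_part par i p \<in> V" for i using assms by (simp add: graded_subspace_iff)
  then have "hom_part par 0 p + hom_part par 1 p \<in> falg.span (V \<inter> (homogeneous par 0 \<union> homogeneous par 1))"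
    by (intro falg.span_add falg.span_base) auto
  then show "p \<in> falg.span (V \<inter> (homogeneous par 0 \<union> homogeneous par 1))"
    using hom_part_decomp[of p par] by simp
qed

lemma extend_homogeneous_basis:
  assumes "graded_subspace par V" "B \<subseteq> V \<inter> (homogeneous par 0 \<union> homogeneous par 1)" "falg.independent B"
  obtains B' where "B \<subseteq> B'" "B' \<subseteq> homogeneous par 0 \<union> homogeneous par 1" "falg.independent B'" "falg.span B' = V"
proof -
  let ?H = "V \<inter> (homogeneous par 0 \<union> homogeneous par 1)"
  obtain B' where B': "B \<subseteq> B'" "B' \<subseteq> ?H" "falg.independent B'" "?H \<subseteq> falg.span B'"
    using falg.maximal_independent_subset_extend[OF assms(2,3)] by blast
  have "falg.span B' = V"
  proof
    show "falg.span B' \<subseteq> V"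
      using B'(2) assms(1) by (intro falg.span_minimal) (auto simp: graded_subspace_iff)
    have "falg.span ?H \<subseteq> falg.span B'" using B'(4) by (simp add: falg.span_minimal)
    then show "V \<subseteq> falg.span B'" using graded_subspace_span[OF assms(1)] by blast
  qed
  with B' that show thesis by blast
qed

text \<open>On \<open>B\<close> the order has to be that of the words, so that chains turn into
  normal words; the remaining elements are placed above \<open>B\<close> in some well-order, as a
  total order on all letters is required.\<close>

lemma extend_word_order:
  fixes B :: "'b set" and f :: "'b \<Rightarrow> 'x list"
  assumes r: "trans r" "irrefl r" "total_on T r" and f: "inj_on f B" "\<And>p. p \<in> B \<Longrightarrow> set (f p) \<subseteq> T"
  obtains s :: "'b rel" where "strict_linear_order_on UNIV s"
    "\<And>p q. p \<in> B \<Longrightarrow> q \<in> B \<Longrightarrow> (p, q) \<in> s \<longleftrightarrow> lex_less r (f p) (f q)"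
proof -
  obtain w :: "'b rel" where "well_order_on UNIV w" using well_order_on by blast
  then have w: "strict_linear_order_on UNIV (w - Id)"
    by (intro strict_linear_order_on_diff_Id) (simp add: well_order_on_def)
  define s where "s = {(p, q). p \<in> B \<and> q \<in> B \<and> lex_less r (f p) (f q) \<or> p \<in> B \<and> q \<notin> B \<or> p \<notin> B \<and> q \<notin> B \<and> (p, q) \<in> w - Id}"
  have "trans s"
    using w unfolding s_def strict_linear_order_on_def by (auto intro!: transI dest: lex_less_trans[OF r(1)] transD)
  moreover have "irrefl s"
    unfolding s_def irrefl_def using lex_less_irrefl[OF r(2)] by auto
  moreover have "total_on UNIV s"
  proof (rule total_onI)
    fix p q :: 'b assume "p \<noteq> q"
    then have "p \<in> B \<Longrightarrow> q \<in> B \<Longrightarrow> lex_less r (f p) (f q) \<or> lex_less r (f q) (f p)"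
      using lex_less_total[OF r(3) f(2) f(2)] inj_onD[OF f(1)] by blast
    moreover have "(p, q) \<in> w - Id \<or> (q, p) \<in> w - Id"
      using w \<open>p \<noteq> q\<close> by (auto simp: strict_linear_order_on_def total_on_def)
    ultimately show "(p, q) \<in> s \<or> (q, p) \<in> s" unfolding s_def by blast
  qed
  ultimately have "strict_linear_order_on UNIV s" by (simp add: strict_linear_order_on_def)
  then show thesis by (rule that) (simp add: s_def)
qed

context hnn_bracketings
begin

lemma basis_independent_mod_W:
  assumes "finite t" "t \<subseteq> bv ` basis_words" "(\<Sum>v\<in>t. fscale (c v) v) \<in> W" "v \<in> t"
  shows "c v = 0"
proof -
  obtain K where K: "K \<subseteq> basis_words" "inj_on bv K" "t = bv ` K"
    using assms(2) by (auto simp: subset_image_inj)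
  then obtain u where "u \<in> K" "v = bv u" using assms(4) by blast
  moreover have "(\<Sum>u\<in>K. fscale (c (bv u)) (bv u)) \<in> assoc_ideal"
    using assms(3) K W_subset_assoc_ideal by (auto simp: sum.reindex)
  ultimately show ?thesis
    using bv_independent[of K "c \<circ> bv" u] K assms(1) by (simp add: finite_image_iff)
qed

lemma inj_on_bv: "inj_on bv basis_words"
proof (rule inj_onI, rule ccontr)
  fix u v assume uv: "u \<in> basis_words" "v \<in> basis_words" "bv u = bv v" "u \<noteq> v"
  have "(\<Sum>w\<in>{u, v}. fscale (if w = u then 1 else - 1) (bv w)) = 0"
    using uv by (simp add: fscale_minus_one)
  then have "(if u = u then 1 else - 1 :: 'k) = 0"
    using uv falg.subspace_0[OF assoc_ideal_subspace] by (intro bv_independent[of "{u, v}"]) auto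
  then show False by simp
qed

text \<open>Nested homogeneous bases \<open>W0\<close>, \<open>F0\<close>, \<open>G\<close> of
  \<open>W\<close>, \<open>F\<close> and the whole algebra are chosen with the bracketings in
  \<open>F0\<close> but outside \<open>W0\<close>. \<open>\<pi>\<close> keeps \<open>F0 - W0\<close>
  and kills the rest of \<open>G\<close>, so its image is a graded copy of \<open>H\<close> inside
  the free algebra.\<close>

lemma adapted_projection:
  obtains G and \<pi> :: "('k, ('i, 'j) letter) free_alg \<Rightarrow> ('k, ('i, 'j) letter) free_alg" where
    "falg.independent G" "falg.span G = UNIV" "G \<subseteq> homogeneous par 0 \<union> homogeneous par 1" "bv ` basis_words \<subseteq> G"
    "\<And>p q. \<pi> (p + q) = \<pi> p + \<pi> q" "\<And>c p. \<pi> (fscale c p) = fscale c (\<pi> p)"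
    "\<And>p. \<pi> p \<in> F" "\<And>p. p \<in> F \<Longrightarrow> p - \<pi> p \<in> W" "\<And>p. p \<in> W \<Longrightarrow> \<pi> p = 0" "\<And>p. \<pi> (\<pi> p) = \<pi> p"
    "\<And>p i. p \<in> homogeneous par i \<Longrightarrow> \<pi> p \<in> homogeneous par i" "\<And>u. u \<in> basis_words \<Longrightarrow> \<pi> (bv u) = bv u"
proof -
  have gW: "graded_subspace par W" using W_subspace W_hom_part by (simp add: graded_subspace_iff)
  have gF: "graded_subspace par F" using free_lie_subspace free_lie_hom_part by (auto simp: graded_subspace_iff)
  have gU: "graded_subspace par (UNIV :: ('k, ('i, 'j) letter) free_alg set)" by (simp add: graded_subspace_iff)
  let ?H = "homogeneous par 0 \<union> homogeneous par 1 :: ('k, ('i, 'j) letter) free_alg set"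
  let ?B = "bv ` basis_words"
  obtain W0 where W0: "W0 \<subseteq> ?H" "falg.independent W0" "falg.span W0 = W"
    by (rule extend_homogeneous_basis[OF gW empty_subsetI falg.independent_empty]) (rule that)
  have W0W: "W0 \<subseteq> W" using W0(3) falg.span_superset by blast
  have homB: "?B \<subseteq> ?H"
  proof (rule image_subsetI)
    fix u assume "u \<in> basis_words"
    note hom = bv_homogeneous[OF this]
    have "word_parity par u = 0 \<or> word_parity par u = 1" by (metis bit.exhaust)
    then show "bv u \<in> ?H" using hom by (elim disjE) (simp_all only: Un_iff simp_thms)
  qed
  have "falg.independent (W0 \<union> ?B)"
    unfolding falg.independent_explicit_module
  proof (intro allI impI)
    fix t c v
    assume t: "finite t" "t \<subseteq> W0 \<union> ?B" "(\<Sum>v\<in>t. fscale (c v) v) = 0" "v \<in> t"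
    let ?t1 = "t \<inter> ?B" and ?t2 = "t - ?B"
    have split: "(\<Sum>v\<in>t. fscale (c v) v) = (\<Sum>v\<in>?t1. fscale (c v) v) + (\<Sum>v\<in>?t2. fscale (c v) v)"
      using t(1) by (subst sum.union_disjoint[symmetric]) (auto intro: arg_cong[where f = "sum _"])
    have s2: "(\<Sum>v\<in>?t2. fscale (c v) v) \<in> W"
      by (intro falg.subspace_sum[OF W_subspace] falg.subspace_scale[OF W_subspace]) (use t(2) W0W in auto)
    have "(\<Sum>v\<in>?t1. fscale (c v) v) = - (\<Sum>v\<in>?t2. fscale (c v) v)"
      using t(3) unfolding split by (simp add: eq_neg_iff_add_eq_0)
    then have "(\<Sum>v\<in>?t1. fscale (c v) v) \<in> W" using falg.subspace_neg[OF W_subspace s2] by simp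
    then have 1: "c v = 0" if "v \<in> ?t1" for v
      using basis_independent_mod_W[of ?t1 c v] t(1) that by auto
    then have "(\<Sum>v\<in>?t1. fscale (c v) v) = 0" by (intro sum.neutral) auto
    then have 2: "(\<Sum>v\<in>?t2. fscale (c v) v) = 0" using t(3) split by simp
    show "c v = 0"
    proof (cases "v \<in> ?B")
      case False
      have "?t2 \<subseteq> W0" using t(2) by auto
      then show ?thesis using falg.independentD[OF W0(2) _ _ 2] t(1,4) False by auto
    qed (use 1 t(4) in auto)
  qed
  moreover have "W0 \<union> ?B \<subseteq> F \<inter> ?H" using W0(1) W0W W_subset_F homB bv_in_F by blast
  ultimately obtain F0 where F0: "W0 \<union> ?B \<subseteq> F0" "F0 \<subseteq> ?H" "falg.independent F0" "falg.span F0 = F"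
    using extend_homogeneous_basis[OF gF] by metis
  have "F0 \<subseteq> UNIV \<inter> ?H" using F0(2) by simp
  then obtain G where G: "F0 \<subseteq> G" "G \<subseteq> ?H" "falg.independent G" "falg.span G = UNIV"
    using extend_homogeneous_basis[OF gU _ F0(3)] by metis
  interpret vs: vector_space_pair "fscale :: 'k \<Rightarrow> ('k, ('i, 'j) letter) free_alg \<Rightarrow> _"
    "fscale :: 'k \<Rightarrow> ('k, ('i, 'j) letter) free_alg \<Rightarrow> _" ..
  obtain \<pi> where \<pi>: "Vector_Spaces.linear fscale fscale \<pi>" "\<And>v. v \<in> G \<Longrightarrow> \<pi> v = (if v \<in> F0 - W0 then v else 0)"
    using vs.linear_independent_extend[OF G(3), of "\<lambda>v. if v \<in> F0 - W0 then v else 0"] by blast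
  have add: "\<pi> (p + q) = \<pi> p + \<pi> q" and scale: "\<pi> (fscale c p) = fscale c (\<pi> p)" for p q c
    using \<pi>(1) by (simp_all add: vs.linear_add vs.linear_scale)
  have zero: "\<pi> 0 = 0" using scale[of 0 0] by simp
  have span_eq: "\<phi> p = \<psi> p" if "p \<in> falg.span S" "\<And>v. v \<in> S \<Longrightarrow> \<phi> v = \<psi> v"
    "\<And>p q c. \<phi> (fscale c p + q) = fscale c (\<phi> p) + \<phi> q" "\<And>p q c. \<psi> (fscale c p + q) = fscale c (\<psi> p) + \<psi> q"
    "\<phi> 0 = 0" "\<psi> 0 = 0" for \<phi> \<psi> :: "('k, ('i, 'j) letter) free_alg \<Rightarrow> ('k, ('i, 'j) letter) free_alg" and p S
    using that(1) by (induction rule: falg.span_induct_alt) (simp_all add: that)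
  have in_F: "\<pi> p \<in> F" for p
  proof -
    have "p \<in> falg.span G" using G(4) by simp
    then show ?thesis
    proof (induction rule: falg.span_induct_alt)
      case (step c v p)
      have "\<pi> v \<in> F"
        using \<pi>(2)[OF step(1)] falg.span_superset[of F0] F0(4) falg.subspace_0[OF free_lie_subspace] by auto
      then show ?case using step by (simp add: add scale falg.subspace_add[OF free_lie_subspace] falg.subspace_scale[OF free_lie_subspace])
    qed (simp add: zero falg.subspace_0[OF free_lie_subspace])
  qed
  have mod_W: "p - \<pi> p \<in> W" if "p \<in> F" for p
  proof -
    have "p \<in> falg.span F0" using that F0(4) by simp
    then show ?thesis
    proof (induction rule: falg.span_induct_alt)
      case (step c v p)
      have "v - \<pi> v \<in> W"
        using \<pi>(2)[OF subsetD[OF G(1) step(1)]] step(1) W0W falg.subspace_0[OF W_subspace] by auto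
      then have "fscale c (v - \<pi> v) + (p - \<pi> p) \<in> W"
        using step.IH by (simp add: falg.subspace_add[OF W_subspace] falg.subspace_scale[OF W_subspace])
      then show ?case by (simp add: add scale algebra_simps falg.scale_right_diff_distrib)
    qed (simp add: zero falg.subspace_0[OF W_subspace])
  qed
  have kill: "\<pi> p = 0" if "p \<in> W" for p
  proof (rule span_eq[of p W0 \<pi> "\<lambda>_. 0"])
    show "p \<in> falg.span W0" using that W0(3) by simp
  next
    fix v assume "v \<in> W0"
    then show "\<pi> v = 0" using \<pi>(2)[of v] F0(1) G(1) by auto
  qed (simp_all add: add scale zero)
  have idem: "\<pi> (\<pi> p) = \<pi> p" for p
  proof (rule span_eq[of p G "\<lambda>p. \<pi> (\<pi> p)" \<pi>])
    fix v assume "v \<in> G"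
    then show "\<pi> (\<pi> v) = \<pi> v" by (simp add: \<pi>(2) zero)
  qed (simp_all add: add scale zero G(4))
  have hom: "\<pi> p \<in> homogeneous par i" if "p \<in> homogeneous par i" for p i
  proof -
    have "hom_part par i (\<pi> p) = \<pi> (hom_part par i p)"
    proof (rule span_eq[of p G "\<lambda>p. hom_part par i (\<pi> p)" "\<lambda>p. \<pi> (hom_part par i p)"])
      fix v assume v: "v \<in> G"
      then obtain j where "v \<in> homogeneous par j" using G(2) by blast
      then show "hom_part par i (\<pi> v) = \<pi> (hom_part par i v)"
        using v by (simp add: \<pi>(2) hom_part_eq zero)
    qed (simp_all add: add scale zero G(4))
    then have "\<pi> p = hom_part par i (\<pi> p)" using that by (simp add: hom_part_eq)
    then show ?thesis by (metis hom_part_homogeneous)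
  qed
  have "\<pi> (bv u) = bv u" if "u \<in> basis_words" for u
  proof -
    have "bv u \<notin> W0"
    proof
      assume "bv u \<in> W0"
      then have "(\<Sum>v\<in>{bv u}. fscale ((\<lambda>_. 1) v) v) \<in> W" using W0W by auto
      then have "(1::'k) = 0" using basis_independent_mod_W[of "{bv u}" "\<lambda>_. 1" "bv u"] that by simp
      then show False by simp
    qed
    moreover have "bv u \<in> F0" using F0(1) that by blast
    ultimately show ?thesis using \<pi>(2)[OF subsetD[OF G(1)]] by simp
  qed
  moreover have "?B \<subseteq> G" using F0(1) G(1) by blast
  ultimately show thesis
    using that[of G \<pi>] G(2-4) add scale in_F mod_W kill idem hom by blast
qed

text \<open>Since \<open>free_lie\<close> modulo \<open>hnn_ideal\<close> is not a type, its bracket is carried over to the whole free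
  algebra along the projection \<open>\<pi>\<close>; the kernel of \<open>\<pi>\<close> becomes central.\<close>

lemma lie_superalgebra_projection:
  fixes \<pi> :: "('k, ('i, 'j) letter) free_alg \<Rightarrow> ('k, ('i, 'j) letter) free_alg"
  assumes add: "\<And>p q. \<pi> (p + q) = \<pi> p + \<pi> q" and scale: "\<And>c p. \<pi> (fscale c p) = fscale c (\<pi> p)"
    and in_F: "\<And>p. \<pi> p \<in> F" and mod_W: "\<And>p. p \<in> F \<Longrightarrow> p - \<pi> p \<in> W" and kill: "\<And>p. p \<in> W \<Longrightarrow> \<pi> p = 0"
    and idem: "\<And>p. \<pi> (\<pi> p) = \<pi> p" and hom: "\<And>p i. p \<in> homogeneous par i \<Longrightarrow> \<pi> p \<in> homogeneous par i"
  shows "lie_superalgebra fscale (homogeneous par) (\<lambda>p q. \<pi> (superbracket par (\<pi> p) (\<pi> q)))"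
    and "p \<in> F \<Longrightarrow> q \<in> F \<Longrightarrow> \<pi> (superbracket par (\<pi> p) (\<pi> q)) = \<pi> (superbracket par p q)"
proof -
  have diff: "\<pi> (p - q) = \<pi> p - \<pi> q" for p q
    using add[of "p - q" q] by (simp add: algebra_simps)
  have right: "\<pi> (superbracket par p (\<pi> q)) = \<pi> (superbracket par p q)" if "p \<in> F" "q \<in> F" for p q
  proof -
    have "\<pi> (superbracket par p (q - \<pi> q)) = 0"
      using that by (intro kill W_bracket mod_W)
    then show ?thesis by (simp add: diff)
  qed
  have left: "\<pi> (superbracket par (\<pi> p) q) = \<pi> (superbracket par p q)" if "p \<in> F" "q \<in> F" for p q
  proof -
    have "\<pi> (superbracket par (p - \<pi> p) q) = 0"
      using that by (intro kill W_bracket mod_W)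
    then show ?thesis by (simp add: diff)
  qed
  show "\<pi> (superbracket par (\<pi> p) (\<pi> q)) = \<pi> (superbracket par p q)" if "p \<in> F" "q \<in> F" for p q
    using that in_F by (simp add: left right)
  show "lie_superalgebra fscale (homogeneous par) (\<lambda>p q. \<pi> (superbracket par (\<pi> p) (\<pi> q)))"
  proof (intro lie_superalgebra.intro lie_superalgebra_axioms.intro)
    show "vector_space (fscale :: 'k \<Rightarrow> ('k, ('i, 'j) letter) free_alg \<Rightarrow> _)" ..
    show "homogeneous par 0 \<inter> homogeneous par 1 = {0 :: ('k, ('i, 'j) letter) free_alg}"
      using homogeneous_disjoint by (auto simp: homogeneous_def)
    show "\<exists>y\<in>homogeneous par 0. \<exists>z\<in>homogeneous par 1. v = y + z" for v :: "('k, ('i, 'j) letter) free_alg"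
      using hom_part_decomp[of v par] hom_part_homogeneous by blast
    show "\<pi> (superbracket par (\<pi> u) (\<pi> v)) \<in> homogeneous par (i + j)"
      if "u \<in> homogeneous par i" "v \<in> homogeneous par j" for u v i j
      using that by (intro hom superbracket_in_homogeneous)
    show "\<pi> (superbracket par (\<pi> u) (\<pi> v)) = fscale (- ssign i j) (\<pi> (superbracket par (\<pi> v) (\<pi> u)))"
      if "u \<in> homogeneous par i" "v \<in> homogeneous par j" for u v i j
      using superbracket_skew[OF hom[OF that(1)] hom[OF that(2)]] by (metis scale)
    show "\<pi> (superbracket par (\<pi> u) (\<pi> (\<pi> (superbracket par (\<pi> v) (\<pi> w))))) =
        \<pi> (superbracket par (\<pi> (\<pi> (superbracket par (\<pi> u) (\<pi> v)))) (\<pi> w)) +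
        fscale (ssign i j) (\<pi> (superbracket par (\<pi> v) (\<pi> (\<pi> (superbracket par (\<pi> u) (\<pi> w))))))"
      if "u \<in> homogeneous par i" "v \<in> homogeneous par j" "w \<in> homogeneous par m" for u v w i j m
      using superbracket_jacobi[OF hom[OF that(1)] hom[OF that(2)] hom[OF that(3)]] in_F
      by (simp add: idem left right free_lie_superbracket flip: add scale)
  qed (simp_all add: homogeneous_subspace add scale)
qed

text \<open>\<open>\<pi> f\<close> yields a linear form, already normal in the PBW algebra of the
  copy of \<open>H\<close>. Expanding \<open>f\<close> by \<open>products_span\<close> yields the
  same element as a combination of words spelled by chains. Words of a linear form have length one,
  so each chain that matters is a single basis word.\<close>

lemma free_lie_spanned:
  assumes f: "f \<in> F"
  shows "\<exists>n\<in>W. f - n \<in> falg.span (bv ` basis_words)"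
proof -
  obtain G \<pi> where G: "falg.independent G" "falg.span G = UNIV" "G \<subseteq> homogeneous par 0 \<union> homogeneous par 1"
    "bv ` basis_words \<subseteq> G"
    and \<pi>: "\<And>p q. \<pi> (p + q) = \<pi> p + \<pi> q" "\<And>c p. \<pi> (fscale c p) = fscale c (\<pi> p)"
    "\<And>p. \<pi> p \<in> F" "\<And>p. p \<in> F \<Longrightarrow> p - \<pi> p \<in> W" "\<And>p. p \<in> W \<Longrightarrow> \<pi> p = 0" "\<And>p. \<pi> (\<pi> p) = \<pi> p"
    "\<And>p i. p \<in> homogeneous par i \<Longrightarrow> \<pi> p \<in> homogeneous par i" "\<And>u. u \<in> basis_words \<Longrightarrow> \<pi> (bv u) = bv u"
    by (rule adapted_projection) blast
  note lie = lie_superalgebra_projection[OF \<pi>(1-7)]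
  let ?B = "bv ` basis_words"
  let ?br = "\<lambda>p q. \<pi> (superbracket par (\<pi> p) (\<pi> q))"
  have word: "the_inv_into basis_words bv (bv u) = u" if "u \<in> basis_words" for u
    using that by (rule the_inv_into_f_f[OF inj_on_bv])
  have inj: "inj_on (the_inv_into basis_words bv) ?B" by (rule inj_on_the_inv_into[OF inj_on_bv])
  have letters: "set (the_inv_into basis_words bv p) \<subseteq> T" if p: "p \<in> ?B" for p
  proof -
    obtain u where "u \<in> basis_words" "p = bv u" using p by blast
    then show ?thesis using basis_words_normal(1)[of u] word[of u] by simp
  qed
  obtain s where s: "strict_linear_order_on UNIV s"
    "\<And>p q. p \<in> ?B \<Longrightarrow> q \<in> ?B \<Longrightarrow> (p, q) \<in> s \<longleftrightarrow> lex_less r (the_inv_into basis_words bv p) (the_inv_into basis_words bv q)"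
    by (rule extend_word_order[OF r_trans r_irrefl r_total inj letters], assumption) (rule that)
  define r' :: "(('k, ('i, 'j) letter) free_alg, unit) letter rel" where
    "r' = {(LA p, LA q) | p q. (p, q) \<in> s} \<union> {(LA p, LT) | p. True}"
  have r': "strict_linear_order_on (alphabet G {}) r'"
    using s(1) unfolding strict_linear_order_on_def r'_def
    by (auto simp: alphabet_def A_letters_def X_letters_def irrefl_def total_on_def intro!: transI dest: transD)
  have vs: "lie_superalgebra fscale (homogeneous par) ?br" by (rule lie(1))
  \<comment> \<open>The subalgebra is the whole algebra with basis \<open>G\<close>, the complement
    is zero and the derivation is zero. The stable letter remains as an even largest letter, absent
    from the words considered.\<close>
  interpret L: hnn_data fscale "homogeneous par" ?br UNIV 0 "\<lambda>_. 0" "\<lambda>p. p" G "{0}" "\<lambda>_::unit. 0" "{}" r'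
  proof (intro hnn_data.intro hnn_data_axioms.intro vs char r')
    show "lie_subalgebra fscale (homogeneous par) ?br UNIV"
      using lie_superalgebra.gr_spans[OF vs] by (auto simp: lie_subalgebra_def)
    have "\<pi> 0 = 0" using \<pi>(2)[of 0 0] by simp
    then show "superderivation fscale (homogeneous par) ?br UNIV 0 (\<lambda>_. 0)"
      using falg.subspace_0[OF homogeneous_subspace] by (auto simp: superderivation_def)
    show "homogeneous_basis fscale (homogeneous par) UNIV (\<lambda>p. p) G"
      using G by (auto simp: homogeneous_basis_def)
    show "complementary UNIV {0 :: ('k, ('i, 'j) letter) free_alg}" by (auto simp: complementary_def)
    show "homogeneous_basis fscale (homogeneous par) {0 :: ('k, ('i, 'j) letter) free_alg} (\<lambda>_::unit. 0) {}"
      by (simp add: homogeneous_basis_def falg.independent_empty)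
  qed (auto simp: r'_def)
  have lin_G: "L.lin v = wmono [LA v]" if "v \<in> G" for v
    using L.lin_val[of "LA v"] that by (simp add: A_letters_def)
  have NF_lin: "L.NF (L.lin v) = L.lin v" for v
  proof -
    have "L.NF (L.lin v) = lin_ext wmono (L.lin v)"
    proof (rule lin_ext_cong)
      fix w assume "w \<in> Poly_Mapping.keys (L.lin v)"
      then have "L.normal w" using L.keys_lin by (fastforce simp: L.normal_Cons)
      then show "L.nf w = wmono w" by simp
    qed
    then show ?thesis by simp
  qed
  note I_closed = falg.subspace_0[OF L.assoc_ideal_subspace] falg.subspace_add[OF L.assoc_ideal_subspace]
    falg.subspace_diff[OF L.assoc_ideal_subspace] falg.subspace_scale[OF L.assoc_ideal_subspace]
  \<comment> \<open>Each letter of \<open>T\<close> goes to the linear form of its class in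
    \<open>H\<close>; on \<open>F\<close> this agrees with \<open>\<pi>\<close> followed by
    \<open>L.lin\<close>, modulo the ideal.\<close>
  define \<Phi> where "\<Phi> = alg_hom (\<lambda>z. L.lin (\<pi> (wmono [z])))"
  have \<Phi>_F: "L.lin (\<pi> q) - \<Phi> q \<in> L.assoc_ideal" if "q \<in> F" for q
    unfolding \<Phi>_def
  proof (rule free_lie_hom_unique[where T = T and par = par and M = UNIV and \<theta> = "\<lambda>q. L.lin (\<pi> q)"])
    fix p q i j
    assume pq: "p \<in> F" "q \<in> F" "p \<in> homogeneous par i" "q \<in> homogeneous par j"
    have "L.lin (\<pi> p) * L.lin (\<pi> q) - fscale (ssign i j) (L.lin (\<pi> q) * L.lin (\<pi> p)) - L.lin (?br (\<pi> p) (\<pi> q)) \<in> L.assoc_ideal"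
      using L.lin_br[OF \<pi>(7)[OF pq(3)] \<pi>(7)[OF pq(4)]] L.defects_subset_assoc_ideal by blast
    moreover have "?br (\<pi> p) (\<pi> q) = \<pi> (superbracket par p q)"
      using lie(2)[OF _ _ _ pq(1,2)] by (simp add: \<pi>(6))
    ultimately have "L.lin (\<pi> p) * L.lin (\<pi> q) - fscale (ssign i j) (L.lin (\<pi> q) * L.lin (\<pi> p))
        - L.lin (\<pi> (superbracket par p q)) \<in> L.assoc_ideal" by simp
    from falg.subspace_neg[OF L.assoc_ideal_subspace this]
    show "L.lin (\<pi> (superbracket par p q))
        - (L.lin (\<pi> p) * L.lin (\<pi> q) - fscale (ssign i j) (L.lin (\<pi> q) * L.lin (\<pi> p))) \<in> L.assoc_ideal" by simp
  qed (use that L.assoc_ideal_mult in \<open>auto simp: L.assoc_ideal_subspace \<pi>(1,2) L.lin_add L.lin_scale I_closed\<close>)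
  have \<Phi>_W: "\<Phi> q \<in> L.assoc_ideal" if "q \<in> W" for q
    using I_closed(3)[OF I_closed(1) \<Phi>_F[of q]] that W_subset_F \<pi>(5)[OF that] by auto
  have \<Phi>_ideal: "\<Phi> p \<in> L.assoc_ideal" if "p \<in> assoc_ideal" for p
    using that unfolding assoc_ideal_def
  proof (induction rule: falg.span_induct_alt)
    case base
    then show ?case by (simp add: \<Phi>_def I_closed)
  next
    case (step c t p)
    then obtain u y z v where t: "t = wmono u * rel y z * wmono v" "(y, z) \<in> P" by blast
    have "\<Phi> t = \<Phi> (wmono u) * \<Phi> (rel y z) * \<Phi> (wmono v)" by (simp add: t \<Phi>_def)
    then have "\<Phi> t \<in> L.assoc_ideal" using \<Phi>_W[OF relator_in_W[OF t(2)]] by (simp add: L.assoc_ideal_mult)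
    then show ?case using step.IH I_closed by (simp add: \<Phi>_def)
  qed
  \<comment> \<open>Since \<open>\<pi>\<close> fixes \<open>bv u\<close> and \<open>bv u\<close>
    belongs to \<open>G\<close>, every factor becomes a single letter modulo the ideal; the order
    \<open>s\<close> makes the resulting word normal.\<close>
  have chain: "L.NF (\<Phi> (prod_list (map bv ss))) = wmono (map (\<lambda>u. LA (bv u)) ss)" if ss: "ss \<in> chains" for ss
  proof -
    have bw: "set ss \<subseteq> basis_words" using ss by (simp add: chains_def)
    then have "wmono (map (\<lambda>u. LA (bv u)) ss) - \<Phi> (prod_list (map bv ss)) \<in> L.assoc_ideal"
    proof (induction ss)
      case Nil
      have "\<Phi> (wmono []) = wmono []" unfolding \<Phi>_def alg_hom_wmono by (simp add: wmono_Nil)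
      then have "wmono (map (\<lambda>u. LA (bv u)) []) - \<Phi> (prod_list (map bv [])) = 0"
        by (simp add: wmono_Nil[symmetric] del: single_one)
      then show ?case using I_closed(1) by (simp only:)
    next
      case (Cons u ss)
      have u: "u \<in> basis_words" using Cons.prems by simp
      have "wmono [LA (bv u)] - \<Phi> (bv u) \<in> L.assoc_ideal"
        using \<Phi>_F[OF bv_in_F[OF u]] lin_G[of "bv u"] u G(4) \<pi>(8)[OF u] by auto
      then have "(wmono [LA (bv u)] - \<Phi> (bv u)) * wmono (map (\<lambda>u. LA (bv u)) ss)
          + \<Phi> (bv u) * (wmono (map (\<lambda>u. LA (bv u)) ss) - \<Phi> (prod_list (map bv ss))) \<in> L.assoc_ideal"
        using Cons by (intro I_closed(2) L.assoc_ideal_mult) auto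
      then show ?case by (simp add: \<Phi>_def algebra_simps wmono_mult)
    qed
    then have "L.NF (wmono (map (\<lambda>u. LA (bv u)) ss) - \<Phi> (prod_list (map bv ss))) = 0"
      by (rule L.NF_assoc_ideal)
    moreover have "L.normal (map (\<lambda>u. LA (bv u)) ss)"
    proof -
      have "(LA (bv u), LA (bv v)) \<notin> L.P"
        if uv: "u \<in> basis_words" "v \<in> basis_words" and less: "lex_less r u v \<or> u = v \<and> word_parity par u \<noteq> 1" for u v
      proof
        assume "(LA (bv u), LA (bv v)) \<in> L.P"
        then have "(LA (bv v), LA (bv u)) \<in> r' \<or> LA (bv u) = (LA (bv v) :: (_, unit) letter) \<and> L.par (LA (bv u)) = 1"
          unfolding L.P_def by simp
        then consider "(bv v, bv u) \<in> s" | "bv u = bv v" "L.par (LA (bv u)) = 1"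
          by (auto simp: r'_def)
        then show False
        proof cases
          case 1
          then have "lex_less r v u" using s(2)[of "bv v" "bv u"] uv word by auto
          then show False using less lex_less_trans[OF r_trans] lex_less_irrefl[OF r_irrefl] by blast
        next
          case 2
          then have "u = v" using inj_onD[OF inj_on_bv] uv by blast
          then have "word_parity par u = 0" using less lex_less_irrefl[OF r_irrefl] by auto
          then have "bv u \<in> homogeneous par 0" using bv_homogeneous[OF uv(1)] by simp
          then show False using 2(2) by (simp add: parity_of_def)
        qed
      qed
      then show ?thesis
        unfolding L.normal_def successively_map
        using ss bw unfolding chains_def by (auto elim!: successively_mono)
    qed
    ultimately show ?thesis by simp
  qed
  have "f \<in> free_alg_on T" using f free_lie_subset by blast
  then obtain n where n: "n \<in> assoc_ideal" "f - n \<in> falg.span ((\<lambda>ss. prod_list (map bv ss)) ` chains)"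
    using products_span by blast
  have "L.lin (\<pi> f) = L.NF (\<Phi> (f - n))"
  proof -
    have "L.NF (L.lin (\<pi> f) - \<Phi> f) = 0" "L.NF (\<Phi> n) = 0"
      by (rule L.NF_assoc_ideal[OF \<Phi>_F[OF f]], rule L.NF_assoc_ideal[OF \<Phi>_ideal[OF n(1)]])
    then show ?thesis using NF_lin by (simp add: \<Phi>_def)
  qed
  moreover have "L.NF (\<Phi> p) \<in> falg.span ((\<lambda>ss. wmono (map (\<lambda>u. LA (bv u)) ss)) ` chains)"
    if "p \<in> falg.span ((\<lambda>ss. prod_list (map bv ss)) ` chains)" for p
    using that
  proof (induction rule: falg.span_induct_alt)
    case (step c t p)
    then obtain ss where "t = prod_list (map bv ss)" "ss \<in> chains" by blast
    then have "L.NF (\<Phi> t) \<in> falg.span ((\<lambda>ss. wmono (map (\<lambda>u. LA (bv u)) ss)) ` chains)"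
      using chain by (auto intro!: falg.span_base)
    then show ?case using step.IH by (simp add: \<Phi>_def falg.span_add falg.span_scale)
  qed (simp add: \<Phi>_def falg.span_zero)
  ultimately have span: "L.lin (\<pi> f) \<in> falg.span ((\<lambda>ss. wmono (map (\<lambda>u. LA (bv u)) ss)) ` chains)"
    using n(2) by simp
  have "Poly_Mapping.keys q \<subseteq> (\<lambda>ss. map (\<lambda>u. LA (bv u)) ss) ` chains"
    if "q \<in> falg.span ((\<lambda>ss. wmono (map (\<lambda>u. LA (bv u)) ss)) ` chains)"
    for q :: "('k, (('k, ('i, 'j) letter) free_alg, unit) letter) free_alg"
    using that
  proof (induction rule: falg.span_induct_alt)
    case (step c t p)
    then show ?case by (auto dest!: subsetD[OF keys_add] subsetD[OF keys_fscale_subset])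
  qed simp
  then have keys: "Poly_Mapping.keys (L.lin (\<pi> f)) \<subseteq> (\<lambda>ss. map (\<lambda>u. LA (bv u)) ss) ` chains"
    using span by blast
  \<comment> \<open>A left inverse of \<open>L.lin\<close>, reading the letter \<open>LA v\<close>
    as the element \<open>v\<close>. The default 0 is not reached, as every word of such a linear
    form is a single letter \<open>LA v\<close>.\<close>
  let ?back = "lin_ext (\<lambda>w. case hd w of LA v \<Rightarrow> v | _ \<Rightarrow> 0)"
  have "?back (L.lin p) = p" for p
  proof -
    have "p \<in> falg.span G" using G(2) by simp
    then show ?thesis
      by (induction rule: falg.span_induct_alt) (simp_all add: L.lin_add L.lin_scale lin_G)
  qed
  moreover have "?back (L.lin (\<pi> f)) \<in> falg.span ?B"
  proof (rule lin_ext_in_subspace[OF falg.subspace_span])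
    fix w assume w: "w \<in> Poly_Mapping.keys (L.lin (\<pi> f))"
    obtain ss where ss: "ss \<in> chains" "w = map (\<lambda>u. LA (bv u)) ss" using keys w by blast
    obtain y where "w = [y]" using L.keys_lin[OF w] by blast
    then obtain u where "ss = [u]" "w = [LA (bv u)]" using ss(2) by (cases ss) auto
    then show "(case hd w of LA v \<Rightarrow> v | _ \<Rightarrow> 0) \<in> falg.span ?B"
      using ss(1) by (auto simp: chains_def intro!: falg.span_base)
  qed
  ultimately have "\<pi> f \<in> falg.span ?B" by simp
  then show ?thesis using \<pi>(4)[OF f] by (intro bexI[of _ "f - \<pi> f"]) auto
qed

theorem lie_basis:
  "is_basis hnn (\<lambda>m. cl (bracket_value par m)) (hnn_basis_monomials r par I J bk)"
  unfolding hnn_basis_monomials_eq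
proof (rule is_basis_quotient[where M = F and N = W])
  fix m assume "m \<in> monomial_of bk ` basis_words"
  then show "bracket_value par m \<in> F" using bv_in_F by auto
next
  fix K c m
  assume K: "finite K" "K \<subseteq> monomial_of bk ` basis_words" "(\<Sum>m\<in>K. fscale (c m) (bracket_value par m)) \<in> W" "m \<in> K"
  obtain K0 where K0: "K0 \<subseteq> basis_words" "inj_on (monomial_of bk) K0" "K = monomial_of bk ` K0"
    using K(2) by (auto simp: subset_image_inj)
  then obtain u where u: "u \<in> K0" "m = monomial_of bk u" using K(4) by blast
  have "(\<Sum>u\<in>K0. fscale ((c \<circ> monomial_of bk) u) (bv u)) \<in> assoc_ideal"
    using K(3) K0 W_subset_assoc_ideal by (auto simp: sum.reindex)
  then have "(c \<circ> monomial_of bk) u = 0"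
    using K0 K(1) u by (intro bv_independent[of K0]) (auto simp: finite_image_iff)
  then show "c m = 0" using u by simp
next
  fix f assume "f \<in> F"
  then show "\<exists>n\<in>W. f - n \<in> falg.span (bracket_value par ` monomial_of bk ` basis_words)"
    using free_lie_spanned by (simp add: image_image)
qed (simp_all add: W_subspace hnn_simps hnn_extension_def lie_quotient_def)

end

theorem theorem4p2:
  fixes scale :: "'k::field \<Rightarrow> 'l::ab_group_add \<Rightarrow> 'l"
    and gr :: "bit \<Rightarrow> 'l set"
    and br :: "'l \<Rightarrow> 'l \<Rightarrow> 'l"
    and A :: "'l set"
    and e :: bit
    and d :: "'l \<Rightarrow> 'l"
    and a :: "'i \<Rightarrow> 'l" and I :: "'i set"
    and C :: "'l set"
    and x :: "'j \<Rightarrow> 'l" and J :: "'j set"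
    and r :: "('i, 'j) letter rel"
  assumes char: "CHAR('k) \<noteq> 2" "CHAR('k) \<noteq> 3"
    and L: "lie_superalgebra scale gr br"
    and A: "lie_subalgebra scale gr br A" "A \<noteq> UNIV"
    and d: "superderivation scale gr br A e d"
    and a: "homogeneous_basis scale gr A a I"
    and C: "module.subspace scale C" "complementary A C"
    and x: "homogeneous_basis scale gr C x J"
    and r: "strict_linear_order_on (alphabet I J) r"
      "\<And>i j. i \<in> I \<Longrightarrow> j \<in> J \<Longrightarrow> (LA i, LX j) \<in> r"
      "\<And>i. i \<in> I \<Longrightarrow> (LA i, LT) \<in> r"
      "\<And>j. j \<in> J \<Longrightarrow> (LX j, LT) \<in> r"
  shows
    "let T = alphabet I J;
         par = letter_parity gr a x e;
         H = hnn_extension scale gr br e d a I x J;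
         image = coset (hnn_ideal scale gr br e d a I x J)
     in is_basis (enveloping H)
          (\<lambda>w. env_product H (map (\<lambda>z. image (wmono [z])) w))
          (env_basis_words r par I J)
        \<and>
        (\<forall>bk. (\<forall>u. set u \<subseteq> T \<and> super_lyndon_shirshov r par u
                 \<longrightarrow> admissible TYPE('k) r par u (bk u))
           \<longrightarrow> is_basis H (\<lambda>m. image (bracket_value par m))
                 (hnn_basis_monomials r par I J bk))"
proof -
  interpret hnn_data scale gr br A e d a I C x J r
    using assms by (intro hnn_data.intro hnn_data_axioms.intro) auto
  have "is_basis hnn (\<lambda>m. cl (bracket_value par m)) (hnn_basis_monomials r par I J bk)"
    if "\<And>u. set u \<subseteq> T \<Longrightarrow> super_lyndon_shirshov r par u \<Longrightarrow> admissible TYPE('k) r par u (bk u)" for bk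
  proof -
    interpret hnn_bracketings scale gr br A e d a I C x J r bk
      using that by unfold_locales
    show ?thesis by (rule lie_basis)
  qed
  then show ?thesis
    unfolding Let_def using enveloping_basis by blast
qed

end
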